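(* Let $Q$ be a non-degenerate isotropic quadratic form in $3$ variables over $K_\nu$ and let $H_Q=\{g\in G: Q\circ g=Q\}$. If $x\in G/\Gamma$ is such that the closure $\overline{H_Qx}$ is compact, then $H_Qx=\overline{H_Qx}$ (i.e. the orbit $H_Qx$ is closed, hence compact).
   Context: $K$ is a global function field of characteristic $\mathfrak{p}\neq 2$, $\nu$ a place of $K$, $K_\nu\cong\mathbb{F}_{\mathfrak{q}}((\theta^{-1}))$ the completion, $\mathcal{O}_\nu$ the ring of $\nu$-integers of $K$ (elements of $K$ integral at all places other than $\nu$). $G=\mathrm{SL}_3(K_\nu)$, $\Gamma=\mathrm{SL}_3(\mathcal{O}_\nu)$, and $G/\Gamma$ carries the quotient topology (it is identified with the space of free $\mathcal{O}_\nu$-modules of determinant one in $K_\nu^3$). *)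

theory Defs
  imports "HOL-Analysis.Analysis" "HOL-Computational_Algebra.Polynomial"
begin

text \<open>All fields live inside an ambient field type 'k, which plays the role of the
completion K_nu; the global function field K is a subfield (carrier set) of it.\<close>

definition subfield :: "'k::field set \<Rightarrow> bool" where
  "subfield K \<longleftrightarrow> 0 \<in> K \<and> 1 \<in> K \<and>
     (\<forall>x\<in>K. \<forall>y\<in>K. x + y \<in> K \<and> x - y \<in> K \<and> x * y \<in> K) \<and>
     (\<forall>x\<in>K. x \<noteq> 0 \<longrightarrow> inverse x \<in> K)"

definition prime_subfield :: "'k::field set" where
  "prime_subfield = range of_int"

definition poly_over :: "'k::field set \<Rightarrow> 'k poly \<Rightarrow> bool" where
  "poly_over F p \<longleftrightarrow> (\<forall>i. coeff p i \<in> F)"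

definition transcendental_prime :: "'k::field \<Rightarrow> bool" where
  "transcendental_prime t \<longleftrightarrow>
     (\<forall>p. p \<noteq> 0 \<and> poly_over prime_subfield p \<longrightarrow> poly p t \<noteq> 0)"

definition rat_fun_field :: "'k::field \<Rightarrow> 'k set" where
  "rat_fun_field t = {poly p t / poly q t | p q.
      poly_over prime_subfield p \<and> poly_over prime_subfield q \<and> poly q t \<noteq> 0}"

definition global_function_field :: "'k::field set \<Rightarrow> bool" where
  "global_function_field K \<longleftrightarrow> subfield K \<and> CHAR('k) > 0 \<and>
     (\<exists>t\<in>K. transcendental_prime t \<and>
        (\<exists>B. finite B \<and> B \<subseteq> K \<and>
           K \<subseteq> {\<Sum>b\<in>B. c b * b | c. \<forall>b\<in>B. c b \<in> rat_fun_field t}))"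

text \<open>A normalized discrete valuation on the subfield K (values on nonzero elements).
Places of a global function field correspond bijectively to these.\<close>
definition normalized_discrete_valuation :: "'k::field set \<Rightarrow> ('k \<Rightarrow> int) \<Rightarrow> bool" where
  "normalized_discrete_valuation K w \<longleftrightarrow>
     (\<forall>x\<in>K-{0}. \<forall>y\<in>K-{0}. w (x * y) = w x + w y) \<and>
     (\<forall>x\<in>K-{0}. \<forall>y\<in>K-{0}. x + y \<noteq> 0 \<longrightarrow> w (x + y) \<ge> min (w x) (w y)) \<and>
     w ` (K - {0}) = UNIV"

text \<open>Valuation balls: {y. |y - x|_v < q^(-n)}, with v(0) = infinity.\<close>
definition vball :: "('k::field \<Rightarrow> int) \<Rightarrow> 'k \<Rightarrow> int \<Rightarrow> 'k set" where
  "vball v x n = {y. y = x \<or> v (y - x) > n}"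

definition is_completion :: "'k::field set \<Rightarrow> ('k \<Rightarrow> int) \<Rightarrow> bool" where
  "is_completion K v \<longleftrightarrow>
     normalized_discrete_valuation UNIV v \<and> normalized_discrete_valuation K v \<and>
     (\<forall>s::nat \<Rightarrow> 'k. (\<forall>n. \<exists>N. \<forall>m\<ge>N. \<forall>k\<ge>N. s m \<in> vball v (s k) n)
        \<longrightarrow> (\<exists>L. \<forall>n. \<exists>N. \<forall>m\<ge>N. s m \<in> vball v L n)) \<and>
     (\<forall>x n. \<exists>y\<in>K. y \<in> vball v x n)"

definition nu_integers :: "'k::field set \<Rightarrow> ('k \<Rightarrow> int) \<Rightarrow> 'k set" where
  "nu_integers K v = {x \<in> K. \<forall>w. normalized_discrete_valuation K w \<and>
        (\<exists>y\<in>K-{0}. w y \<noteq> v y) \<longrightarrow> (x = 0 \<or> w x \<ge> 0)}"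

definition SL3 :: "'k::field set \<Rightarrow> ('k^3^3) set" where
  "SL3 R = {A. det A = 1 \<and> (\<forall>i j. A $ i $ j \<in> R)}"

definition G_topology :: "('k::field \<Rightarrow> int) \<Rightarrow> ('k^3^3) topology" where
  "G_topology v = subtopology
     (topology (\<lambda>U. \<forall>A\<in>U. \<exists>n. {B. \<forall>i j. B $ i $ j \<in> vball v (A $ i $ j) n} \<subseteq> U))
     (SL3 UNIV)"

definition left_coset :: "'k::field^3^3 \<Rightarrow> ('k^3^3) set \<Rightarrow> ('k^3^3) set" where
  "left_coset g S = (\<lambda>s. g ** s) ` S"

definition coset_space :: "('k::field^3^3) set \<Rightarrow> ('k^3^3) set \<Rightarrow> ('k^3^3) set set" where
  "coset_space G \<Gamma> = {left_coset g \<Gamma> | g. g \<in> G}"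

definition quotient_top :: "('a set) \<Rightarrow> 'a topology \<Rightarrow> 'a set set \<Rightarrow> ('a set) topology" where
  "quotient_top G X Q = topology (\<lambda>S. S \<subseteq> Q \<and> openin X (\<Union>S))"

definition homogeneous_space :: "'k::field set \<Rightarrow> ('k \<Rightarrow> int) \<Rightarrow> ('k^3^3) set topology" where
  "homogeneous_space K v = quotient_top (SL3 UNIV) (G_topology v)
      (coset_space (SL3 UNIV) (SL3 (nu_integers K v)))"

definition orbit :: "('k::field^3^3) set \<Rightarrow> ('k^3^3) set \<Rightarrow> ('k^3^3) set set" where
  "orbit H x = {left_coset h x | h. h \<in> H}"

text \<open>Quadratic form with symmetric Gram matrix B (char /= 2): Q(y) = y^T B y.\<close>
definition qform :: "'k::field^3^3 \<Rightarrow> 'k^3 \<Rightarrow> 'k" where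
  "qform B y = (\<Sum>i\<in>UNIV. \<Sum>j\<in>UNIV. B $ i $ j * y $ i * y $ j)"

definition nondegenerate_qf :: "'k::field^3^3 \<Rightarrow> bool" where
  "nondegenerate_qf B \<longleftrightarrow> det B \<noteq> 0"

definition isotropic_qf :: "'k::field^3^3 \<Rightarrow> bool" where
  "isotropic_qf B \<longleftrightarrow> (\<exists>y. y \<noteq> 0 \<and> qform B y = 0)"

definition stabilizer_qf :: "'k::field^3^3 \<Rightarrow> ('k^3^3) set" where
  "stabilizer_qf B = {g \<in> SL3 UNIV. \<forall>y. qform B (g *v y) = qform B y}"

end

theory Submission
  imports Defs
begin

text \<open>In suitable coordinates the form is $y^2 - 2xz$, which is invariant under a one-parameter
  unipotent group $U$. On the lattices in the compact orbit closure its values at nonzero lattice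
  vectors are bounded away from zero: a short value could be turned into a short vector by the
  stabiliser. If the orbit is not closed, the points of its closure that are accumulated from outside
  of their own orbit form a nonempty closed invariant set. Let $Y$ be a minimal $U$-invariant
  closed subset and $C$ the set of all $c$ for which $y^2 - 2xz + cz^2$ obeys the same lower bound
  on the lattices in $Y$. A rational function with nonzero derivative cannot take all its values
  in $C$, since the ratios of the form to $z^2$ on lattice vectors are dense enough for a Hensel
  argument. On the other hand, pulling the form back along the displacement between two close
  points and shearing it by $U$ gives, after rescaling, polynomials with values in $C$. Applied
  to an accumulated point this yields a nonzero element of $C$, and applied to a recurrence of $U$
  on $Y$ it yields a contradiction. In characteristic $3$ the additive limits $ct^3$ have
  zero derivative and must be split off first.\<close>

section \<open>Discretely valued fields\<close>

text \<open>The symmetric matrices fixed by all of \<open>upper_unip\<close> belong to a (y^2 - 2xz)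
  + c z^2, and the determinant pins a. So whatever survives a long shear of a nearby form is a
  \<open>normal_form c\<close>, and the argument takes place on the line of these forms.

  One nonzero point of that line is not yet absurd. A recurrence may displace the points of Y by
  elements of the stabiliser, which leave the form unchanged; such a displacement shows up only as a
  fractional linear change of the time of the flow, and it multiplies a parameter c by a nonconstant
  m^-4. This is invisible for c = 0, so a nonzero parameter has to be produced beforehand.

  The arithmetic of K has one source, linear dependences over F_p[T] found by counting. They yield
  the finiteness of the residue field, the discreteness of the places that are constructed, and
  denominators for the elements of K. That some \<nu>-integer has a pole at \<nu>, usually a
  consequence of Riemann-Roch, is read off from the compactness of the orbit closure.\<close>

lemma powi_le: "(2::real) powi m \<le> 2 powi n \<longleftrightarrow> m \<le> n"
  by (metis linorder_not_le nle_le one_less_numeral_iff order_less_imp_le power_int_increasing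
      power_int_strict_increasing semiring_norm(76))

lemma powi_less: "(2::real) powi m < 2 powi n \<longleftrightarrow> m < n"
  using powi_le[of n m] by linarith

locale discrete_valued_field =
  fixes v :: "'k::field \<Rightarrow> int"
  assumes valuation: "normalized_discrete_valuation UNIV v"
begin

text \<open>Base 2 replaces the residue cardinality. Any base above 1 yields the same topology; with
  2 a uniformizer has norm 1/2, and a norm below 1 is at most 1/2.\<close>

definition vnorm :: "'k \<Rightarrow> real"
  where "vnorm x = (if x = 0 then 0 else 2 powi (- v x))"

lemma v_mult: "x \<noteq> 0 \<Longrightarrow> y \<noteq> 0 \<Longrightarrow> v (x * y) = v x + v y"
  using valuation by (auto simp: normalized_discrete_valuation_def)

lemma v_add: "x \<noteq> 0 \<Longrightarrow> y \<noteq> 0 \<Longrightarrow> x + y \<noteq> 0 \<Longrightarrow> min (v x) (v y) \<le> v (x + y)"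
  using valuation unfolding normalized_discrete_valuation_def by auto

lemma v_surj: "\<exists>x. x \<noteq> 0 \<and> v x = n"
proof -
  have "v ` (UNIV - {0}) = UNIV"
    using valuation unfolding normalized_discrete_valuation_def by simp
  then have "n \<in> v ` (UNIV - {0})" by simp
  then show ?thesis by auto
qed

lemma vnorm_nonneg [simp]: "0 \<le> vnorm x"
  by (simp add: vnorm_def)

lemma vnorm_0 [simp]: "vnorm 0 = 0"
  by (simp add: vnorm_def)

lemma vnorm_eq_0 [simp]: "vnorm x = 0 \<longleftrightarrow> x = 0"
  by (simp add: vnorm_def)

lemma vnorm_pos [simp]: "0 < vnorm x \<longleftrightarrow> x \<noteq> 0"
  using vnorm_nonneg[of x] vnorm_eq_0[of x] by linarith

lemma vnorm_mult: "vnorm (x * y) = vnorm x * vnorm y"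
  by (simp add: vnorm_def v_mult power_int_add[symmetric])

lemma vnorm_less_powi: "vnorm x < 2 powi (- n) \<longleftrightarrow> x = 0 \<or> n < v x"
  by (auto simp: vnorm_def powi_less)

lemma vnorm_le_powi: "vnorm x \<le> 2 powi (- n) \<longleftrightarrow> x = 0 \<or> n \<le> v x"
  by (auto simp: vnorm_def powi_le)

lemma vnorm_less_1: "vnorm x < 1 \<longleftrightarrow> x = 0 \<or> 0 < v x"
  using vnorm_less_powi[of x 0] by simp

lemma vnorm_le_1: "vnorm x \<le> 1 \<longleftrightarrow> x = 0 \<or> 0 \<le> v x"
  using vnorm_le_powi[of x 0] by simp

lemma vnorm_add: "vnorm (x + y) \<le> max (vnorm x) (vnorm y)"
proof (cases "x = 0 \<or> y = 0 \<or> x + y = 0")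
  case False
  then have "min (v x) (v y) \<le> v (x + y)" by (auto intro: v_add)
  then have "- v (x + y) \<le> - v x \<or> - v (x + y) \<le> - v y" by linarith
  then have "(2::real) powi (- v (x + y)) \<le> 2 powi (- v x) \<or> (2::real) powi (- v (x + y)) \<le> 2 powi (- v y)"
    by (auto intro!: power_int_increasing)
  with False show ?thesis by (auto simp: vnorm_def)
qed (auto simp: le_max_iff_disj)

lemma vnorm_1 [simp]: "vnorm 1 = 1"
proof -
  have "vnorm 1 * vnorm 1 = vnorm 1" using vnorm_mult[of 1 1] by simp
  then show ?thesis by simp
qed

lemma vnorm_minus [simp]: "vnorm (- x) = vnorm x"
proof -
  have "vnorm (-1) * vnorm (-1) = 1" using vnorm_mult[of "-1" "-1"] by simp
  then have "(vnorm (-1))\<^sup>2 = 1" by (simp add: power2_eq_square)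
  then have "vnorm (-1) = 1"
    unfolding power2_eq_1_iff using vnorm_nonneg[of "-1"] by (auto simp del: vnorm_nonneg)
  then show ?thesis using vnorm_mult[of "-1" x] by simp
qed

lemma vnorm_diff: "vnorm (x - y) \<le> max (vnorm x) (vnorm y)"
  using vnorm_add[of x "- y"] by simp

lemma vnorm_diff_commute: "vnorm (x - y) = vnorm (y - x)"
  using vnorm_minus[of "x - y"] by simp

lemma vnorm_triangle: "vnorm (x + y) \<le> vnorm x + vnorm y"
  using vnorm_add[of x y] vnorm_nonneg[of x] vnorm_nonneg[of y] by linarith

lemma vnorm_add_less: "vnorm x < c \<Longrightarrow> vnorm y < c \<Longrightarrow> vnorm (x + y) < c"
  using vnorm_add[of x y] by linarith

lemma vnorm_add_le: "vnorm x \<le> c \<Longrightarrow> vnorm y \<le> c \<Longrightarrow> vnorm (x + y) \<le> c"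
  using vnorm_add[of x y] by linarith

lemma vnorm_diff_less: "vnorm x < c \<Longrightarrow> vnorm y < c \<Longrightarrow> vnorm (x - y) < c"
  using vnorm_diff[of x y] by linarith

lemma vnorm_diff_le: "vnorm x \<le> c \<Longrightarrow> vnorm y \<le> c \<Longrightarrow> vnorm (x - y) \<le> c"
  using vnorm_diff[of x y] by linarith

lemma vnorm_power: "vnorm (x ^ n) = vnorm x ^ n"
  by (induction n) (auto simp: vnorm_mult)

lemma vnorm_inverse: "vnorm (inverse x) = inverse (vnorm x)"
proof (cases "x = 0")
  case False
  then have "vnorm x * vnorm (inverse x) = 1" by (simp flip: vnorm_mult)
  with False show ?thesis by (metis inverse_unique)
qed simp

lemma vnorm_divide: "vnorm (x / y) = vnorm x / vnorm y"
  by (simp add: divide_inverse vnorm_mult vnorm_inverse)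

lemma vnorm_sum_le: "(\<And>i. i \<in> I \<Longrightarrow> vnorm (f i) \<le> c) \<Longrightarrow> 0 \<le> c \<Longrightarrow> vnorm (sum f I) \<le> c"
  by (induction I rule: infinite_finite_induct) (auto intro!: vnorm_add_le)

lemma vnorm_add_eq: "vnorm y < vnorm x \<Longrightarrow> vnorm (x + y) = vnorm x"
  using vnorm_add[of x y] vnorm_diff[of "x + y" y] by auto

lemma vnorm_eqI: "vnorm (y - x) < vnorm x \<Longrightarrow> vnorm y = vnorm x"
  using vnorm_add_eq[of "y - x" x] by simp

lemma vnorm_of_nat: "vnorm (of_nat n) \<le> 1"
  by (induction n) (auto intro!: vnorm_add_le)

lemma vnorm_of_int: "vnorm (of_int n) \<le> 1"
  by (cases n rule: int_diff_cases) (auto intro!: vnorm_diff_le vnorm_of_nat)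

lemma vnorm_numeral: "vnorm (numeral n) \<le> 1"
  using vnorm_of_nat[of "numeral n"] by simp

definition unif :: 'k
  where "unif = (SOME x. x \<noteq> 0 \<and> v x = 1)"

lemma unif: "unif \<noteq> 0" "v unif = 1"
  using someI_ex[OF v_surj[of 1]] by (auto simp: unif_def)

lemma vnorm_unif [simp]: "vnorm unif = 1 / 2"
  using unif by (simp add: vnorm_def power_int_minus field_simps)

lemma unif_nz [simp]: "unif \<noteq> 0"
  by (rule unif)

lemma infinite_field: "infinite (UNIV :: 'k set)"
proof
  assume fin: "finite (UNIV :: 'k set)"
  have "inj ((\<lambda>n. unif ^ n) :: nat \<Rightarrow> 'k)"
  proof (rule injI)
    fix m n :: nat
    assume "unif ^ m = unif ^ n"
    then have "vnorm (unif ^ m) = vnorm (unif ^ n)" by simp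
    then show "m = n" by (simp add: vnorm_power power_one_over)
  qed
  then show False using fin finite_imageD[of "\<lambda>n::nat. unif ^ n" UNIV]
    by (meson finite_subset subset_UNIV infinite_UNIV_nat)
qed

lemma mem_vball: "y \<in> vball v x n \<longleftrightarrow> vnorm (y - x) < 2 powi (- n)"
  by (auto simp: vball_def vnorm_less_powi)

lemma powi_small: "0 < e \<Longrightarrow> \<exists>n::nat. 2 powi (- int n) < (e::real)"
  using real_arch_pow_inv[of e "1/2"] by (auto simp: power_int_minus power_one_over inverse_eq_divide)

section \<open>Sequential convergence in the valued field\<close>

definition vconv :: "(nat \<Rightarrow> 'k) \<Rightarrow> 'k \<Rightarrow> bool"
  where "vconv a L \<longleftrightarrow> (\<lambda>n. vnorm (a n - L)) \<longlonglongrightarrow> 0"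

lemma vconv_iff: "vconv a L \<longleftrightarrow> (\<forall>e>0. \<forall>\<^sub>F n in sequentially. vnorm (a n - L) < e)"
  by (simp add: vconv_def tendsto_iff)

lemma vconv_powi:
  assumes "\<And>n::int. \<exists>N. \<forall>m\<ge>N. a m \<in> vball v L n"
  shows "vconv a L"
  unfolding vconv_iff
proof (intro allI impI)
  fix e :: real assume "e > 0"
  then obtain n :: nat where "2 powi (- int n) < e" using powi_small by blast
  moreover obtain N where "\<forall>m\<ge>N. a m \<in> vball v L (int n)" using assms by blast
  ultimately show "\<forall>\<^sub>F n in sequentially. vnorm (a n - L) < e"
    unfolding eventually_sequentially mem_vball by (meson order_less_trans)
qed

lemma vconv_const [simp]: "vconv (\<lambda>n. c) c"
  by (simp add: vconv_def)

lemma vconv_0_iff: "vconv a 0 \<longleftrightarrow> (\<lambda>n. vnorm (a n)) \<longlonglongrightarrow> 0"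
  by (simp add: vconv_def)

lemma vconv_add:
  assumes "vconv a L" "vconv b M"
  shows "vconv (\<lambda>n. a n + b n) (L + M)"
  unfolding vconv_iff
proof (intro allI impI)
  fix e :: real assume e: "e > 0"
  have "\<forall>\<^sub>F n in sequentially. vnorm (a n - L) < e \<and> vnorm (b n - M) < e"
    using assms e unfolding vconv_iff by (simp add: eventually_conj)
  then show "\<forall>\<^sub>F n in sequentially. vnorm (a n + b n - (L + M)) < e"
    by eventually_elim (metis vnorm_add_less add_diff_add)
qed

lemma vconv_minus: "vconv a L \<Longrightarrow> vconv (\<lambda>n. - a n) (- L)"
proof -
  have "vnorm (- a n - - L) = vnorm (a n - L)" for n
    using vnorm_minus[of "a n - L"] by simp
  then show "vconv a L \<Longrightarrow> vconv (\<lambda>n. - a n) (- L)" by (simp only: vconv_def)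
qed

lemma vconv_diff: "vconv a L \<Longrightarrow> vconv b M \<Longrightarrow> vconv (\<lambda>n. a n - b n) (L - M)"
  using vconv_add[of a L "\<lambda>n. - b n" "- M"] vconv_minus[of b M] by simp

lemma vconv_bounded:
  assumes "vconv a L"
  shows "\<exists>C>0. \<forall>n. vnorm (a n) \<le> C"
proof -
  have "Bseq (\<lambda>n. vnorm (a n - L))"
    using assms unfolding vconv_def by (intro convergent_imp_Bseq convergentI)
  then obtain C where C: "C > 0" "\<And>n. vnorm (a n - L) \<le> C" by (auto simp: Bseq_def)
  have "vnorm (a n) \<le> C + vnorm L" for n
    using vnorm_triangle[of "a n - L" L] C(2)[of n] by simp
  moreover have "C + vnorm L > 0" using C by (simp add: add_pos_nonneg)
  ultimately show ?thesis by blast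
qed

lemma vconv_mult_0:
  assumes "vconv a 0" "\<And>n. vnorm (b n) \<le> C"
  shows "vconv (\<lambda>n. a n * b n) 0"
proof -
  have "(\<lambda>n. vnorm (a n) * C) \<longlonglongrightarrow> 0"
    using assms(1) unfolding vconv_0_iff by (rule tendsto_mult_left_zero)
  moreover have "\<And>n. vnorm (a n * b n) \<le> vnorm (a n) * C"
    using assms(2) by (auto simp: vnorm_mult intro: mult_left_mono)
  ultimately show ?thesis unfolding vconv_0_iff
    by (intro real_tendsto_sandwich[of "\<lambda>n. 0" "\<lambda>n. vnorm (a n * b n)" sequentially "\<lambda>n. vnorm (a n) * C"])
      (simp_all add: always_eventually)
qed

lemma vconv_diff_iff: "vconv a L \<longleftrightarrow> vconv (\<lambda>n. a n - L) 0"
  by (simp add: vconv_def)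

lemma vconv_mult:
  assumes "vconv a L" "vconv b M"
  shows "vconv (\<lambda>n. a n * b n) (L * M)"
proof -
  obtain C where "\<And>n. vnorm (b n) \<le> C" using vconv_bounded[OF assms(2)] by blast
  then have "vconv (\<lambda>n. (a n - L) * b n) 0"
    using assms(1) vconv_diff_iff by (intro vconv_mult_0) auto
  moreover have "vconv (\<lambda>n. (b n - M) * L) 0"
    using assms(2) vconv_diff_iff by (intro vconv_mult_0[where C = "vnorm L"]) auto
  ultimately have "vconv (\<lambda>n. (a n - L) * b n + (b n - M) * L) (0 + 0)" by (rule vconv_add)
  then show ?thesis by (subst vconv_diff_iff) (simp add: algebra_simps)
qed

lemma vconv_power: "vconv a L \<Longrightarrow> vconv (\<lambda>n. a n ^ k) (L ^ k)"
  by (induction k) (auto intro: vconv_mult)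

lemma vconv_sum:
  "(\<And>i. i \<in> I \<Longrightarrow> vconv (a i) (L i)) \<Longrightarrow> vconv (\<lambda>n. \<Sum>i\<in>I. a i n) (\<Sum>i\<in>I. L i)"
  by (induction I rule: infinite_finite_induct) (auto intro: vconv_add)

lemma vconv_subseq: "vconv a L \<Longrightarrow> strict_mono r \<Longrightarrow> vconv (\<lambda>n. a (r n)) L"
  unfolding vconv_def using LIMSEQ_subseq_LIMSEQ[of "\<lambda>n. vnorm (a n - L)"] by (simp add: o_def)

lemma vconv_Suc: "vconv a L \<Longrightarrow> vconv (\<lambda>n. a (Suc n)) L"
  using vconv_subseq[of a L Suc] by (simp add: strict_mono_Suc_iff)

lemma vconv_unique:
  assumes "vconv a L" "vconv a M"
  shows "L = M"
proof -
  have "vconv (\<lambda>n. a n - a n) (L - M)" using assms by (rule vconv_diff)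
  then have "(\<lambda>n::nat. vnorm (L - M)) \<longlonglongrightarrow> 0"
    using vnorm_minus[of "L - M"] by (simp add: vconv_def)
  then show ?thesis by (simp add: LIMSEQ_const_iff)
qed

lemma vconv_cong: "\<forall>\<^sub>F n in sequentially. a n = b n \<Longrightarrow> vconv a L \<longleftrightarrow> vconv b L"
  unfolding vconv_def by (rule tendsto_cong) (auto elim: eventually_mono)

lemma vconv_vnorm: "vconv a L \<Longrightarrow> L \<noteq> 0 \<Longrightarrow> \<forall>\<^sub>F n in sequentially. vnorm (a n) = vnorm L"
proof -
  assume "vconv a L" "L \<noteq> 0"
  then have "\<forall>\<^sub>F n in sequentially. vnorm (a n - L) < vnorm L" unfolding vconv_iff by simp
  then show ?thesis by eventually_elim (rule vnorm_eqI)
qed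

lemma vconv_nz: "vconv a L \<Longrightarrow> L \<noteq> 0 \<Longrightarrow> \<forall>\<^sub>F n in sequentially. a n \<noteq> 0"
  using vconv_vnorm by (rule eventually_mono) auto

lemma vnorm_limit_ge:
  assumes "vconv a L" "\<And>n. e \<le> vnorm (a n)"
  shows "e \<le> vnorm L"
proof (cases "L = 0")
  case True
  with assms show ?thesis unfolding vconv_def
    by (intro tendsto_lowerbound[of "\<lambda>n. vnorm (a n)" _ sequentially]) auto
next
  case False
  obtain n where "vnorm (a n) = vnorm L"
    using eventually_happens'[OF _ vconv_vnorm[OF assms(1) False]] by auto
  then show ?thesis using assms(2)[of n] by simp
qed

lemma vconv_inverse:
  assumes "vconv a L" "L \<noteq> 0"
  shows "vconv (\<lambda>n. inverse (a n)) (inverse L)"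
proof -
  have ev: "\<forall>\<^sub>F n in sequentially. vnorm (a n) = vnorm L" using assms by (rule vconv_vnorm)
  have "(\<lambda>n. vnorm (a n - L) * (inverse (vnorm L) * inverse (vnorm L))) \<longlonglongrightarrow> 0"
    using assms(1) unfolding vconv_def by (rule tendsto_mult_left_zero)
  moreover have "\<forall>\<^sub>F n in sequentially. vnorm (inverse (a n) - inverse L)
      = vnorm (a n - L) * (inverse (vnorm L) * inverse (vnorm L))"
    using ev
  proof eventually_elim
    case (elim n)
    then have "a n \<noteq> 0" using assms(2) by auto
    then have "inverse (a n) - inverse L = - (a n - L) * (inverse (a n) * inverse L)"
      using assms(2) by (simp add: field_simps)
    then have "vnorm (inverse (a n) - inverse L) = vnorm (- (a n - L) * (inverse (a n) * inverse L))"
      by simp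
    also have "\<dots> = vnorm (a n - L) * (inverse (vnorm (a n)) * inverse (vnorm L))"
      by (simp only: vnorm_mult vnorm_minus vnorm_inverse)
    finally show ?case by (simp add: elim)
  qed
  ultimately show ?thesis unfolding vconv_def by (simp add: tendsto_cong)
qed

lemma vconv_divide:
  "vconv a L \<Longrightarrow> vconv b M \<Longrightarrow> M \<noteq> 0 \<Longrightarrow> vconv (\<lambda>n. a n / b n) (L / M)"
  by (auto simp: divide_inverse intro: vconv_mult vconv_inverse)

lemma vconv_0_bound:
  assumes "vconv a 0" "\<forall>\<^sub>F n in sequentially. vnorm (b n) \<le> vnorm (a n)"
  shows "vconv b 0"
  using assms unfolding vconv_0_iff
  by (intro real_tendsto_sandwich[of "\<lambda>n. 0" "\<lambda>n. vnorm (b n)" sequentially "\<lambda>n. vnorm (a n)"])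
    (simp_all add: always_eventually)

lemma vconv_unif_power: "vconv (\<lambda>n. unif ^ n) 0"
  unfolding vconv_0_iff by (simp add: vnorm_power LIMSEQ_power_zero)

lemma poly_nonroot: "p \<noteq> 0 \<Longrightarrow> \<exists>x. poly p x \<noteq> (0::'k)"
  using poly_roots_finite[of p] infinite_field
  by (metis (mono_tags, lifting) finite_subset mem_Collect_eq subsetI)

sublocale Metric_space "UNIV :: 'k set" "\<lambda>x y. vnorm (x - y)"
proof
  show "vnorm (x - z) \<le> vnorm (x - y) + vnorm (y - z)" for x y z
    using vnorm_triangle[of "x - y" "y - z"] by simp
qed (auto simp: vnorm_diff_commute)

end

section \<open>Local fields\<close>

locale local_field = discrete_valued_field +
  assumes complete: "\<And>s::nat \<Rightarrow> 'a. (\<And>n. \<exists>N. \<forall>m\<ge>N. \<forall>k\<ge>N. s m \<in> vball v (s k) n) \<Longrightarrow>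
      \<exists>L. \<forall>n. \<exists>N. \<forall>m\<ge>N. s m \<in> vball v L n"
    and finite_residue: "\<exists>R. finite R \<and> (\<forall>x. vnorm x \<le> 1 \<longrightarrow> (\<exists>r\<in>R. vnorm (x - r) < 1))"
begin

lemma vconv_complete:
  assumes "\<And>e. 0 < e \<Longrightarrow> \<exists>N. \<forall>m\<ge>N. \<forall>n\<ge>N. vnorm (s m - s n) < e"
  shows "\<exists>L. vconv s L"
proof -
  have "\<exists>L. \<forall>n. \<exists>N. \<forall>m\<ge>N. s m \<in> vball v L n"
    using assms unfolding mem_vball[symmetric] by (intro complete) (simp add: mem_vball)
  then show ?thesis using vconv_powi by blast
qed

lemma vnorm_less_1_half: "vnorm x < 1 \<Longrightarrow> vnorm x \<le> 1 / 2"
  using vnorm_le_powi[of x 1] by (auto simp: vnorm_less_1 power_int_minus)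

text \<open>Digits are chosen one at a time: after the first residue representative the remainder is
  divided by \<open>unif\<close> and approximated recursively.\<close>

lemma finite_cover:
  "\<exists>R. finite R \<and> (\<forall>x. vnorm x \<le> 1 \<longrightarrow> (\<exists>r\<in>R. vnorm (x - r) < (1 / 2) ^ m))"
proof (induction m)
  case 0
  show ?case using finite_residue by simp
next
  case (Suc m)
  then obtain S where S: "finite S" "\<And>x. vnorm x \<le> 1 \<Longrightarrow> \<exists>r\<in>S. vnorm (x - r) < (1 / 2) ^ m" by blast
  obtain R where R: "finite R" "\<And>x. vnorm x \<le> 1 \<Longrightarrow> \<exists>r\<in>R. vnorm (x - r) < 1"
    using finite_residue by blast
  have "\<exists>r\<in>(\<lambda>(r, s). r + unif * s) ` (R \<times> S). vnorm (x - r) < (1 / 2) ^ Suc m" if x: "vnorm x \<le> 1" for x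
  proof -
    obtain r where r: "r \<in> R" "vnorm (x - r) < 1" using R x by blast
    then have "vnorm ((x - r) / unif) \<le> 1" using vnorm_less_1_half[of "x - r"] by (simp add: vnorm_divide)
    then obtain s where s: "s \<in> S" "vnorm ((x - r) / unif - s) < (1 / 2) ^ m" using S by blast
    have "x - (r + unif * s) = unif * ((x - r) / unif - s)" by (simp add: field_simps)
    then have "vnorm (x - (r + unif * s)) < (1 / 2) ^ Suc m"
      using s(2) by (simp add: vnorm_mult)
    then show ?thesis using r s by auto
  qed
  then show ?case using R(1) S(1) by (intro exI[of _ "(\<lambda>(r, s). r + unif * s) ` (R \<times> S)"]) auto
qed

lemma totally_bounded: "mtotally_bounded {x. vnorm x \<le> 1}"
  unfolding mtotally_bounded_def
proof (intro allI impI)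
  fix e :: real assume "e > 0"
  then obtain m where m: "(1 / 2) ^ m < e" using real_arch_pow_inv[of e "1/2"] by auto
  obtain R where R: "finite R" "\<And>x. vnorm x \<le> 1 \<Longrightarrow> \<exists>r\<in>R. vnorm (x - r) < (1 / 2) ^ m"
    using finite_cover by metis
  define S where "S = {r \<in> R. vnorm r \<le> 1}"
  have "\<exists>r\<in>S. x \<in> mball r e" if x: "vnorm x \<le> 1" for x
  proof -
    obtain r where r: "r \<in> R" "vnorm (x - r) < (1 / 2) ^ m" using R x by blast
    then have "vnorm (x - r) < 1" by (meson less_le_trans power_le_one zero_le_divide_1_iff
          zero_le_numeral divide_le_eq_1_pos one_le_numeral zero_less_numeral)
    then have "vnorm r \<le> 1" using vnorm_diff_le[of x 1 "x - r"] x by simp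
    then show ?thesis using r m by (auto simp: S_def vnorm_diff_commute)
  qed
  then show "\<exists>K. finite K \<and> K \<subseteq> {x. vnorm x \<le> 1} \<and> {x. vnorm x \<le> 1} \<subseteq> (\<Union>x\<in>K. mball x e)"
    using R(1) by (intro exI[of _ S]) (auto simp: S_def)
qed

lemma bounded_vconv_subseq:
  assumes "\<And>n::nat. vnorm (a n) \<le> C"
  shows "\<exists>r L. strict_mono r \<and> vconv (\<lambda>n. a (r n)) L"
proof -
  obtain k :: nat where "C < 2 ^ k" using real_arch_pow[of 2 C] by auto
  then have k: "C \<le> 2 ^ k" by simp
  define c where "c = unif ^ k"
  have c: "c \<noteq> 0" "vnorm c = inverse (2 ^ k)" by (auto simp: c_def vnorm_power power_one_over inverse_eq_divide)
  have "range (\<lambda>n. c * a n) \<subseteq> {x. vnorm x \<le> 1}"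
  proof -
    have "vnorm (c * a n) \<le> 1" for n
    proof -
      have "vnorm (c * a n) \<le> inverse (2 ^ k) * 2 ^ k"
        unfolding vnorm_mult c(2) using order_trans[OF assms k] by (intro mult_left_mono) auto
      then show ?thesis by simp
    qed
    then show ?thesis by auto
  qed
  then obtain r where r: "strict_mono r" "MCauchy ((\<lambda>n. c * a n) \<circ> r)"
    using totally_bounded unfolding mtotally_bounded_sequentially by metis
  have "\<exists>L. vconv ((\<lambda>n. c * a n) \<circ> r) L"
    using r(2) by (intro vconv_complete) (simp add: MCauchy_def)
  then obtain L where "vconv (\<lambda>n. c * a (r n)) L" by (auto simp: o_def)
  then have "vconv (\<lambda>n. inverse c * (c * a (r n))) (inverse c * L)"
    by (rule vconv_mult[OF vconv_const])
  moreover have "inverse c * (c * a (r n)) = a (r n)" for n using c(1) by simp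
  ultimately have "vconv (\<lambda>n. a (r n)) (inverse c * L)" by simp
  with r(1) show ?thesis by blast
qed

lemma bounded_vconv_subseq_finite:
  assumes "finite I" "\<And>i. i \<in> I \<Longrightarrow> \<exists>C. \<forall>n::nat. vnorm (a i n) \<le> C"
  shows "\<exists>r. strict_mono r \<and> (\<forall>i\<in>I. \<exists>L. vconv (\<lambda>n. a i (r n)) L)"
  using assms
proof (induction I rule: finite_induct)
  case empty
  show ?case by (auto intro: exI[of _ id] simp: strict_mono_id)
next
  case (insert j I)
  then obtain r where r: "strict_mono r" "\<forall>i\<in>I. \<exists>L. vconv (\<lambda>n. a i (r n)) L" by auto
  obtain C where "\<And>n. vnorm (a j (r n)) \<le> C" using insert.prems by blast
  then obtain s L where s: "strict_mono s" "vconv (\<lambda>n. a j (r (s n))) L"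
    using bounded_vconv_subseq[of "\<lambda>n. a j (r n)"] by blast
  have "\<exists>L. vconv (\<lambda>n. a i (r (s n))) L" if "i \<in> I" for i
    using r(2) that vconv_subseq[OF _ s(1)] by blast
  with r(1) s show ?case by (intro exI[of _ "r \<circ> s"]) (auto simp: strict_mono_def)
qed

text \<open>This is the renormalisation behind every limit polynomial: \<open>k i\<close> is the
  power of the flow time that accompanies the small quantity \<open>x i\<close>. \<open>T n\<close>
  is the first power of \<open>inverse unif\<close> at which some weighted quantity reaches norm 1.
  One step earlier all were below 1, so at \<open>T n\<close> they are at most
  \<open>2 ^ k i\<close>. Hence a subsequence converges, and since I is finite, not all limits can
  be 0.\<close>

lemma vconv_rescale:
  fixes x :: "'i \<Rightarrow> nat \<Rightarrow> 'a" and k :: "'i \<Rightarrow> nat"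
  assumes I: "finite I" "\<And>i. i \<in> I \<Longrightarrow> vconv (x i) 0" "\<And>i. i \<in> I \<Longrightarrow> 1 \<le> k i"
    and nz: "\<And>n. \<exists>i\<in>I. x i n \<noteq> 0"
  shows "\<exists>T r X. strict_mono r \<and> (\<forall>n. T n \<noteq> 0) \<and> vconv (\<lambda>n. inverse (T n)) 0 \<and>
    (\<forall>i\<in>I. vconv (\<lambda>n. x i (r n) * T n ^ k i) (X i)) \<and> (\<exists>i\<in>I. X i \<noteq> 0)"
proof -
  define P where "P n m \<longleftrightarrow> (\<exists>i\<in>I. 1 \<le> vnorm (x i n) * (2 ^ m) ^ k i)" for n m
  have ex: "\<exists>m. P n m" for n
  proof -
    obtain i where i: "i \<in> I" "x i n \<noteq> 0" using nz by blast
    obtain m where "inverse (2 ^ m) < vnorm (x i n)"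
      using real_arch_pow_inv[of "vnorm (x i n)" "1/2"] i by (auto simp: power_one_over inverse_eq_divide)
    then have "1 \<le> vnorm (x i n) * 2 ^ m" by (simp add: field_simps)
    also have "\<dots> \<le> vnorm (x i n) * (2 ^ m) ^ k i"
      using I(3)[OF i(1)] by (intro mult_left_mono self_le_power) auto
    finally show ?thesis using i unfolding P_def by blast
  qed
  define M where "M n = (LEAST m. P n m)" for n
  have PM: "P n (M n)" for n unfolding M_def using ex by (rule LeastI_ex)
  have below: "vnorm (x i n) * (2 ^ m) ^ k i < 1" if "m < M n" "i \<in> I" for m n i
    using not_less_Least[of m "P n"] that unfolding M_def P_def by force
  define T where "T n = inverse unif ^ M n" for n
  have T: "T n \<noteq> 0" "vnorm (T n) = 2 ^ M n" for n
    by (auto simp: T_def vnorm_power vnorm_inverse)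
  have large: "\<forall>\<^sub>F n in sequentially. m < M n" for m
  proof -
    have "\<forall>\<^sub>F n in sequentially. vnorm (x i n) * (2 ^ m) ^ k i < 1" if "i \<in> I" for i
    proof -
      have "\<forall>\<^sub>F n in sequentially. vnorm (x i n) < inverse ((2 ^ m) ^ k i)"
        using I(2)[OF that] unfolding vconv_iff by simp
      then show ?thesis by eventually_elim (simp add: field_simps)
    qed
    then have "\<forall>\<^sub>F n in sequentially. \<forall>i\<in>I. vnorm (x i n) * (2 ^ m) ^ k i < 1"
      using I(1) by (simp add: eventually_ball_finite)
    then show ?thesis
    proof eventually_elim
      case (elim n)
      have "\<not> P n m'" if "m' \<le> m" for m'
      proof
        assume "P n m'"
        then obtain i where i: "i \<in> I" "1 \<le> vnorm (x i n) * (2 ^ m') ^ k i" unfolding P_def by blast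
        have "((2::real) ^ m') ^ k i \<le> (2 ^ m) ^ k i" using that by (intro power_mono power_increasing) auto
        then have "vnorm (x i n) * (2 ^ m') ^ k i \<le> vnorm (x i n) * (2 ^ m) ^ k i"
          by (rule mult_left_mono) simp
        with i elim show False by force
      qed
      then show ?case using PM[of n] linorder_not_le by blast
    qed
  qed
  have "vconv (\<lambda>n. inverse (T n)) 0"
    unfolding vconv_iff
  proof (intro allI impI)
    fix e :: real assume "e > 0"
    then obtain m where m: "inverse (2 ^ m) < e"
      using real_arch_pow_inv[of e "1/2"] by (auto simp: power_one_over inverse_eq_divide)
    show "\<forall>\<^sub>F n in sequentially. vnorm (inverse (T n) - 0) < e"
      using large[of m]
    proof eventually_elim
      case (elim n)
      then have "(2::real) ^ m \<le> 2 ^ M n" by (intro power_increasing) auto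
      then have "inverse (2 ^ M n) \<le> inverse ((2::real) ^ m)" by (intro le_imp_inverse_le) auto
      then have "vnorm (inverse (T n)) < e" unfolding vnorm_inverse T(2) using m by linarith
      then show ?case by simp
    qed
  qed
  moreover have bdd: "\<exists>C. \<forall>n. vnorm (x i n * T n ^ k i) \<le> C" if i: "i \<in> I" for i
  proof -
    obtain C where C: "\<And>n. vnorm (x i n) \<le> C" using vconv_bounded[OF I(2)[OF i]] by blast
    have "vnorm (x i n * T n ^ k i) \<le> max C (2 ^ k i)" for n
    \<comment> \<open>For \<open>M n = 0\<close> there is no earlier step, and the bound comes from
      the convergence of \<open>x i\<close> instead.\<close>
    proof (cases "M n")
      case 0
      then show ?thesis using C[of n] by (simp add: T_def)
    next
      case (Suc m)
      have "vnorm (x i n * T n ^ k i) = vnorm (x i n) * (2 ^ m) ^ k i * 2 ^ k i"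
        by (simp add: vnorm_mult vnorm_power T Suc power_mult_distrib)
      also have "\<dots> \<le> 1 * 2 ^ k i"
        using below[of m n i] Suc i by (intro mult_right_mono) auto
      finally show ?thesis by simp
    qed
    then show ?thesis by blast
  qed
  obtain r where r: "strict_mono r" "\<forall>i\<in>I. \<exists>L. vconv (\<lambda>n. x i (r n) * T (r n) ^ k i) L"
    using bounded_vconv_subseq_finite[OF I(1), of "\<lambda>i n. x i n * T n ^ k i"] bdd by auto
  then obtain X where X: "\<And>i. i \<in> I \<Longrightarrow> vconv (\<lambda>n. x i (r n) * T (r n) ^ k i) (X i)" by metis
  have "\<exists>i\<in>I. X i \<noteq> 0"
  proof (rule ccontr)
    assume "\<not> (\<exists>i\<in>I. X i \<noteq> 0)"
    then have "\<forall>\<^sub>F n in sequentially. vnorm (x i (r n) * T (r n) ^ k i) < 1" if "i \<in> I" for i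
      using X[OF that] that unfolding vconv_iff by (auto dest: spec[of _ 1])
    then have "\<forall>\<^sub>F n in sequentially. \<forall>i\<in>I. vnorm (x i (r n) * T (r n) ^ k i) < 1"
      using I(1) by (simp add: eventually_ball_finite)
    then obtain n where n: "\<forall>i\<in>I. vnorm (x i (r n) * T (r n) ^ k i) < 1"
      by (auto simp: eventually_sequentially)
    then show False using PM[of "r n"] by (force simp: P_def vnorm_mult vnorm_power T)
  qed
  ultimately show ?thesis using r(1) X T(1) vconv_subseq[OF _ r(1)]
    by (intro exI[of _ "\<lambda>n. T (r n)"] exI[of _ r] exI[of _ X]) auto
qed

text \<open>Banach's fixed point theorem on an open ball. The ultrametric inequality replaces the
  usual geometric sum: all iterates stay as close to a as the first one, so a first step shorter
  than d suffices.\<close>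

lemma contraction_fixpoint:
  assumes f: "\<And>x y. vnorm (x - a) < d \<Longrightarrow> vnorm (y - a) < d \<Longrightarrow> vnorm (f x - f y) \<le> vnorm (x - y) / 2"
    and a: "vnorm (f a - a) < d"
  shows "\<exists>x. vnorm (x - a) < d \<and> f x = x"
proof -
  have d: "d > 0" using a vnorm_nonneg[of "f a - a"] by linarith
  define s where "s n = (f ^^ n) a" for n
  have s_Suc: "s (Suc n) = f (s n)" for n by (simp add: s_def)
  define e where "e = vnorm (f a - a)"
  have near: "vnorm (s n - a) \<le> e" for n
  proof (induction n)
    case (Suc n)
    then have n: "vnorm (s n - a) < d" using a by (simp add: e_def)
    have "vnorm (f (s n) - f a) \<le> vnorm (s n - a) / 2" using n d by (intro f) auto
    then have "vnorm (f (s n) - f a) \<le> e" using Suc vnorm_nonneg[of "s n - a"] by linarith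
    then have "vnorm ((f (s n) - f a) + (f a - a)) \<le> e" by (intro vnorm_add_le) (auto simp: e_def)
    then show ?case by (simp add: s_Suc)
  qed (simp add: s_def e_def)
  then have near': "vnorm (s n - a) < d" for n using a by (metis e_def order_le_less_trans)
  have step: "vnorm (s (Suc n) - s n) \<le> (1 / 2) ^ n * e" for n
  proof (induction n)
    case (Suc n)
    have "vnorm (s (Suc (Suc n)) - s (Suc n)) \<le> vnorm (s (Suc n) - s n) / 2"
      unfolding s_Suc[of "Suc n"] s_Suc[of n] using f[OF near'[of "Suc n"] near'[of n]] by (simp add: s_Suc)
    then show ?case using Suc by simp
  qed (simp add: s_def e_def)
  have tail: "vnorm (s (n + m) - s n) \<le> (1 / 2) ^ n * e" for n m
  proof (induction m)
    case (Suc m)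
    have "(1 / 2) ^ (n + m) * e \<le> (1 / 2) ^ n * e"
      by (intro mult_right_mono power_decreasing) (auto simp: e_def)
    then have "vnorm (s (Suc (n + m)) - s (n + m)) \<le> (1 / 2) ^ n * e" using step[of "n + m"] by linarith
    then have "vnorm ((s (Suc (n + m)) - s (n + m)) + (s (n + m) - s n)) \<le> (1 / 2) ^ n * e"
      using Suc by (rule vnorm_add_le)
    then show ?case by simp
  qed (simp add: e_def)
  have "\<exists>L. vconv s L"
  proof (rule vconv_complete)
    fix c :: real assume c: "0 < c"
    then obtain N where "(1 / 2) ^ N < c / (e + 1)"
      using real_arch_pow_inv[of "c / (e + 1)" "1/2"] by (auto simp: e_def add_nonneg_pos)
    moreover have "(1 / 2) ^ N * e \<le> (1 / 2) ^ N * (e + 1)" by (intro mult_left_mono) auto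
    moreover have "e + 1 > 0" by (simp add: e_def add_nonneg_pos)
    ultimately have N: "(1 / 2) ^ N * e < c" by (simp add: field_simps)
    have "vnorm (s m - s n) < c" if "N \<le> m" "N \<le> n" for m n
    proof -
      have "vnorm (s m - s N) < c" "vnorm (s n - s N) < c"
        using tail[of N "m - N"] tail[of N "n - N"] N that by auto
      then have "vnorm ((s m - s N) - (s n - s N)) < c" by (rule vnorm_diff_less)
      then show ?thesis by simp
    qed
    then show "\<exists>N. \<forall>m\<ge>N. \<forall>n\<ge>N. vnorm (s m - s n) < c" by blast
  qed
  then obtain L where L: "vconv s L" by blast
  have La: "vnorm (L - a) < d"
  proof -
    have "\<forall>\<^sub>F n in sequentially. vnorm (s n - L) < d" using L d unfolding vconv_iff by blast
    then obtain n where "vnorm (s n - L) < d" by (auto simp: eventually_sequentially)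
    then have "vnorm ((s n - a) - (s n - L)) < d" by (rule vnorm_diff_less[OF near'])
    then show ?thesis by simp
  qed
  have "vconv (\<lambda>n. f (s n)) (f L)"
  proof -
    have "vnorm (f (s n) - f L) \<le> vnorm (s n - L)" for n
      using f[OF near' La, of n] vnorm_nonneg[of "s n - L"] by linarith
    then have "\<forall>\<^sub>F n in sequentially. vnorm (f (s n) - f L) \<le> vnorm (s n - L)"
      by (rule always_eventually[OF allI])
    moreover have "vconv (\<lambda>n. s n - L) 0" using L vconv_diff_iff[of s L] by (rule iffD1[rotated])
    ultimately have "vconv (\<lambda>n. f (s n) - f L) 0" by (rule vconv_0_bound[rotated])
    then show ?thesis using vconv_diff_iff[of "\<lambda>n. f (s n)" "f L"] by (rule iffD2[rotated])
  qed
  moreover have "vconv (\<lambda>n. f (s n)) L" using vconv_Suc[OF L] by (simp add: s_Suc)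
  ultimately have "f L = L" by (rule vconv_unique)
  with La show ?thesis by blast
qed

text \<open>Strict differentiability, with both points moving, is what bounds the contraction
  constant of a Newton iteration. For \<open>pCons c p\<close> the error splits into x times the
  error of p, the variation of p between y and a, and the distance from x to a times the slope of
  p.\<close>

lemma poly_strict_diff:
  "0 < e \<Longrightarrow> \<exists>d>0. \<forall>x y. vnorm (x - a) < d \<longrightarrow> vnorm (y - a) < d \<longrightarrow>
      vnorm (poly p x - poly p y - poly (pderiv p) a * (x - y)) \<le> e * vnorm (x - y)"
proof (induction p arbitrary: e)
  case 0
  then show ?case by (auto intro: exI[of _ 1])
next
  case (pCons c p)
  define K where "K = vnorm a + 1"
  define D where "D = vnorm (poly (pderiv p) a) + 1"
  have pos: "K > 0" "D > 0" by (auto simp: K_def D_def add_nonneg_pos)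
  obtain d where d: "d > 0" "\<And>x y. vnorm (x - a) < d \<Longrightarrow> vnorm (y - a) < d \<Longrightarrow>
      vnorm (poly p x - poly p y - poly (pderiv p) a * (x - y)) \<le> min 1 (e / K) * vnorm (x - y)"
    using pCons.IH[of "min 1 (e / K)"] pCons.prems pos by auto
  \<comment> \<open>The bound 1 keeps the norm of x below K; the bound e / D takes care of the last
    two error terms.\<close>
  define d' where "d' = Min {d, 1, e / D}"
  have "d' > 0" using d(1) pos pCons.prems by (auto simp: d'_def)
  moreover have "vnorm (poly (pCons c p) x - poly (pCons c p) y - poly (pderiv (pCons c p)) a * (x - y))
       \<le> e * vnorm (x - y)" if xa: "vnorm (x - a) < d'" and ya: "vnorm (y - a) < d'" for x y
  proof -
    have x: "vnorm (x - a) < d" "vnorm (x - a) < 1" "vnorm (x - a) < e / D"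
      and y: "vnorm (y - a) < d" "vnorm (y - a) < 1" "vnorm (y - a) < e / D"
      using xa ya by (auto simp: d'_def)
    define E where "E = poly p x - poly p y - poly (pderiv p) a * (x - y)"
    have E: "vnorm E \<le> min 1 (e / K) * vnorm (x - y)" unfolding E_def using x y by (intro d)
    have ya0: "vnorm (y - a) * D \<le> e" using y(3) pos by (simp add: field_simps)
    have xa0: "vnorm (x - a) * D \<le> e" using x(3) pos by (simp add: field_simps)
    have "vnorm x \<le> K" using vnorm_triangle[of "x - a" a] x(2) by (simp add: K_def)
    then have 1: "vnorm (x * E) \<le> e * vnorm (x - y)"
    proof -
      assume xK: "vnorm x \<le> K"
      have "vnorm (x * E) \<le> K * (e / K * vnorm (x - y))" unfolding vnorm_mult
        using E xK pos mult_right_mono[of "min 1 (e / K)" "e / K" "vnorm (x - y)"]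
        by (intro mult_mono) auto
      then show ?thesis using pos by simp
    qed
    have xaa: "vnorm (poly p y - poly p a) \<le> D * vnorm (y - a)"
    proof -
      have "vnorm (poly p y - poly p a - poly (pderiv p) a * (y - a)) \<le> min 1 (e / K) * vnorm (y - a)"
        using y d(1) by (intro d) auto
      also have "\<dots> \<le> D * vnorm (y - a)" by (intro mult_right_mono) (auto simp: D_def min_def add_increasing)
      finally have "vnorm ((poly p y - poly p a - poly (pderiv p) a * (y - a)) + poly (pderiv p) a * (y - a))
         \<le> D * vnorm (y - a)"
        by (rule vnorm_add_le) (auto simp: vnorm_mult D_def intro: mult_right_mono)
      then show ?thesis by simp
    qed
    have 2: "vnorm ((poly p y - poly p a) * (x - y)) \<le> e * vnorm (x - y)"
      unfolding vnorm_mult using xaa ya0 by (intro mult_right_mono) (auto simp: mult.commute)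
    have 3: "vnorm ((x - a) * poly (pderiv p) a * (x - y)) \<le> e * vnorm (x - y)"
    proof -
      have "vnorm ((x - a) * poly (pderiv p) a) \<le> vnorm (x - a) * D"
        unfolding vnorm_mult by (intro mult_left_mono) (auto simp: D_def)
      then show ?thesis unfolding vnorm_mult[of "(x - a) * poly (pderiv p) a"] using xa0
        by (intro mult_right_mono) auto
    qed
    have "poly (pCons c p) x - poly (pCons c p) y - poly (pderiv (pCons c p)) a * (x - y)
       = x * E + (poly p y - poly p a) * (x - y) + (x - a) * poly (pderiv p) a * (x - y)"
      by (simp add: pderiv_pCons E_def algebra_simps)
    then show ?thesis using 1 2 3 by (simp only:) (intro vnorm_add_le)
  qed
  ultimately show ?case by blast
qed

text \<open>Implicit function theorem for A + l B at a simple root, by Newton iteration with the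
  slope D frozen at \<open>t0\<close> and \<open>l0\<close>. Keeping B nonzero allows the root to be
  read as a solution of A / B = - l.\<close>

lemma hensel_family:
  assumes root: "poly A t0 + l0 * poly B t0 = 0"
    and deriv: "poly (pderiv A) t0 + l0 * poly (pderiv B) t0 \<noteq> 0"
    and B: "poly B t0 \<noteq> 0"
  shows "\<exists>d>0. \<forall>l. vnorm (l - l0) < d \<longrightarrow> (\<exists>t. poly A t + l * poly B t = 0 \<and> poly B t \<noteq> 0)"
proof -
  define D where "D = poly (pderiv A) t0 + l0 * poly (pderiv B) t0"
  define L where "L = vnorm l0 + 1"
  define e where "e = vnorm D / (2 * L)"
  have D: "D \<noteq> 0" "vnorm D > 0" using deriv by (auto simp: D_def)
  have L: "L \<ge> 1" by (simp add: L_def)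
  have e: "e > 0" using D L by (simp add: e_def)
  obtain d1 where d1: "d1 > 0" "\<And>x y. vnorm (x - t0) < d1 \<Longrightarrow> vnorm (y - t0) < d1 \<Longrightarrow>
      vnorm (poly A x - poly A y - poly (pderiv A) t0 * (x - y)) \<le> e * vnorm (x - y)"
    using poly_strict_diff[OF e] by blast
  obtain d2 where d2: "d2 > 0" "\<And>x y. vnorm (x - t0) < d2 \<Longrightarrow> vnorm (y - t0) < d2 \<Longrightarrow>
      vnorm (poly B x - poly B y - poly (pderiv B) t0 * (x - y)) \<le> e * vnorm (x - y)"
    using poly_strict_diff[OF e] by blast
  define b where "b = vnorm (poly (pderiv B) t0) + e"
  have b: "b > 0" using e by (simp add: b_def add_nonneg_pos)
  define r where "r = Min {d1, d2, vnorm (poly B t0) / b}"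
  have r: "r > 0" "r \<le> d1" "r \<le> d2" "r \<le> vnorm (poly B t0) / b" using d1 d2 B b by (auto simp: r_def)
  have Bnz: "poly B t \<noteq> 0" if t: "vnorm (t - t0) < r" for t
  proof
    assume "poly B t = 0"
    have "vnorm (poly B t - poly B t0 - poly (pderiv B) t0 * (t - t0)) \<le> e * vnorm (t - t0)"
      using t r d2(1) by (intro d2) auto
    then have "vnorm ((poly B t - poly B t0 - poly (pderiv B) t0 * (t - t0)) + poly (pderiv B) t0 * (t - t0))
       \<le> e * vnorm (t - t0) + vnorm (poly (pderiv B) t0) * vnorm (t - t0)"
      using vnorm_triangle by (smt (verit) vnorm_mult)
    then have "vnorm (poly B t0) \<le> b * vnorm (t - t0)"
      using \<open>poly B t = 0\<close> by (simp add: b_def algebra_simps)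
    moreover have "b * vnorm (t - t0) < b * r" using t b by simp
    moreover have "b * r \<le> vnorm (poly B t0)" using r(4) b by (simp add: field_simps)
    ultimately show False by linarith
  qed
  \<comment> \<open>In this order: l stays bounded by L, the change of l spoils the slope by at most
    half the norm of D, and the first Newton step from \<open>t0\<close> is shorter than r.\<close>
  define d where "d = Min {1, vnorm D / (2 * b), vnorm D * r / (vnorm (poly B t0))}"
  have "d > 0" using D b r B by (auto simp: d_def)
  moreover have "\<exists>t. poly A t + l * poly B t = 0 \<and> poly B t \<noteq> 0" if l: "vnorm (l - l0) < d" for l
  proof -
    have l1: "vnorm (l - l0) < 1" "vnorm (l - l0) < vnorm D / (2 * b)"
      "vnorm (l - l0) < vnorm D * r / vnorm (poly B t0)" using l by (auto simp: d_def)
    have lL: "vnorm l \<le> L" using vnorm_triangle[of "l - l0" l0] l1(1) by (simp add: L_def)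
    define f where "f x = x - (poly A x + l * poly B x) / D" for x
    have "\<exists>x. vnorm (x - t0) < r \<and> f x = x"
    proof (rule contraction_fixpoint)
      fix x y assume x: "vnorm (x - t0) < r" and y: "vnorm (y - t0) < r"
      define E1 where "E1 = poly A x - poly A y - poly (pderiv A) t0 * (x - y)"
      define E2 where "E2 = poly B x - poly B y - poly (pderiv B) t0 * (x - y)"
      define c where "c = vnorm D / 2 * vnorm (x - y)"
      have eD: "L * e = vnorm D / 2" using L by (simp add: e_def)
      have "vnorm E1 \<le> e * vnorm (x - y)" unfolding E1_def using x y r by (intro d1) auto
      also have "\<dots> \<le> L * e * vnorm (x - y)" using L e by (intro mult_right_mono) auto
      finally have 1: "vnorm E1 \<le> c" using eD by (simp add: c_def)
      have E2: "vnorm E2 \<le> e * vnorm (x - y)" unfolding E2_def using x y r by (intro d2) auto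
      then have "vnorm (l * E2) \<le> L * (e * vnorm (x - y))"
        unfolding vnorm_mult using lL L by (intro mult_mono) auto
      then have 2: "vnorm (l * E2) \<le> c" using eD by (simp add: c_def flip: mult.assoc)
      have "vnorm ((l - l0) * poly (pderiv B) t0) \<le> vnorm D / (2 * b) * b"
        unfolding vnorm_mult using l1 e by (intro mult_mono) (auto simp: b_def)
      then have 3: "vnorm ((l - l0) * poly (pderiv B) t0 * (x - y)) \<le> c"
        unfolding vnorm_mult[of "(l - l0) * poly (pderiv B) t0"] c_def using b by (intro mult_right_mono) auto
      have "f x - f y = - ((E1 + l * E2 + (l - l0) * poly (pderiv B) t0 * (x - y)) / D)"
      proof -
        have "E1 + l * E2 + (l - l0) * poly (pderiv B) t0 * (x - y)
          = (poly A x + l * poly B x) - (poly A y + l * poly B y) - D * (x - y)"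
          by (simp add: E1_def E2_def D_def algebra_simps)
        then show ?thesis using D(1) by (simp add: f_def diff_divide_distrib)
      qed
      then have "vnorm (f x - f y) = vnorm (E1 + l * E2 + (l - l0) * poly (pderiv B) t0 * (x - y)) / vnorm D"
        by (simp only: vnorm_minus vnorm_divide)
      also have "\<dots> \<le> c / vnorm D" using 1 2 3 by (intro divide_right_mono vnorm_add_le) auto
      finally show "vnorm (f x - f y) \<le> vnorm (x - y) / 2" using D by (simp add: c_def)
    next
      have "poly A t0 + l * poly B t0 = (l - l0) * poly B t0"
        using root by (simp add: algebra_simps)
      then have "vnorm (f t0 - t0) = vnorm (l - l0) * vnorm (poly B t0) / vnorm D"
        by (simp add: f_def vnorm_divide vnorm_mult)
      also have "\<dots> < r" using l1(3) D B by (simp add: field_simps)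
      finally show "vnorm (f t0 - t0) < r" .
    qed
    then obtain t where t: "vnorm (t - t0) < r" "f t = t" by blast
    then have "poly A t + l * poly B t = 0" using D(1) by (simp add: f_def)
    with Bnz[OF t(1)] show ?thesis by blast
  qed
  ultimately show ?thesis by blast
qed

end

section \<open>Function fields and their places\<close>

lemma prime_subfield_closed [simp, intro]:
  "0 \<in> prime_subfield" "1 \<in> prime_subfield"
  "x \<in> prime_subfield \<Longrightarrow> y \<in> prime_subfield \<Longrightarrow> x + y \<in> prime_subfield"
  "x \<in> prime_subfield \<Longrightarrow> y \<in> prime_subfield \<Longrightarrow> x - y \<in> prime_subfield"
  "x \<in> prime_subfield \<Longrightarrow> y \<in> prime_subfield \<Longrightarrow> x * y \<in> prime_subfield"
  "x \<in> prime_subfield \<Longrightarrow> - x \<in> prime_subfield"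
  unfolding prime_subfield_def
  by (metis of_int_0 rangeI, metis of_int_1 rangeI, (elim rangeE, metis of_int_add rangeI),
      (elim rangeE, metis of_int_diff rangeI), (elim rangeE, metis of_int_mult rangeI),
      (elim rangeE, metis of_int_minus rangeI))

lemma finite_prime_subfield:
  assumes "CHAR('k) > 0"
  shows "finite (prime_subfield :: 'k::field set)"
proof -
  define p where "p = int CHAR('k)"
  have p: "of_int p = (0 :: 'k)" by (simp add: p_def)
  have "of_int n \<in> (of_int ` {0..<p} :: 'k set)" for n
  proof -
    have "of_int n = (of_int (n div p * p + n mod p) :: 'k)" by simp
    also have "\<dots> = of_int (n mod p)" by (simp only: of_int_add of_int_mult p) simp
    finally show ?thesis using assms by (simp add: p_def)
  qed
  then have "(prime_subfield :: 'k set) \<subseteq> of_int ` {0..<p}" unfolding prime_subfield_def by blast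
  then show ?thesis by (rule finite_subset) simp
qed

lemma prime_subfield_inverse:
  fixes x :: "'k::field"
  assumes "CHAR('k) > 0" "x \<in> prime_subfield"
  shows "inverse x \<in> prime_subfield"
proof (cases "x = 0")
  case False
  have "inj_on ((*) x) prime_subfield" using False by (simp add: inj_on_def)
  then have "(*) x ` prime_subfield = prime_subfield"
    using assms finite_prime_subfield by (intro endo_inj_surj) auto
  then obtain y where "y \<in> prime_subfield" "x * y = 1"
    by (metis (no_types, lifting) imageE prime_subfield_closed(2))
  then show ?thesis using inverse_unique by blast
qed simp

lemma subfield_closed:
  assumes "subfield K"
  shows "0 \<in> K" "1 \<in> K" "x \<in> K \<Longrightarrow> y \<in> K \<Longrightarrow> x + y \<in> K" "x \<in> K \<Longrightarrow> y \<in> K \<Longrightarrow> x - y \<in> K"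
    "x \<in> K \<Longrightarrow> y \<in> K \<Longrightarrow> x * y \<in> K" "x \<in> K \<Longrightarrow> inverse x \<in> K" "x \<in> K \<Longrightarrow> y \<in> K \<Longrightarrow> x / y \<in> K"
    "x \<in> K \<Longrightarrow> - x \<in> K" "x \<in> K \<Longrightarrow> x ^ n \<in> K" "x \<in> K \<Longrightarrow> x powi i \<in> K"
proof -
  show 0: "0 \<in> K" "1 \<in> K" and add: "\<And>x y. x \<in> K \<Longrightarrow> y \<in> K \<Longrightarrow> x + y \<in> K"
    and diff: "\<And>x y. x \<in> K \<Longrightarrow> y \<in> K \<Longrightarrow> x - y \<in> K"
    and mult: "\<And>x y. x \<in> K \<Longrightarrow> y \<in> K \<Longrightarrow> x * y \<in> K"
    using assms unfolding subfield_def by auto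
  show inv: "inverse x \<in> K" if "x \<in> K" for x
    using assms that 0 unfolding subfield_def by (cases "x = 0") auto
  show "x / y \<in> K" if "x \<in> K" "y \<in> K" for x y
    using that inv mult by (simp add: divide_inverse)
  show "- x \<in> K" if "x \<in> K" for x using diff[OF 0(1) that] by simp
  show pow: "x ^ n \<in> K" if "x \<in> K" for x n using that 0 mult by (induction n) auto
  show "x powi i \<in> K" if "x \<in> K" for x using that pow inv by (auto simp: power_int_def)
qed

lemma subfield_sum: "subfield K \<Longrightarrow> (\<And>i. i \<in> I \<Longrightarrow> f i \<in> K) \<Longrightarrow> sum f I \<in> K"
  by (induction I rule: infinite_finite_induct) (auto intro: subfield_closed)

lemma prime_subfield_subset: "subfield K \<Longrightarrow> prime_subfield \<subseteq> K"
proof -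
  assume K: "subfield K"
  have "of_nat n \<in> K" for n by (induction n) (auto intro: subfield_closed[OF K])
  then have "of_int i \<in> K" for i
    using subfield_closed(4)[OF K] by (cases i rule: int_diff_cases) auto
  then show ?thesis unfolding prime_subfield_def by auto
qed

lemma prime_subfield_sum: "(\<And>i. i \<in> I \<Longrightarrow> f i \<in> prime_subfield) \<Longrightarrow> sum f I \<in> prime_subfield"
  by (induction I rule: infinite_finite_induct) auto

lemma poly_over_mult: "poly_over prime_subfield p \<Longrightarrow> poly_over prime_subfield q \<Longrightarrow> poly_over prime_subfield (p * q)"
  by (auto simp: poly_over_def coeff_mult intro!: prime_subfield_sum)

section \<open>Dependences over F_p[T] by counting\<close>

locale function_field_basis =
  fixes K :: "'k::field set" and t :: 'k and B :: "'k set"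
  assumes K: "subfield K" and char: "CHAR('k) > 0" and t: "t \<in> K" "transcendental_prime t"
    and B: "finite B" "B \<subseteq> K"
    and span: "K \<subseteq> {\<Sum>b\<in>B. c b * b | c. \<forall>b\<in>B. c b \<in> rat_fun_field t}"
begin

text \<open>A filtration by finite sets of the F_p[t]-module spanned by B. The counting rests on its
  dimension over the prime field growing only linearly in d.\<close>

definition span_deg :: "nat \<Rightarrow> 'k set"
  where "span_deg d = {\<Sum>b\<in>B. \<Sum>k\<le>d. c b k * t ^ k * b | c. \<forall>b k. c b k \<in> prime_subfield}"

lemma span_degI: "(\<And>b k. c b k \<in> prime_subfield) \<Longrightarrow> (\<Sum>b\<in>B. \<Sum>k\<le>d. c b k * t ^ k * b) \<in> span_deg d"
  by (auto simp: span_deg_def)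

lemma span_degE:
  assumes "x \<in> span_deg d"
  obtains c where "\<And>b k. c b k \<in> prime_subfield" "x = (\<Sum>b\<in>B. \<Sum>k\<le>d. c b k * t ^ k * b)"
  using assms by (auto simp: span_deg_def)

lemma span_deg_0: "0 \<in> span_deg d"
  using span_degI[of "\<lambda>_ _. 0" d] by simp

lemma span_deg_add: "x \<in> span_deg d \<Longrightarrow> y \<in> span_deg d \<Longrightarrow> x + y \<in> span_deg d"
proof (elim span_degE)
  fix c c' :: "'k \<Rightarrow> nat \<Rightarrow> 'k"
  assume "\<And>b k. c b k \<in> prime_subfield" "\<And>b k. c' b k \<in> prime_subfield"
    "x = (\<Sum>b\<in>B. \<Sum>k\<le>d. c b k * t ^ k * b)" "y = (\<Sum>b\<in>B. \<Sum>k\<le>d. c' b k * t ^ k * b)"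
  then show ?thesis
    using span_degI[of "\<lambda>b k. c b k + c' b k" d] by (simp add: algebra_simps sum.distrib)
qed

lemma span_deg_scale: "a \<in> prime_subfield \<Longrightarrow> x \<in> span_deg d \<Longrightarrow> a * x \<in> span_deg d"
proof (elim span_degE)
  fix c :: "'k \<Rightarrow> nat \<Rightarrow> 'k"
  assume "a \<in> prime_subfield" "\<And>b k. c b k \<in> prime_subfield" "x = (\<Sum>b\<in>B. \<Sum>k\<le>d. c b k * t ^ k * b)"
  then show ?thesis
    using span_degI[of "\<lambda>b k. a * c b k" d] by (simp add: sum_distrib_left mult.assoc)
qed

lemma span_deg_sum: "(\<And>i. i \<in> I \<Longrightarrow> f i \<in> span_deg d) \<Longrightarrow> sum f I \<in> span_deg d"
  by (induction I rule: infinite_finite_induct) (auto intro: span_deg_0 span_deg_add)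

lemma span_deg_mono:
  assumes "d \<le> d'"
  shows "span_deg d \<subseteq> span_deg d'"
proof
  fix x assume "x \<in> span_deg d"
  then obtain c where c: "\<And>b k. c b k \<in> prime_subfield" "x = (\<Sum>b\<in>B. \<Sum>k\<le>d. c b k * t ^ k * b)"
    by (rule span_degE) blast
  have "(\<Sum>k\<le>d. c b k * t ^ k * b) = (\<Sum>k\<le>d'. (if k \<le> d then c b k else 0) * t ^ k * b)" for b
    using assms by (intro sum.mono_neutral_cong_left) auto
  then show "x \<in> span_deg d'"
    using c span_degI[of "\<lambda>b k. if k \<le> d then c b k else 0" d'] by simp
qed

lemma span_deg_t:
  assumes "x \<in> span_deg d"
  shows "t * x \<in> span_deg (Suc d)"
proof -
  obtain c where c: "\<And>b k. c b k \<in> prime_subfield" "x = (\<Sum>b\<in>B. \<Sum>k\<le>d. c b k * t ^ k * b)"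
    using assms by (rule span_degE) blast
  have "t * (\<Sum>k\<le>d. c b k * t ^ k * b)
      = (\<Sum>k\<le>Suc d. (if k = 0 then 0 else c b (k - 1)) * t ^ k * b)" for b
    by (subst sum.atMost_Suc_shift) (simp add: sum_distrib_left algebra_simps)
  then have "t * x = (\<Sum>b\<in>B. \<Sum>k\<le>Suc d. (if k = 0 then 0 else c b (k - 1)) * t ^ k * b)"
    unfolding c(2) sum_distrib_left[of t] by simp
  then show ?thesis
    using c(1) span_degI[of "\<lambda>b k. if k = 0 then 0 else c b (k - 1)" "Suc d"] by simp
qed

lemma span_deg_t_power: "x \<in> span_deg d \<Longrightarrow> t ^ k * x \<in> span_deg (d + k)"
proof (induction k)
  case (Suc k)
  then show ?case using span_deg_t[of "t ^ k * x"] by (simp add: mult.assoc)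
qed simp

lemma span_deg_poly:
  assumes "poly_over prime_subfield p" "x \<in> span_deg d" "degree p \<le> e"
  shows "poly p t * x \<in> span_deg (d + e)"
proof -
  have "coeff p i * (t ^ i * x) \<in> span_deg (d + e)" if "i \<le> degree p" for i
  proof (rule span_deg_scale)
    show "coeff p i \<in> prime_subfield" using assms(1) by (simp add: poly_over_def)
    show "t ^ i * x \<in> span_deg (d + e)"
      using span_deg_t_power[OF assms(2), of i] span_deg_mono[of "d + i" "d + e"] that assms(3) by auto
  qed
  then have "(\<Sum>i\<le>degree p. coeff p i * (t ^ i * x)) \<in> span_deg (d + e)" by (intro span_deg_sum) auto
  then show ?thesis by (simp add: poly_altdef sum_distrib_right mult.assoc)
qed

lemma basis_span_deg:
  assumes "b \<in> B"
  shows "b \<in> span_deg 0"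
proof -
  have "(\<Sum>b'\<in>B. \<Sum>k\<le>0. (if b' = b then 1 else 0) * t ^ k * b') = (\<Sum>b'\<in>B. if b' = b then b' else 0)"
    by (intro sum.cong) auto
  also have "\<dots> = b" using assms B by (simp add: sum.delta)
  finally show ?thesis using span_degI[of "\<lambda>b' k. if b' = b then 1 else 0" 0] by simp
qed

lemma card_span_deg:
  "finite (span_deg d) \<and> card (span_deg d) \<le> card (prime_subfield :: 'k set) ^ (card B * Suc d)"
proof -
  define X where "X = (B \<times> {..d} \<rightarrow>\<^sub>E (prime_subfield :: 'k set))"
  have fin: "finite X" unfolding X_def using B finite_prime_subfield[OF char] by (intro finite_PiE) auto
  have "card X = card (prime_subfield :: 'k set) ^ (card B * Suc d)"
    unfolding X_def using B by (subst card_PiE) (auto simp: card_cartesian_product)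
  moreover have "span_deg d \<subseteq> (\<lambda>c. \<Sum>b\<in>B. \<Sum>k\<le>d. c (b, k) * t ^ k * b) ` X"
  proof
    fix x assume "x \<in> span_deg d"
    then obtain c where c: "\<And>b k. c b k \<in> prime_subfield" "x = (\<Sum>b\<in>B. \<Sum>k\<le>d. c b k * t ^ k * b)"
      by (rule span_degE) blast
    then show "x \<in> (\<lambda>c. \<Sum>b\<in>B. \<Sum>k\<le>d. c (b, k) * t ^ k * b) ` X"
      by (intro image_eqI[of _ _ "\<lambda>bk\<in>B \<times> {..d}. c (fst bk) (snd bk)"]) (auto simp: X_def)
  qed
  moreover have "card ((\<lambda>c. \<Sum>b\<in>B. \<Sum>k\<le>d. c (b, k) * t ^ k * b) ` X) \<le> card X"
    using fin by (rule card_image_le)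
  ultimately show ?thesis
    using finite_imageI[OF fin] card_mono finite_subset order_trans by (metis (no_types, lifting))
qed

lemma poly_t_nz: "poly_over prime_subfield p \<Longrightarrow> p \<noteq> 0 \<Longrightarrow> poly p t \<noteq> 0"
  using t by (auto simp: transcendental_prime_def)

definition denominator :: "'k poly \<Rightarrow> 'k \<Rightarrow> bool"
  where "denominator p x \<longleftrightarrow> poly_over prime_subfield p \<and> p \<noteq> 0 \<and> (\<exists>d. poly p t * x \<in> span_deg d)"

lemma denominatorD: "denominator p x \<Longrightarrow> poly_over prime_subfield p" "denominator p x \<Longrightarrow> p \<noteq> 0"
  by (auto simp: denominator_def)

lemma denominator_mult:
  assumes "denominator p x" "poly_over prime_subfield q" "q \<noteq> 0"
  shows "denominator (q * p) x"
proof -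
  obtain d where "poly p t * x \<in> span_deg d" using assms unfolding denominator_def by blast
  then have "poly q t * (poly p t * x) \<in> span_deg (d + degree q)"
    using assms by (intro span_deg_poly) auto
  then show ?thesis using assms unfolding denominator_def by (auto simp: poly_over_mult mult.assoc)
qed

lemma denominator_add:
  assumes "denominator p x" "denominator p y"
  shows "denominator p (x + y)"
proof -
  obtain d d' where "poly p t * x \<in> span_deg d" "poly p t * y \<in> span_deg d'"
    using assms unfolding denominator_def by blast
  then have "poly p t * x + poly p t * y \<in> span_deg (max d d')"
    using span_deg_mono[of d "max d d'"] span_deg_mono[of d' "max d d'"] by (intro span_deg_add) auto
  then show ?thesis using assms unfolding denominator_def by (auto simp: distrib_left)
qed

lemma ex_common_denominator:
  assumes "finite S" "\<And>x. x \<in> S \<Longrightarrow> \<exists>p. denominator p x"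
  shows "\<exists>p. poly_over prime_subfield p \<and> p \<noteq> 0 \<and> (\<forall>x\<in>S. denominator p x)"
  using assms
proof (induction S rule: finite_induct)
  case empty
  show ?case by (intro exI[of _ 1]) (auto simp: poly_over_def coeff_1)
next
  case (insert x S)
  have "\<exists>p. poly_over prime_subfield p \<and> p \<noteq> 0 \<and> (\<forall>x\<in>S. denominator p x)"
    by (rule insert.IH) (simp add: insert.prems)
  then obtain p where p: "poly_over prime_subfield p" "p \<noteq> 0" "\<forall>x\<in>S. denominator p x" by auto
  obtain q where q: "denominator q x" using insert.prems[of x] by auto
  have "denominator (p * q) x" using denominator_mult[OF q] p by simp
  moreover have "\<forall>y\<in>S. denominator (p * q) y"
    using denominator_mult[of p _ q] p(3) denominatorD[OF q] by (simp add: mult.commute)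
  ultimately show ?case using denominatorD[of "p * q" x] by auto
qed

lemma ex_denominator:
  assumes "x \<in> K"
  shows "\<exists>p. denominator p x"
proof -
  obtain c where c: "x = (\<Sum>b\<in>B. c b * b)" "\<And>b. b \<in> B \<Longrightarrow> c b \<in> rat_fun_field t"
    using span assms by blast
  have summand: "\<exists>p. denominator p (c b * b)" if b: "b \<in> B" for b
  proof -
    obtain p q where pq: "c b = poly p t / poly q t" "poly_over prime_subfield p"
      "poly_over prime_subfield q" "poly q t \<noteq> 0"
      using c(2)[OF b] by (auto simp: rat_fun_field_def)
    have "poly p t * b \<in> span_deg (0 + degree p)"
      using pq basis_span_deg[OF b] by (intro span_deg_poly) auto
    then have "poly q t * (c b * b) \<in> span_deg (degree p)" using pq by simp
    then show ?thesis using pq unfolding denominator_def by (intro exI[of _ q]) auto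
  qed
  have "\<exists>p. denominator p (\<Sum>b\<in>S. c b * b)" if "S \<subseteq> B" for S
    using finite_subset[OF that B(1)] that
  proof (induction S rule: finite_induct)
    case empty
    show ?case using span_deg_0 by (intro exI[of _ 1]) (auto simp: denominator_def poly_over_def coeff_1)
  next
    case (insert b S)
    then obtain p where p: "denominator p (\<Sum>b\<in>S. c b * b)" by blast
    obtain q where q: "denominator q (c b * b)" using summand[of b] insert by blast
    have "denominator (q * p) (\<Sum>b\<in>S. c b * b)"
      using denominator_mult[OF p] denominatorD[OF q] by simp
    moreover have "denominator (q * p) (c b * b)"
      using denominator_mult[OF q] denominatorD[OF p] by (simp add: mult.commute)
    ultimately have "denominator (q * p) (c b * b + (\<Sum>b\<in>S. c b * b))"
      by (intro denominator_add)
    then show ?case using insert by auto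
  qed
  then show ?thesis using c(1) by auto
qed

lemma ex_common_span_deg:
  assumes "finite S" "S \<subseteq> K"
  shows "\<exists>p d. poly_over prime_subfield p \<and> p \<noteq> 0 \<and> (\<forall>x\<in>S. poly p t * x \<in> span_deg d)"
proof -
  obtain p where p: "poly_over prime_subfield p" "p \<noteq> 0" "\<forall>x\<in>S. denominator p x"
    using ex_common_denominator[OF assms(1)] assms(2) ex_denominator by (metis subsetD)
  then have "\<forall>x\<in>S. \<exists>d. poly p t * x \<in> span_deg d" unfolding denominator_def by simp
  then obtain d where d: "\<forall>x\<in>S. poly p t * x \<in> span_deg (d x)" by (auto dest!: bchoice)
  have "poly p t * x \<in> span_deg (Max (d ` S))" if "x \<in> S" for x
    using d that assms(1) span_deg_mono[of "d x" "Max (d ` S)"] by auto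
  with p show ?thesis by blast
qed

text \<open>Both $G$ and $GT$ raise the degree in the span by at most $\delta$, so the elements
  $G^D T^j g_0 r_i$ with $j < D$ lie in a space of $\mathbb{F}_p$-dimension about $|B| \delta D$.\<close>
lemma linear_dependence:
  assumes T: "T \<in> K"
  shows "\<exists>N. \<forall>r::nat \<Rightarrow> 'k. (\<forall>i<N. r i \<in> K) \<longrightarrow>
    (\<exists>f. (\<forall>i. poly_over prime_subfield (f i)) \<and> (\<exists>i<N. f i \<noteq> 0) \<and> (\<Sum>i<N. poly (f i) T * r i) = 0)"
proof -
  have "finite ((\<lambda>b. T * b) ` B)" "(\<lambda>b. T * b) ` B \<subseteq> K"
    using B T subfield_closed(5)[OF K] by auto
  then obtain g d where g: "poly_over prime_subfield g" "g \<noteq> 0" "\<And>b. b \<in> B \<Longrightarrow> poly g t * (T * b) \<in> span_deg d"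
    using ex_common_span_deg[of "(\<lambda>b. T * b) ` B"] by auto
  define G where "G = poly g t"
  define \<delta> where "\<delta> = max d (degree g)"
  have G: "G \<noteq> 0" using g poly_t_nz by (simp add: G_def)
  have multG: "G * x \<in> span_deg (e + \<delta>)" if "x \<in> span_deg e" for x e
    unfolding G_def using g(1) that by (rule span_deg_poly) (simp add: \<delta>_def)
  have multGT: "G * T * x \<in> span_deg (e + \<delta>)" if x: "x \<in> span_deg e" for x e
  proof -
    obtain c where c: "\<And>b k. c b k \<in> prime_subfield" "x = (\<Sum>b\<in>B. \<Sum>k\<le>e. c b k * t ^ k * b)"
      using x by (rule span_degE) blast
    have "c b k * (t ^ k * (G * (T * b))) \<in> span_deg (e + \<delta>)" if "b \<in> B" "k \<le> e" for b k
    proof (rule span_deg_scale[OF c(1)])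
      have "t ^ k * (G * (T * b)) \<in> span_deg (d + k)"
        using g(3)[OF that(1)] unfolding G_def by (rule span_deg_t_power)
      then show "t ^ k * (G * (T * b)) \<in> span_deg (e + \<delta>)"
        using span_deg_mono[of "d + k" "e + \<delta>"] that unfolding \<delta>_def by fastforce
    qed
    then have "(\<Sum>b\<in>B. \<Sum>k\<le>e. c b k * (t ^ k * (G * (T * b)))) \<in> span_deg (e + \<delta>)"
      by (intro span_deg_sum) auto
    also have "(\<Sum>b\<in>B. \<Sum>k\<le>e. c b k * (t ^ k * (G * (T * b)))) = G * T * x"
      unfolding c(2) sum_distrib_left by (intro sum.cong refl) (simp add: mult.commute mult.left_commute)
    finally show ?thesis .
  qed
  have multG': "G ^ a * x \<in> span_deg (e + a * \<delta>)" if "x \<in> span_deg e" for a x e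
  proof (induction a)
    case (Suc a)
    have "G * (G ^ a * x) \<in> span_deg (e + a * \<delta> + \<delta>)" using Suc by (rule multG)
    then show ?case by (simp add: algebra_simps)
  qed (use that in simp)
  have multGT': "(G * T) ^ a * x \<in> span_deg (e + a * \<delta>)" if "x \<in> span_deg e" for a x e
  proof (induction a)
    case (Suc a)
    have "G * T * ((G * T) ^ a * x) \<in> span_deg (e + a * \<delta> + \<delta>)" using Suc by (rule multGT)
    then show ?case by (simp add: mult.assoc add.commute add.left_commute)
  qed (use that in simp)
  \<comment> \<open>N depends on T alone. The family r enters only through \<open>D0\<close>, and
    taking D powers of T dilutes this: the number N * D of products exceeds the dimension bound
    \<open>card B * Suc (D0 + D * \<delta>)\<close> by \<open>D - (D0 + 1) * card B\<close>, which
    is 1.\<close>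
  define N where "N = \<delta> * card B + 1"
  have "\<exists>f. (\<forall>i. poly_over prime_subfield (f i)) \<and> (\<exists>i<N. f i \<noteq> 0) \<and> (\<Sum>i<N. poly (f i) T * r i) = 0"
    if r: "\<And>i. i < N \<Longrightarrow> r i \<in> K" for r
  proof -
    obtain h D0 where h: "poly_over prime_subfield h" "h \<noteq> 0" "\<And>i. i < N \<Longrightarrow> poly h t * r i \<in> span_deg D0"
      using ex_common_span_deg[of "r ` {..<N}"] r by (auto simp: image_subset_iff)
    define H where "H = poly h t"
    have H: "H \<noteq> 0" using h poly_t_nz by (simp add: H_def)
    define D where "D = (D0 + 1) * card B + 1"
    define u where "u ij = G ^ D * T ^ snd ij * (H * r (fst ij))" for ij
    define A where "A = {..<N} \<times> {..<D}"
    define X where "X = (A \<rightarrow>\<^sub>E (prime_subfield :: 'k set))"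
    define \<Phi> where "\<Phi> c = (\<Sum>ij\<in>A. c ij * u ij)" for c
    have u: "u ij \<in> span_deg (D0 + D * \<delta>)" if A: "ij \<in> A" for ij
    proof -
      obtain i j where ij: "ij = (i, j)" "i < N" "j < D" using A by (auto simp: A_def)
      have "G ^ (D - j) * ((G * T) ^ j * (H * r i)) \<in> span_deg (D0 + j * \<delta> + (D - j) * \<delta>)"
        unfolding H_def by (intro multG' multGT' h(3) ij)
      moreover have "j * \<delta> + (D - j) * \<delta> = D * \<delta>" using ij(3) by (simp flip: add_mult_distrib)
      moreover have "G ^ (D - j) * ((G * T) ^ j * (H * r i)) = u ij"
      proof -
        have "G ^ (D - j) * G ^ j = G ^ D" using ij(3) by (simp flip: power_add)
        then show ?thesis by (simp add: u_def ij power_mult_distrib flip: mult.assoc)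
      qed
      ultimately show ?thesis by (simp add: add.assoc)
    qed
    have "card X = card (prime_subfield :: 'k set) ^ (N * D)"
      unfolding X_def A_def by (subst card_PiE) (auto simp: card_cartesian_product)
    moreover have "card (\<Phi> ` X) \<le> card (prime_subfield :: 'k set) ^ (card B * Suc (D0 + D * \<delta>))"
    proof -
      have "\<Phi> ` X \<subseteq> span_deg (D0 + D * \<delta>)"
        using u by (auto simp: \<Phi>_def X_def intro!: span_deg_sum span_deg_scale)
      then show ?thesis using card_span_deg by (meson card_mono le_trans)
    qed
    moreover have "card (prime_subfield :: 'k set) ^ (card B * Suc (D0 + D * \<delta>))
        < card (prime_subfield :: 'k set) ^ (N * D)"
    proof (rule power_strict_increasing)
      have "card {0, 1 :: 'k} \<le> card (prime_subfield :: 'k set)"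
        by (rule card_mono[OF finite_prime_subfield[OF char]]) auto
      then show "1 < card (prime_subfield :: 'k set)" by simp
      show "card B * Suc (D0 + D * \<delta>) < N * D" by (simp add: N_def D_def algebra_simps)
    qed
    ultimately have "card (\<Phi> ` X) < card X" by linarith
    \<comment> \<open>Counting over the finite prime field replaces linear algebra: two coefficient
      families with equal sums differ by the dependence sought.\<close>
    then have "\<not> inj_on \<Phi> X" by (rule pigeonhole)
    then obtain c c' where cc: "c \<in> X" "c' \<in> X" "c \<noteq> c'" "\<Phi> c = \<Phi> c'" by (auto simp: inj_on_def)
    define f where "f i = (\<Sum>j<D. monom (c (i, j) - c' (i, j)) j)" for i
    define f' where "f' i = (if i < N then f i else 0)" for i
    have coeff_f: "coeff (f i) j = (if j < D then c (i, j) - c' (i, j) else 0)" for i j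
      by (simp add: f_def coeff_sum)
    have "c ij \<in> prime_subfield" "c' ij \<in> prime_subfield" if "ij \<in> A" for ij
      using cc that by (auto simp: X_def)
    then have "poly_over prime_subfield (f' i)" for i
      by (auto simp: poly_over_def f'_def coeff_f A_def)
    moreover have "\<exists>i<N. f' i \<noteq> 0"
    proof -
      obtain ij where ij: "c ij \<noteq> c' ij" using cc(3) by blast
      then have "ij \<in> A" using cc(1,2) unfolding X_def by (metis PiE_arb)
      then obtain i j where "ij = (i, j)" "i < N" "j < D" by (auto simp: A_def)
      then have "coeff (f i) j \<noteq> 0" using ij by (simp add: coeff_f)
      then show ?thesis using \<open>i < N\<close> by (intro exI[of _ i]) (auto simp: f'_def)
    qed
    moreover have "(\<Sum>i<N. poly (f' i) T * r i) = 0"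
    proof -
      have "(\<Sum>i<N. poly (f' i) T * r i) = (\<Sum>i<N. \<Sum>j<D. (c (i, j) - c' (i, j)) * T ^ j * r i)"
        by (intro sum.cong) (auto simp: f'_def f_def poly_sum poly_monom sum_distrib_right)
      also have "\<dots> = (\<Sum>ij\<in>A. (c ij - c' ij) * T ^ snd ij * r (fst ij))"
        unfolding A_def by (simp add: sum.cartesian_product split_def)
      finally have "G ^ D * H * (\<Sum>i<N. poly (f' i) T * r i) = (\<Sum>ij\<in>A. (c ij - c' ij) * u ij)"
        by (simp add: sum_distrib_left u_def algebra_simps)
      also have "\<dots> = \<Phi> c - \<Phi> c'" by (simp add: \<Phi>_def left_diff_distrib sum_subtractf)
      finally have "G ^ D * H * (\<Sum>i<N. poly (f' i) T * r i) = 0" using cc(4) by simp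
      then show ?thesis using G H by simp
    qed
    ultimately show ?thesis by blast
  qed
  then show ?thesis by blast
qed

end

text \<open>For T transcendental over the prime field this bounds the degree of K over F_p(T). It
  has three uses: N bounds the exponents in \<open>power_unit\<close> and the residue degree in
  \<open>residually_independent_bound\<close>, and the dependence between the powers of b is the
  algebraic equation in \<open>ex_monic_multiple\<close>.\<close>

lemma global_function_field_dependence:
  fixes K :: "'k::field set"
  assumes "global_function_field K" "T \<in> K"
  shows "\<exists>N. \<forall>r::nat \<Rightarrow> 'k. (\<forall>i<N. r i \<in> K) \<longrightarrow>
    (\<exists>f. (\<forall>i. poly_over prime_subfield (f i)) \<and> (\<exists>i<N. f i \<noteq> 0) \<and> (\<Sum>i<N. poly (f i) T * r i) = 0)"
proof -
  obtain t B where "function_field_basis K t B"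
    using assms(1) unfolding global_function_field_def function_field_basis_def by blast
  then show ?thesis using assms(2) by (rule function_field_basis.linear_dependence)
qed

section \<open>Places and the ring of \<nu>-integers\<close>

locale place =
  fixes K :: "'k::field set" and w :: "'k \<Rightarrow> int"
  assumes K: "subfield K" and w: "normalized_discrete_valuation K w"
begin

lemma mult: "x \<in> K \<Longrightarrow> y \<in> K \<Longrightarrow> x \<noteq> 0 \<Longrightarrow> y \<noteq> 0 \<Longrightarrow> w (x * y) = w x + w y"
  using w by (auto simp: normalized_discrete_valuation_def)

lemma one: "w 1 = 0"
  using mult[of 1 1] subfield_closed[OF K] by simp

lemma minus_one: "w (- 1) = 0"
  using mult[of "-1" "-1"] subfield_closed[OF K] one by simp

lemma minus: "x \<in> K \<Longrightarrow> w (- x) = w x"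
  using mult[of "-1" x] subfield_closed[OF K] minus_one by (cases "x = 0") auto

lemma power: "x \<in> K \<Longrightarrow> x \<noteq> 0 \<Longrightarrow> w (x ^ n) = int n * w x"
  by (induction n) (auto simp: one mult subfield_closed[OF K] algebra_simps)

text \<open>The predicate encodes the convention $w(0) = \infty$.\<close>

definition at_least :: "int \<Rightarrow> 'k \<Rightarrow> bool"
  where "at_least n x \<longleftrightarrow> x = 0 \<or> n \<le> w x"

lemma at_least_add:
  assumes "x \<in> K" "y \<in> K" "at_least n x" "at_least n y"
  shows "at_least n (x + y)"
proof (cases "x = 0 \<or> y = 0 \<or> x + y = 0")
  case False
  then have "w (x + y) \<ge> min (w x) (w y)"
    using assms w unfolding normalized_discrete_valuation_def by auto
  with False assms show ?thesis by (auto simp: at_least_def)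
qed (use assms in \<open>auto simp: at_least_def\<close>)

lemma at_least_minus: "x \<in> K \<Longrightarrow> at_least n (- x) \<longleftrightarrow> at_least n x"
  by (simp add: at_least_def minus)

lemma at_least_mult: "x \<in> K \<Longrightarrow> y \<in> K \<Longrightarrow> at_least m x \<Longrightarrow> at_least n y \<Longrightarrow> at_least (m + n) (x * y)"
  using mult[of x y] by (cases "x = 0 \<or> y = 0") (auto simp: at_least_def)

lemma at_least_sum:
  "(\<And>i. i \<in> I \<Longrightarrow> f i \<in> K) \<Longrightarrow> (\<And>i. i \<in> I \<Longrightarrow> at_least n (f i)) \<Longrightarrow> at_least n (sum f I)"
proof (induction I rule: infinite_finite_induct)
  case (insert i I)
  then show ?case by (auto intro!: at_least_add subfield_sum[OF K])
qed (auto simp: at_least_def)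

end

lemma nu_integers_iff:
  "x \<in> nu_integers K v \<longleftrightarrow> x \<in> K \<and> (\<forall>w. normalized_discrete_valuation K w \<and> (\<exists>y\<in>K-{0}. w y \<noteq> v y)
     \<longrightarrow> place.at_least w 0 x)" if "subfield K"
  using that by (auto simp: nu_integers_def place.at_least_def place_def)

lemma nu_integers_closed:
  assumes K: "subfield K"
  shows "0 \<in> nu_integers K v" "1 \<in> nu_integers K v"
    "x \<in> nu_integers K v \<Longrightarrow> y \<in> nu_integers K v \<Longrightarrow> x + y \<in> nu_integers K v"
    "x \<in> nu_integers K v \<Longrightarrow> - x \<in> nu_integers K v"
    "x \<in> nu_integers K v \<Longrightarrow> y \<in> nu_integers K v \<Longrightarrow> x - y \<in> nu_integers K v"
    "x \<in> nu_integers K v \<Longrightarrow> y \<in> nu_integers K v \<Longrightarrow> x * y \<in> nu_integers K v"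
    "x \<in> nu_integers K v \<Longrightarrow> x ^ n \<in> nu_integers K v"
proof -
  have p: "place K w" if "normalized_discrete_valuation K w" for w
    using that K by (simp add: place_def)
  show 0: "0 \<in> nu_integers K v" and 1: "1 \<in> nu_integers K v"
    using subfield_closed[OF K] p place.one place.at_least_def by (fastforce simp: nu_integers_def)+
  show add: "x + y \<in> nu_integers K v" if "x \<in> nu_integers K v" "y \<in> nu_integers K v" for x y
    using that subfield_closed[OF K] place.at_least_add[OF p] by (auto simp: nu_integers_iff[OF K])
  show min: "- x \<in> nu_integers K v" if "x \<in> nu_integers K v" for x
    using that subfield_closed[OF K] place.at_least_minus[OF p] by (auto simp: nu_integers_iff[OF K])
  show "x - y \<in> nu_integers K v" if "x \<in> nu_integers K v" "y \<in> nu_integers K v" for x y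
    using add[OF that(1) min[OF that(2)]] by simp
  show mul: "x * y \<in> nu_integers K v" if "x \<in> nu_integers K v" "y \<in> nu_integers K v" for x y
    using that subfield_closed[OF K] place.at_least_mult[OF p, of _ x y 0 0] by (auto simp: nu_integers_iff[OF K])
  show "x ^ n \<in> nu_integers K v" if "x \<in> nu_integers K v" for x n
    using that 1 mul by (induction n) auto
qed

lemma nu_integers_sum:
  "subfield K \<Longrightarrow> (\<And>i. i \<in> I \<Longrightarrow> f i \<in> nu_integers K v) \<Longrightarrow> sum f I \<in> nu_integers K v"
  by (induction I rule: infinite_finite_induct) (auto intro: nu_integers_closed)

lemma prime_subfield_nu_integers: "subfield K \<Longrightarrow> prime_subfield \<subseteq> nu_integers K v"
proof -
  assume K: "subfield K"
  have "of_nat n \<in> nu_integers K v" for n by (induction n) (auto intro: nu_integers_closed[OF K])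
  then have "of_int i \<in> nu_integers K v" for i
    using nu_integers_closed(5)[OF K] by (cases i rule: int_diff_cases) auto
  then show ?thesis unfolding prime_subfield_def by auto
qed

lemma nu_integers_poly:
  "subfield K \<Longrightarrow> poly_over prime_subfield p \<Longrightarrow> x \<in> nu_integers K v \<Longrightarrow> poly p x \<in> nu_integers K v"
  unfolding poly_altdef using prime_subfield_nu_integers
  by (intro nu_integers_sum nu_integers_closed) (auto simp: poly_over_def)

text \<open>An intersection of valuation rings is integrally closed: where w b < 0, the right side
  has order at least (m - 1) w b, which exceeds m w b.\<close>

lemma nu_integers_integral:
  assumes K: "subfield K" and b: "b \<in> K" and m: "m > 0"
    and a: "\<And>i. i < m \<Longrightarrow> a i \<in> nu_integers K v" and eq: "b ^ m = (\<Sum>i<m. a i * b ^ i)"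
  shows "b \<in> nu_integers K v"
  unfolding nu_integers_iff[OF K]
proof (intro conjI b allI impI)
  fix w assume hw: "normalized_discrete_valuation K w \<and> (\<exists>y\<in>K - {0}. w y \<noteq> v y)"
  interpret place K w using K hw by (simp add: place_def)
  show "at_least 0 b"
  proof (rule ccontr)
    assume "\<not> at_least 0 b"
    then have b0: "b \<noteq> 0" "w b < 0" by (auto simp: at_least_def)
    have "at_least (int (m - 1) * w b) (\<Sum>i<m. a i * b ^ i)"
    proof (rule at_least_sum)
      fix i assume i: "i \<in> {..<m}"
      then have ai: "a i \<in> K" "at_least 0 (a i)"
        using a[of i] i hw unfolding nu_integers_iff[OF K] lessThan_iff by blast+
      then show "a i * b ^ i \<in> K" by (intro subfield_closed(5,9)[OF K] b)
      have "int (m - 1) * w b \<le> int i * w b" using i b0 by (intro mult_right_mono_neg) auto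
      then have "at_least (int (m - 1) * w b) (b ^ i)" using b b0 by (simp add: at_least_def power)
      then show "at_least (int (m - 1) * w b) (a i * b ^ i)"
        using at_least_mult[OF ai(1) subfield_closed(9)[OF K b] ai(2)] by simp
    qed
    then have "at_least (int (m - 1) * w b) (b ^ m)" by (simp only: eq)
    then have "int (m - 1) * w b \<le> int m * w b"
      using b0(1) unfolding at_least_def power[OF b b0(1)] by simp
    moreover have "int m * w b = int (m - 1) * w b + w b"
      using m by (cases m) (auto simp: algebra_simps)
    ultimately show False using b0(2) by linarith
  qed
qed

section \<open>Existence of places through maximal subrings, after Chevalley\<close>

locale subring_of =
  fixes K R :: "'k::field set"
  assumes K: "subfield K" and R: "R \<subseteq> K" "1 \<in> R" "\<And>x y. x \<in> R \<Longrightarrow> y \<in> R \<Longrightarrow> x - y \<in> R"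
    "\<And>x y. x \<in> R \<Longrightarrow> y \<in> R \<Longrightarrow> x * y \<in> R"
begin

lemma zero: "0 \<in> R" using R(3)[OF R(2) R(2)] by simp
lemma uminus: "x \<in> R \<Longrightarrow> - x \<in> R" using R(3)[OF zero] by simp
lemma add: "x \<in> R \<Longrightarrow> y \<in> R \<Longrightarrow> x + y \<in> R" using R(3)[OF _ uminus] by fastforce
lemma power: "x \<in> R \<Longrightarrow> x ^ n \<in> R" using R by (induction n) auto
lemma sum: "(\<And>i. i \<in> I \<Longrightarrow> f i \<in> R) \<Longrightarrow> sum f I \<in> R"
  by (induction I rule: infinite_finite_induct) (auto intro: zero add)

lemma of_int: "of_int n \<in> R"
proof -
  have "of_nat n \<in> R" for n using R(2) zero add by (induction n) auto
  then show ?thesis using R(3) by (cases n rule: int_diff_cases) auto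
qed

definition adjoin :: "'k \<Rightarrow> 'k set"
  where "adjoin y = {\<Sum>i\<le>n. a i * y ^ i | a n. \<forall>i::nat. a i \<in> R}"

lemma adjoin_iff: "x \<in> adjoin y \<longleftrightarrow> (\<exists>p. (\<forall>i. coeff p i \<in> R) \<and> x = poly p y)"
proof
  assume "x \<in> adjoin y"
  then obtain a n where a: "x = (\<Sum>i\<le>n. a i * y ^ i)" "\<And>i::nat. a i \<in> R" by (auto simp: adjoin_def)
  then have "x = poly (\<Sum>i\<le>n. monom (a i) i) y" by (simp add: poly_sum poly_monom)
  moreover have "coeff (\<Sum>i\<le>n. monom (a i) i) j \<in> R" for j
    using a(2) zero by (auto simp: coeff_sum)
  ultimately show "\<exists>p. (\<forall>i. coeff p i \<in> R) \<and> x = poly p y" by blast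
next
  assume "\<exists>p. (\<forall>i. coeff p i \<in> R) \<and> x = poly p y"
  then show "x \<in> adjoin y" unfolding adjoin_def poly_altdef by blast
qed

lemma adjoin_subring:
  assumes "y \<in> K"
  shows "subring_of K (adjoin y)" "R \<subseteq> adjoin y" "y \<in> adjoin y"
proof -
  show "R \<subseteq> adjoin y"
  proof
    fix x assume "x \<in> R"
    then have "\<forall>i. coeff [:x:] i \<in> R" using zero by (auto simp: coeff_pCons split: nat.split)
    then show "x \<in> adjoin y" unfolding adjoin_iff by (intro exI[of _ "[:x:]"]) auto
  qed
  then have one: "1 \<in> adjoin y" using R(2) by blast
  have "\<forall>i. coeff [:0, 1:] i \<in> R" using zero R(2) by (auto simp: coeff_pCons split: nat.split)
  then show "y \<in> adjoin y" unfolding adjoin_iff by (intro exI[of _ "[:0, 1:]"]) auto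
  show "subring_of K (adjoin y)"
  proof
    show "subfield K" by (rule K)
    show "adjoin y \<subseteq> K"
    proof
      fix x assume "x \<in> adjoin y"
      then obtain a n where "x = (\<Sum>i\<le>n. a i * y ^ i)" "\<And>i::nat. a i \<in> R" by (auto simp: adjoin_def)
      then show "x \<in> K" using R(1) assms by (auto intro!: subfield_sum[OF K] subfield_closed[OF K])
    qed
    show "1 \<in> adjoin y" by (rule one)
    show "x - z \<in> adjoin y" if xz: "x \<in> adjoin y" "z \<in> adjoin y" for x z
    proof -
      obtain p q where "\<forall>i. coeff p i \<in> R" "x = poly p y" "\<forall>i. coeff q i \<in> R" "z = poly q y"
        using xz unfolding adjoin_iff by blast
      then show ?thesis unfolding adjoin_iff using R(3) by (intro exI[of _ "p - q"]) auto
    qed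
    show "x * z \<in> adjoin y" if xz: "x \<in> adjoin y" "z \<in> adjoin y" for x z
    proof -
      obtain p q where "\<forall>i. coeff p i \<in> R" "x = poly p y" "\<forall>i. coeff q i \<in> R" "z = poly q y"
        using xz unfolding adjoin_iff by blast
      then show ?thesis unfolding adjoin_iff using R(4)
        by (intro exI[of _ "p * q"]) (auto simp: coeff_mult intro!: sum)
    qed
  qed
qed

end

locale maximal_subring = subring_of +
  fixes T :: 'a
  assumes T: "T \<in> R" "T \<noteq> 0" "inverse T \<notin> R"
    and maximal: "\<And>S. subring_of K S \<Longrightarrow> R \<subseteq> S \<Longrightarrow> inverse T \<notin> S \<Longrightarrow> S = R"
begin

lemma adjoin_mem: "y \<in> K \<Longrightarrow> y \<notin> R \<Longrightarrow> inverse T \<in> adjoin y"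
  using maximal[of "adjoin y"] adjoin_subring[of y] by blast

text \<open>If u = 1 - T b were no unit, maximality would put \<open>inverse T\<close> into R[1/u];
  clearing denominators, u^n / T would lie in R. But u^n is 1 modulo T, so \<open>inverse T\<close>
  itself would lie in R.\<close>

lemma one_minus_unit:
  assumes b: "b \<in> R"
  shows "1 - T * b \<noteq> 0" "inverse (1 - T * b) \<in> R"
proof -
  define u where "u = 1 - T * b"
  show "1 - T * b \<noteq> 0"
  proof
    assume "1 - T * b = 0"
    then have "inverse T = b" using T(2) by (simp add: field_simps)
    then show False using T(3) b by simp
  qed
  then have u: "u \<noteq> 0" "u \<in> R" using b T R by (auto simp: u_def)
  show "inverse (1 - T * b) \<in> R"
  proof (rule ccontr)
    assume "inverse (1 - T * b) \<notin> R"
    then have "inverse T \<in> adjoin (inverse u)"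
      using u R(1) by (intro adjoin_mem subfield_closed[OF K]) (auto simp: u_def)
    then obtain a n where a: "inverse T = (\<Sum>i\<le>n. a i * inverse u ^ i)" "\<And>i::nat. a i \<in> R"
      by (auto simp: adjoin_def)
    have "inverse T * u ^ n = (\<Sum>i\<le>n. a i * u ^ (n - i))"
      unfolding a(1) sum_distrib_right using u(1)
      by (intro sum.cong) (auto simp: power_diff power_inverse field_simps)
    also have "\<dots> \<in> R" using a(2) u(2) by (intro sum R(4) power) auto
    finally have 1: "inverse T * u ^ n \<in> R" .
    have "\<exists>c\<in>R. u ^ n = 1 - T * c" for n
    proof (induction n)
      case 0
      show ?case using zero by (intro bexI[of _ 0]) auto
    next
      case (Suc n)
      then obtain c where c: "c \<in> R" "u ^ n = 1 - T * c" by blast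
      have "u ^ Suc n = (1 - T * b) * (1 - T * c)" unfolding c(2)[symmetric] by (simp add: u_def)
      then have "u ^ Suc n = 1 - T * (b + c - T * (b * c))" by (simp add: algebra_simps)
      moreover have "b + c - T * (b * c) \<in> R" by (intro R(3,4) add b c T)
      ultimately show ?case by blast
    qed
    then obtain c where c: "c \<in> R" "u ^ n = 1 - T * c" by blast
    then have "inverse T * u ^ n + c = inverse T" using T(2) by (simp add: field_simps)
    then show False using add[OF 1 c(1)] T(3) by simp
  qed
qed

definition expansion :: "'a \<Rightarrow> nat \<Rightarrow> bool"
  where "expansion y n \<longleftrightarrow> (\<exists>a. (\<forall>i::nat. a i \<in> R) \<and> inverse T = (\<Sum>i\<le>n. a i * y ^ i))"

text \<open>Chevalley's shortening. The relation in \<open>inverse y\<close> makes the unit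
  \<open>1 - T * b 0\<close> a combination of negative powers of y. Multiplied by
  \<open>y ^ n\<close>, it expresses \<open>y ^ n\<close> by the powers from n - m to n - 1, and
  this is substituted for the top term.\<close>

lemma expansion_reduce:
  assumes y: "y \<noteq> 0" and n: "expansion y n" and m: "expansion (inverse y) m" and mn: "1 \<le> m" "m \<le> n"
  shows "expansion y (n - 1)"
proof -
  obtain a where a: "\<And>i::nat. a i \<in> R" "inverse T = (\<Sum>i\<le>n. a i * y ^ i)"
    using n unfolding expansion_def by blast
  obtain b where b: "\<And>i::nat. b i \<in> R" "inverse T = (\<Sum>i\<le>m. b i * inverse y ^ i)"
    using m unfolding expansion_def by blast
  define u where "u = inverse (1 - T * b 0)"
  have u: "u \<in> R" "u * (1 - T * b 0) = 1" using one_minus_unit[OF b(1)] by (auto simp: u_def)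
  have "1 = T * (\<Sum>i\<le>m. b i * inverse y ^ i)" using b(2) T(2) by (metis right_inverse)
  also have "(\<Sum>i\<le>m. b i * inverse y ^ i) = b 0 + (\<Sum>i=1..m. b i * inverse y ^ i)"
    by (simp add: sum.atLeast_Suc_atMost atMost_atLeast0)
  finally have "1 - T * b 0 = T * (\<Sum>i=1..m. b i * inverse y ^ i)" by (simp add: algebra_simps)
  then have "1 = u * (T * (\<Sum>i=1..m. b i * inverse y ^ i))" using u(2) by simp
  then have "y ^ n = u * (T * (\<Sum>i=1..m. b i * inverse y ^ i)) * y ^ n" by simp
  also have "\<dots> = (\<Sum>i=1..m. u * T * b i * (inverse y ^ i * y ^ n))"
    by (simp add: sum_distrib_left sum_distrib_right mult.assoc)
  also have "\<dots> = (\<Sum>i=1..m. u * T * b i * y ^ (n - i))"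
    using y mn by (intro sum.cong) (auto simp: power_diff power_inverse field_simps)
  also have "\<dots> = (\<Sum>j\<in>{n-m..n-1}. u * T * b (n - j) * y ^ j)"
    by (rule sum.reindex_bij_witness[of _ "\<lambda>j. n - j" "\<lambda>i. n - i"]) (use mn in auto)
  also have "\<dots> = (\<Sum>j\<le>n-1. (if n - m \<le> j then u * T * b (n - j) else 0) * y ^ j)"
    by (intro sum.mono_neutral_cong_left) auto
  finally have yn: "y ^ n = (\<Sum>j\<le>n-1. (if n - m \<le> j then u * T * b (n - j) else 0) * y ^ j)" .
  have "inverse T = (\<Sum>i\<le>n-1. a i * y ^ i) + a n * y ^ n"
    using mn unfolding a(2) by (cases n) auto
  also have "\<dots> = (\<Sum>i\<le>n-1. (a i + a n * (if n - m \<le> i then u * T * b (n - i) else 0)) * y ^ i)"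
    unfolding yn by (simp add: sum_distrib_left sum.distrib algebra_simps)
  finally show ?thesis unfolding expansion_def
    using a(1) b(1) u(1) T(1) R(4) zero
    by (intro exI[of _ "\<lambda>i. a i + a n * (if n - m \<le> i then u * T * b (n - i) else 0)"]) (auto intro!: add)
qed

text \<open>If neither element lies in R, adjoining either of them yields \<open>inverse T\<close>.
  Of the two shortest expansions, the longer could be shortened with the help of the other.\<close>

lemma valuation_ring:
  assumes y: "y \<in> K" "y \<noteq> 0"
  shows "y \<in> R \<or> inverse y \<in> R"
proof (rule ccontr)
  assume "\<not> (y \<in> R \<or> inverse y \<in> R)"
  then have "\<exists>n. expansion y n" "\<exists>n. expansion (inverse y) n"
    using adjoin_mem[of y] adjoin_mem[of "inverse y"] y subfield_closed(6)[OF K y(1)]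
    unfolding expansion_def adjoin_def by auto
  then have L: "expansion y (LEAST n. expansion y n)"
    "expansion (inverse y) (LEAST n. expansion (inverse y) n)"
    by (auto intro: LeastI_ex)
  define n where "n = (LEAST n. expansion y n)"
  define m where "m = (LEAST n. expansion (inverse y) n)"
  have nm: "expansion y n" "expansion (inverse y) m" using L by (auto simp: n_def m_def)
  have "\<not> expansion z 0" for z using T(3) by (auto simp: expansion_def)
  then have pos: "1 \<le> n" "1 \<le> m" using nm by (metis One_nat_def Suc_leI gr0I)+
  show False
  proof (cases "m \<le> n")
    case True
    then have "expansion y (n - 1)" using expansion_reduce y nm pos by blast
    then have "n \<le> n - 1" unfolding n_def by (rule Least_le)
    then show False using pos by simp
  next
    case False
    then have "expansion (inverse y) (m - 1)"
      using expansion_reduce[of "inverse y" m n] y nm pos by simp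
    then have "m \<le> m - 1" unfolding m_def by (rule Least_le)
    then show False using pos by simp
  qed
qed

definition unit :: "'a \<Rightarrow> bool"
  where "unit x \<longleftrightarrow> x \<noteq> 0 \<and> x \<in> R \<and> inverse x \<in> R"

lemma unit_mult: "unit x \<Longrightarrow> unit y \<Longrightarrow> unit (x * y)"
  using R(4) by (auto simp: unit_def)

lemma unit_inverse: "unit x \<Longrightarrow> unit (inverse x)"
  by (auto simp: unit_def)

lemma unit_power: "unit x \<Longrightarrow> unit (x ^ n)"
proof (induction n)
  case 0
  then show ?case using R(2) by (simp add: unit_def)
next
  case (Suc n)
  then show ?case using unit_mult[of x "x ^ n"] by simp
qed

lemma unit_K: "unit x \<Longrightarrow> x \<in> K"
  using R by (auto simp: unit_def)

lemma nonunit_add: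
  assumes "x \<in> R" "y \<in> R" "\<not> unit x" "\<not> unit y"
  shows "\<not> unit (x + y)"
proof
  assume u: "unit (x + y)"
  have *: False if x: "x \<in> R" "\<not> unit x" "x / y \<in> R" "y \<noteq> 0" and y: "y \<in> R" "\<not> unit y"
    and u: "unit (x + y)" for x y
  proof -
    have "x + y = y * (1 + x / y)" using x by (simp add: field_simps)
    then have "inverse y = inverse (x + y) * (1 + x / y)"
      using u x(4) by (auto simp: unit_def field_simps)
    then have "inverse y \<in> R" using u x R by (auto simp: unit_def intro!: R(4) add)
    then show False using y x(4) by (auto simp: unit_def)
  qed
  show False
  proof (cases "x = 0 \<or> y = 0")
    case True
    then show ?thesis using u assms by auto
  next
    case False
    then have "x / y \<in> R \<or> inverse (x / y) \<in> R"
      using assms R(1) by (intro valuation_ring subfield_closed[OF K]) auto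
    then show ?thesis
      using *[of x y] *[of y x] assms False u by (auto simp: add.commute)
  qed
qed

lemma T_powi_unit: "unit (T powi k) \<longleftrightarrow> k = 0"
proof
  have pos: "\<not> unit (T ^ Suc n)" for n
  proof
    assume "unit (T ^ Suc n)"
    then have "T ^ n * inverse (T ^ Suc n) \<in> R" using power[OF T(1)] R(4) by (auto simp: unit_def)
    then show False using T(2,3) by (simp add: field_simps)
  qed
  assume u: "unit (T powi k)"
  show "k = 0"
  proof (cases k "0 :: int" rule: linorder_cases)
    case less
    then have "unit (T ^ nat (- k))"
      using unit_inverse[OF u] by (simp add: power_int_def power_inverse)
    then show ?thesis using pos[of "nat (- k) - 1"] less by simp
  next
    case greater
    then have "unit (T ^ nat k)" using u by (simp add: power_int_def)
    then show ?thesis using pos[of "nat k - 1"] greater by simp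
  qed
next
  show "k = 0 \<Longrightarrow> unit (T powi k)" using R(2) by (simp add: unit_def)
qed

lemma finite_min:
  assumes "finite S" "S \<noteq> {}" "\<And>i. i \<in> S \<Longrightarrow> z i \<in> K \<and> z i \<noteq> 0"
  shows "\<exists>j\<in>S. \<forall>i\<in>S. z i / z j \<in> R"
  using assms
proof (induction S rule: finite_ne_induct)
  case (singleton i)
  then show ?case using R(2) by simp
next
  case (insert k S)
  then obtain j where j: "j \<in> S" "\<And>i. i \<in> S \<Longrightarrow> z i / z j \<in> R" by auto
  have nz: "z j \<noteq> 0" "z k \<noteq> 0" "z k / z j \<in> K"
    using insert.prems j(1) by (auto intro: subfield_closed[OF K])
  show ?case
  proof (cases "z k / z j \<in> R")
    case True
    then show ?thesis using j by (intro bexI[of _ j]) auto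
  next
    case False
    then have jk: "z j / z k \<in> R" using valuation_ring[OF nz(3)] nz by (simp add: inverse_eq_divide)
    have "z i / z k \<in> R" if "i \<in> S" for i
    proof -
      have "z i / z k = (z i / z j) * (z j / z k)" using nz by simp
      then show ?thesis using R(4)[OF j(2)[OF that] jk] by metis
    qed
    then show ?thesis using R(2) nz by (intro bexI[of _ k]) auto
  qed
qed

lemma nonunit_sum:
  assumes "\<And>i. i \<in> S \<Longrightarrow> z i \<in> R \<and> \<not> unit (z i)"
  shows "sum z S \<in> R \<and> \<not> unit (sum z S)"
  using assms
proof (induction S rule: infinite_finite_induct)
  case (insert i S)
  then show ?case using nonunit_add[of "z i" "sum z S"] add[of "z i" "sum z S"] by auto
qed (auto simp: zero unit_def)

text \<open>The lowest nonzero coefficient is a constant, hence a unit, and what follows it is a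
  multiple of T, which \<open>one_minus_unit\<close> absorbs.\<close>

lemma poly_T_unit:
  assumes "CHAR('a) > 0"
  shows "poly_over prime_subfield f \<Longrightarrow> f \<noteq> 0 \<Longrightarrow> \<exists>k u. unit u \<and> poly f T = T ^ k * u"
proof (induction f)
  case (pCons a p)
  have p: "poly_over prime_subfield p" and a: "a \<in> prime_subfield"
    using pCons.prems(1) unfolding poly_over_def by (auto simp: coeff_pCons dest: spec[of _ 0] spec[of _ "Suc _"])
  show ?case
  proof (cases "a = 0")
    case True
    then obtain k u where "unit u" "poly p T = T ^ k * u" using pCons p by auto
    then show ?thesis using True by (intro exI[of _ "Suc k"] exI[of _ u]) simp
  next
    case False
    have Fp: "b \<in> R" if "b \<in> prime_subfield" for b using that of_int by (auto simp: prime_subfield_def)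
    have "poly p T \<in> R" unfolding poly_altdef
      using p T(1) by (intro sum R(4) power) (auto simp: poly_over_def intro: Fp)
    moreover have ia: "inverse a \<in> R" using prime_subfield_inverse[OF assms a] by (rule Fp)
    ultimately have c: "- (poly p T * inverse a) \<in> R" by (intro uminus R(4))
    define v where "v = 1 - T * (- (poly p T * inverse a))"
    have v: "unit v" using one_minus_unit[OF c] R(3)[OF R(2) R(4)[OF T(1) c]] by (simp add: v_def unit_def)
    have "poly (pCons a p) T = a * v" using False by (simp add: v_def field_simps)
    moreover have "unit a" using False ia Fp[OF a] by (simp add: unit_def)
    ultimately show ?thesis using v by (intro exI[of _ 0] exI[of _ "a * v"]) (simp add: unit_mult)
  qed
qed simp

end

locale finite_maximal_subring = maximal_subring +
  fixes N :: nat
  assumes char: "CHAR('a) > 0"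
    and dependence: "\<And>r. (\<And>i. i < N \<Longrightarrow> r i \<in> K) \<Longrightarrow> \<exists>f. (\<forall>i. poly_over prime_subfield (f i)) \<and>
      (\<exists>i<N. f i \<noteq> 0) \<and> (\<Sum>i<N. poly (f i) T * r i) = 0"
begin

lemma T_K: "T \<in> K" using T R by blast

text \<open>A dependence between the powers of $y$ over $\mathbb{F}_p[T]$ must have two terms of equal
  valuation, so that some power of $y$ is a unit times a power of $T$.\<close>
lemma power_unit:
  assumes y: "y \<in> K" "y \<noteq> 0"
  shows "\<exists>e k. 1 \<le> e \<and> e < N \<and> unit (y ^ e * T powi k)"
proof -
  obtain f where f: "\<And>i. poly_over prime_subfield (f i)" "\<exists>i<N. f i \<noteq> 0" "(\<Sum>i<N. poly (f i) T * y ^ i) = 0"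
    using dependence[of "\<lambda>i. y ^ i"] subfield_closed(9)[OF K y(1)] by blast
  define S where "S = {i. i < N \<and> f i \<noteq> 0}"
  have S: "finite S" "S \<noteq> {}" using f(2) by (auto simp: S_def)
  have "\<exists>k u. unit u \<and> poly (f i) T = T ^ k * u" if "i \<in> S" for i
    using that poly_T_unit[OF char f(1)] by (simp add: S_def)
  then obtain k u where ku: "\<And>i. i \<in> S \<Longrightarrow> unit (u i)" "\<And>i. i \<in> S \<Longrightarrow> poly (f i) T = T ^ k i * u i"
    by metis
  define z where "z i = poly (f i) T * y ^ i" for i
  have z: "z i \<in> K \<and> z i \<noteq> 0" if "i \<in> S" for i
    using ku[OF that] T T_K y unit_K[OF ku(1)[OF that]]
    by (auto simp: z_def unit_def intro!: subfield_closed[OF K])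
  have "sum z S = 0"
    unfolding f(3)[symmetric] by (intro sum.mono_neutral_cong_left) (auto simp: S_def z_def)
  have "\<exists>j\<in>S. \<forall>i\<in>S. z i / z j \<in> R" using S z by (rule finite_min)
  then obtain j where j: "j \<in> S" "\<And>i. i \<in> S \<Longrightarrow> z i / z j \<in> R" by auto
  have "\<exists>i\<in>S - {j}. unit (z i / z j)"
  proof (rule ccontr)
    assume "\<not> ?thesis"
    then have "\<not> unit (\<Sum>i\<in>S - {j}. z i / z j)"
      using nonunit_sum[of "S - {j}" "\<lambda>i. z i / z j"] j(2) by blast
    moreover have "(\<Sum>i\<in>S - {j}. z i / z j) = - 1"
    proof -
      have "z j + (\<Sum>i\<in>S - {j}. z i) = 0" using \<open>sum z S = 0\<close> j(1) S(1) by (simp add: sum.remove)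
      then have "(\<Sum>i\<in>S - {j}. z i) = - z j" by (simp add: eq_neg_iff_add_eq_0 add.commute)
      then show ?thesis using z[OF j(1)] by (simp flip: sum_divide_distrib)
    qed
    moreover have "unit (- 1)" using R(2) uminus by (simp add: unit_def)
    ultimately show False by simp
  qed
  then obtain i where i: "i \<in> S" "i \<noteq> j" "unit (z i / z j)" by blast
  have *: "\<exists>e k. 1 \<le> e \<and> e < N \<and> unit (y ^ e * T powi k)"
    if "i \<in> S" "j \<in> S" "j < i" and u: "unit (z i / z j)" for i j
  proof -
    have uj: "u j \<noteq> 0" "u i \<noteq> 0" using ku(1) that by (auto simp: unit_def)
    have "z i / z j = (u i * inverse (u j)) * (y ^ (i - j) * T powi (int (k i) - int (k j)))"
      using ku(2) that uj T y
      by (simp add: z_def power_diff power_int_diff field_simps)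
    then have "(z i / z j) * (u j * inverse (u i))
        = (u i * inverse (u j) * (u j * inverse (u i))) * (y ^ (i - j) * T powi (int (k i) - int (k j)))"
      by (simp only: mult_ac)
    also have "u i * inverse (u j) * (u j * inverse (u i)) = 1" using uj by (simp add: field_simps)
    finally have "(z i / z j) * (u j * inverse (u i)) = y ^ (i - j) * T powi (int (k i) - int (k j))"
      by simp
    moreover have "unit ((z i / z j) * (u j * inverse (u i)))"
      by (intro unit_mult[OF u] unit_mult ku(1) unit_inverse that)
    ultimately have "unit (y ^ (i - j) * T powi (int (k i) - int (k j)))" by simp
    moreover have "1 \<le> i - j" "i - j < N" using that by (auto simp: S_def)
    ultimately show ?thesis by blast
  qed
  show ?thesis
  proof (cases "j < i")
    case True
    then show ?thesis using *[OF i(1) j(1) _ i(3)] by simp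
  next
    case False
    then show ?thesis using *[OF j(1) i(1)] i(2) unit_inverse[OF i(3)] by simp
  qed
qed

text \<open>By \<open>power_unit\<close> some y^e with 1 \<le> e < N is a unit times a power of T,
  but e depends on y. All these e divide \<open>fact N\<close>, so this common exponent attaches one
  integer to every y, at the price of \<open>ord0 T = fact N\<close>.\<close>

definition ord0 :: "'a \<Rightarrow> int"
  where "ord0 y = (THE k. unit (y ^ fact N * T powi (- k)))"

lemma ord0_eqI:
  assumes "y \<noteq> 0" "unit (y ^ fact N * T powi (- k))"
  shows "ord0 y = k"
  unfolding ord0_def
proof (rule the_equality)
  fix l assume "unit (y ^ fact N * T powi (- l))"
  then have "unit (inverse (y ^ fact N * T powi (- l)) * (y ^ fact N * T powi (- k)))"
    using assms(2) by (rule unit_mult[OF unit_inverse])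
  also have "inverse (y ^ fact N * T powi (- l)) * (y ^ fact N * T powi (- k)) = T powi (l - k)"
    using assms(1) T(2) by (simp add: power_int_diff power_int_minus field_simps)
  finally show "l = k" by (simp add: T_powi_unit)
qed (use assms in simp)

lemma ord0_unit:
  assumes y: "y \<in> K" "y \<noteq> 0"
  shows "unit (y ^ fact N * T powi (- ord0 y))"
proof -
  obtain e k where e: "1 \<le> e" "e < N" "unit (y ^ e * T powi k)" using power_unit[OF y] by blast
  then have "e dvd fact N" by (intro dvd_fact) auto
  then obtain m where m: "fact N = e * m" by blast
  have "unit ((y ^ e * T powi k) ^ m)" using e(3) by (rule unit_power)
  also have "(y ^ e * T powi k) ^ m = y ^ fact N * T powi (- (- (k * int m)))"
    by (simp add: power_mult_distrib m power_mult power_int_mult)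
  finally show ?thesis using ord0_eqI[OF y(2)] by metis
qed

lemma ord0_mult:
  assumes "x \<in> K" "y \<in> K" "x \<noteq> 0" "y \<noteq> 0"
  shows "ord0 (x * y) = ord0 x + ord0 y"
proof (rule ord0_eqI)
  have "unit ((x ^ fact N * T powi (- ord0 x)) * (y ^ fact N * T powi (- ord0 y)))"
    using assms by (intro unit_mult ord0_unit)
  also have "(x ^ fact N * T powi (- ord0 x)) * (y ^ fact N * T powi (- ord0 y))
      = (x * y) ^ fact N * T powi (- (ord0 x + ord0 y))"
    using T(2) by (simp add: power_mult_distrib power_int_add power_int_diff power_int_minus field_simps)
  finally show "unit ((x * y) ^ fact N * T powi (- (ord0 x + ord0 y)))" .
qed (use assms in simp)

lemma ord0_T: "ord0 T = fact N"
proof (rule ord0_eqI)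
  have "T ^ fact N * T powi (- fact N) = 1"
    using T(2) by (simp add: power_int_minus flip: power_int_of_nat)
  then show "unit (T ^ fact N * T powi (- fact N))" using R(2) by (simp add: unit_def)
qed (rule T)

lemma ord0_R:
  assumes "y \<in> R" "y \<noteq> 0"
  shows "0 \<le> ord0 y"
proof (rule ccontr)
  assume "\<not> 0 \<le> ord0 y"
  then obtain n where n: "ord0 y = - int (Suc n)"
    by (metis not_le zero_less_imp_eq_int neg_0_less_iff_less minus_minus gr0_conv_Suc)
  define u where "u = y ^ fact N * T ^ Suc n"
  have "T powi (- ord0 y) = T ^ Suc n" unfolding n minus_minus by (rule power_int_of_nat)
  then have u: "unit u" using ord0_unit[of y] assms R(1) by (auto simp: u_def)
  have "inverse T = y ^ fact N * T ^ n * inverse u"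
    using u T(2) by (simp add: u_def unit_def field_simps)
  moreover have "y ^ fact N * T ^ n * inverse u \<in> R"
    using u assms T by (intro R(4) power) (auto simp: unit_def)
  ultimately show False using T(3) by simp
qed

lemma ord0_add:
  assumes "x \<in> K" "y \<in> K" "x \<noteq> 0" "y \<noteq> 0" "x + y \<noteq> 0"
  shows "min (ord0 x) (ord0 y) \<le> ord0 (x + y)"
proof -
  have *: "min (ord0 x) (ord0 y) \<le> ord0 (x + y)"
    if "x \<in> K" "y \<in> K" "x \<noteq> 0" "y \<noteq> 0" "x + y \<noteq> 0" "x / y \<in> R" for x y
  proof -
    have "x + y = y * (1 + x / y)" using that by (simp add: field_simps)
    moreover have "1 + x / y \<noteq> 0" "1 + x / y \<in> K" "1 + x / y \<in> R"
      using that R calculation by (auto intro: add)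
    ultimately have "ord0 (x + y) = ord0 y + ord0 (1 + x / y)" "0 \<le> ord0 (1 + x / y)"
      using that ord0_mult[of y "1 + x / y"] ord0_R by auto
    then show ?thesis by linarith
  qed
  have "x / y \<in> R \<or> y / x \<in> R"
    using valuation_ring[of "x / y"] assms subfield_closed(7)[OF K] by (simp add: inverse_eq_divide)
  then show ?thesis using *[of x y] *[of y x] assms by (auto simp: add.commute min.commute)
qed

text \<open>The values of \<open>ord0\<close> form a subgroup of the integers, nonzero because of T.
  Division by its least positive element d makes the valuation surjective, as the normalisation
  demands.\<close>

lemma ex_place: "\<exists>w. normalized_discrete_valuation K w \<and> 0 < w T"
proof -
  define d where "d = (LEAST n. 0 < n \<and> (\<exists>y\<in>K - {0}. ord0 y = int n))"
  have "0 < (fact N :: nat) \<and> (\<exists>y\<in>K - {0}. ord0 y = int (fact N))" using T_K T(2) ord0_T by auto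
  then have d: "0 < d" "\<exists>y\<in>K - {0}. ord0 y = int d"
    unfolding d_def by (rule LeastI2_wellorder, blast)+
  have least: "d \<le> n" if "0 < n" "y \<in> K - {0}" "ord0 y = int n" for n y
    unfolding d_def using that by (intro Least_le) blast
  obtain g where g: "g \<in> K" "g \<noteq> 0" "ord0 g = int d" using d(2) by blast
  have one: "ord0 1 = 0" using ord0_mult[of 1 1] subfield_closed[OF K] by simp
  have powr: "ord0 (g powi k) = k * int d" for k
  proof -
    have nat: "ord0 (g ^ n) = int n * int d" for n
      using g one by (induction n) (auto simp: ord0_mult subfield_closed[OF K] algebra_simps)
    have inv: "ord0 (inverse y) = - ord0 y" if "y \<in> K" "y \<noteq> 0" for y
      using ord0_mult[of y "inverse y"] that one subfield_closed[OF K] by simp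
    show ?thesis
    proof (cases "k \<ge> 0")
      case True
      then show ?thesis using nat[of "nat k"] by (simp add: power_int_def)
    next
      case False
      then have "g powi k = inverse (g ^ nat (- k))" by (simp add: power_int_def power_inverse)
      then show ?thesis using nat[of "nat (- k)"] inv[of "g ^ nat (- k)"] False g
        by (simp add: subfield_closed[OF K])
    qed
  qed
  have dvd: "int d dvd ord0 y" if y: "y \<in> K" "y \<noteq> 0" for y
  proof -
    define x where "x = y * g powi (- (ord0 y div int d))"
    have x: "x \<in> K" "x \<noteq> 0" using y g by (auto simp: x_def intro!: subfield_closed[OF K])
    have "ord0 x = ord0 y - ord0 y div int d * int d"
      unfolding x_def using y g by (subst ord0_mult) (auto simp: powr subfield_closed[OF K])
    then have m: "ord0 x = ord0 y mod int d" by (simp add: minus_div_mult_eq_mod)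
    have "ord0 x = 0"
    proof (rule ccontr)
      assume "ord0 x \<noteq> 0"
      moreover have "0 \<le> ord0 x" "ord0 x < int d" using d(1) by (auto simp: m)
      ultimately show False using least[of "nat (ord0 x)" x] x by auto
    qed
    then show ?thesis using m by (simp add: dvd_eq_mod_eq_0)
  qed
  define w where "w y = ord0 y div int d" for y
  have w: "ord0 y = w y * int d" if "y \<in> K" "y \<noteq> 0" for y using dvd[OF that] by (simp add: w_def)
  have "normalized_discrete_valuation K w"
    unfolding normalized_discrete_valuation_def
  proof (intro conjI ballI impI)
    fix x y assume xy: "x \<in> K - {0}" "y \<in> K - {0}"
    then have "w (x * y) * int d = (w x + w y) * int d"
      using w[of x] w[of y] w[of "x * y"] ord0_mult[of x y] subfield_closed(5)[OF K, of x y]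
      by (simp add: algebra_simps)
    then show "w (x * y) = w x + w y" using d(1) by simp
    assume s: "x + y \<noteq> 0"
    have "min (w x * int d) (w y * int d) \<le> w (x + y) * int d"
      using ord0_add[of x y] xy s w[of x] w[of y] w[of "x + y"] subfield_closed(3)[OF K, of x y] by simp
    then show "min (w x) (w y) \<le> w (x + y)" using d(1) by (auto simp: min_def split: if_splits)
  next
    have "n \<in> w ` (K - {0})" for n
    proof (rule image_eqI)
      show "g powi n \<in> K - {0}" using g by (auto intro: subfield_closed[OF K])
      then show "n = w (g powi n)" using w[of "g powi n"] powr[of n] d(1) by simp
    qed
    then show "w ` (K - {0}) = UNIV" by blast
  qed
  moreover have "0 < w T"
  proof -
    have "w T * int d = fact N" using w[of T] T_K T(2) ord0_T by simp
    then have "0 < w T * int d" by (metis fact_gt_zero)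
    then show ?thesis by (simp add: zero_less_mult_iff)
  qed
  ultimately show ?thesis by blast
qed

end

text \<open>A subring of $K$ that contains $T$ and is maximal among those not containing $1/T$
  is a discrete valuation ring.\<close>
lemma ex_place_positive:
  fixes K :: "'k::field set"
  assumes gff: "global_function_field K" and S: "subring_of K S" "T \<in> S" "T \<noteq> 0" "inverse T \<notin> S"
  shows "\<exists>w. normalized_discrete_valuation K w \<and> 0 < w T"
proof -
  have K: "subfield K" using gff by (simp add: global_function_field_def)
  define \<A> where "\<A> = {R. subring_of K R \<and> T \<in> R \<and> inverse T \<notin> R}"
  have "\<exists>M\<in>\<A>. \<forall>X\<in>\<A>. M \<subseteq> X \<longrightarrow> X = M"
  proof (rule subset_Zorn_nonempty)
    show "\<A> \<noteq> {}" using S by (auto simp: \<A>_def)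
    fix \<C> assume C: "\<C> \<noteq> {}" "subset.chain \<A> \<C>"
    have sr: "subring_of K R" if "R \<in> \<C>" for R using C(2) that by (auto simp: \<A>_def subset_chain_def)
    have two: "\<exists>R\<in>\<C>. x \<in> R \<and> y \<in> R" if "x \<in> \<Union>\<C>" "y \<in> \<Union>\<C>" for x y
      using C(2) that unfolding subset_chain_def by blast
    have "subring_of K (\<Union>\<C>)"
    proof
      show "1 \<in> \<Union>\<C>" using C(1) sr subring_of.R(2) by blast
      show "\<Union>\<C> \<subseteq> K" using sr subring_of.R(1) by blast
      show "x - y \<in> \<Union>\<C>" if "x \<in> \<Union>\<C>" "y \<in> \<Union>\<C>" for x y
        using two[OF that] sr subring_of.R(3) by blast
      show "x * y \<in> \<Union>\<C>" if "x \<in> \<Union>\<C>" "y \<in> \<Union>\<C>" for x y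
        using two[OF that] sr subring_of.R(4) by blast
    qed (rule K)
    then show "\<Union>\<C> \<in> \<A>" using C by (auto simp: \<A>_def subset_chain_def)
  qed
  then obtain R where R: "R \<in> \<A>" "\<And>X. X \<in> \<A> \<Longrightarrow> R \<subseteq> X \<Longrightarrow> X = R" by blast
  have "T \<in> K" using S subring_of.R(1) by blast
  obtain N where N: "\<forall>r::nat \<Rightarrow> 'k. (\<forall>i<N. r i \<in> K) \<longrightarrow> (\<exists>f. (\<forall>i. poly_over prime_subfield (f i)) \<and>
      (\<exists>i<N. f i \<noteq> 0) \<and> (\<Sum>i<N. poly (f i) T * r i) = 0)"
    using global_function_field_dependence[OF gff \<open>T \<in> K\<close>] by (rule exE)
  have sr: "subring_of K R" "T \<in> R" "inverse T \<notin> R" using R(1) by (auto simp: \<A>_def)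
  have "finite_maximal_subring K R T N"
  proof (intro finite_maximal_subring.intro maximal_subring.intro sr
      maximal_subring_axioms.intro finite_maximal_subring_axioms.intro)
    show "T \<noteq> 0" by (rule S)
    show "X = R" if "subring_of K X" "R \<subseteq> X" "inverse T \<notin> X" for X
      using that sr R(2)[of X] by (auto simp: \<A>_def)
    show "0 < CHAR('k)" using gff by (simp add: global_function_field_def)
    show "\<exists>f. (\<forall>i. poly_over prime_subfield (f i)) \<and> (\<exists>i<N. f i \<noteq> 0) \<and> (\<Sum>i<N. poly (f i) T * r i) = 0"
      if "\<And>i. i < N \<Longrightarrow> r i \<in> K" for r using N that by blast
  qed
  then show ?thesis by (rule finite_maximal_subring.ex_place)
qed

section \<open>The completion and its ring of integers\<close>

locale completion =
  fixes K :: "'k::field set" and v :: "'k \<Rightarrow> int"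
  assumes gff: "global_function_field K" and compl: "is_completion K v"
begin

sublocale discrete_valued_field v
  using compl by unfold_locales (simp add: is_completion_def)

lemma K: "subfield K" and char: "CHAR('k) > 0"
  using gff by (auto simp: global_function_field_def)

sublocale K_place: place K v
  using compl K by unfold_locales (simp_all add: is_completion_def)

lemma dense: "\<exists>y\<in>K. vnorm (y - x) < 2 powi (- n)"
  using compl unfolding is_completion_def mem_vball by blast

lemma ex_K_val: "\<exists>x\<in>K. x \<noteq> 0 \<and> v x = n"
proof -
  have "v ` (K - {0}) = UNIV" using K_place.w unfolding normalized_discrete_valuation_def by simp
  then have "n \<in> v ` (K - {0})" by simp
  then show ?thesis by auto
qed

section \<open>Finiteness of the residue field\<close>

lemma vnorm_prime_subfield: "a \<in> prime_subfield \<Longrightarrow> a \<noteq> 0 \<Longrightarrow> vnorm a = 1"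
proof -
  assume a: "a \<in> prime_subfield" "a \<noteq> 0"
  have le: "vnorm b \<le> 1" if "b \<in> prime_subfield" for b
    using that vnorm_of_int by (auto simp: prime_subfield_def)
  have "vnorm (inverse a) \<le> 1" using a prime_subfield_inverse[OF char] by (intro le) auto
  then have "1 \<le> vnorm a" using a(2) unfolding vnorm_inverse by (simp add: field_simps)
  then show ?thesis using le[OF a(1)] by simp
qed

lemma vnorm_expansion:
  assumes T: "1 < vnorm T" and le: "\<And>i. i < m \<Longrightarrow> vnorm (a i) \<le> 1" and m: "vnorm (a m) = 1"
  shows "vnorm (\<Sum>i\<le>m. T ^ i * a i) = vnorm T ^ m"
proof (cases m)
  case 0
  then show ?thesis using m by simp
next
  case (Suc l)
  have "vnorm (\<Sum>i<m. T ^ i * a i) \<le> vnorm T ^ l"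
  proof (rule vnorm_sum_le)
    fix i assume i: "i \<in> {..<m}"
    then have "vnorm T ^ i \<le> vnorm T ^ l" using T Suc by (intro power_increasing) auto
    then have "vnorm T ^ i * vnorm (a i) \<le> vnorm T ^ l * 1"
      using le[of i] i T by (intro mult_mono) auto
    then show "vnorm (T ^ i * a i) \<le> vnorm T ^ l" by (simp add: vnorm_mult vnorm_power)
  qed simp
  also have "\<dots> < vnorm T ^ m" using T unfolding Suc by (intro power_strict_increasing) auto
  also have "\<dots> = vnorm (T ^ m * a m)" by (simp add: vnorm_mult vnorm_power m)
  finally have "vnorm (T ^ m * a m + (\<Sum>i<m. T ^ i * a i)) = vnorm (T ^ m * a m)"
    by (rule vnorm_add_eq)
  then show ?thesis
    by (simp add: vnorm_mult vnorm_power m add.commute flip: lessThan_Suc_atMost)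
qed

lemma vnorm_poly:
  assumes "1 < vnorm T" "poly_over prime_subfield p" "p \<noteq> 0"
  shows "vnorm (poly p T) = vnorm T ^ degree p"
proof -
  have "coeff p i \<in> prime_subfield" for i using assms(2) by (simp add: poly_over_def)
  then have "vnorm (coeff p i) \<le> 1" "coeff p i \<noteq> 0 \<Longrightarrow> vnorm (coeff p i) = 1" for i
    using vnorm_prime_subfield[of "coeff p i"] by (cases "coeff p i = 0"; auto)+
  then show ?thesis using vnorm_expansion[OF assms(1), of "degree p" "coeff p"] assms(3)
    by (simp add: poly_altdef mult.commute)
qed

text \<open>Linear independence of residue classes over the prime field, without forming the residue
  field: an integral element has nonzero residue exactly when its norm is 1.\<close>

definition residually_independent :: "nat \<Rightarrow> (nat \<Rightarrow> 'k) \<Rightarrow> bool"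
  where "residually_independent n r \<longleftrightarrow> (\<forall>i<n. r i \<in> K \<and> vnorm (r i) \<le> 1) \<and>
    (\<forall>c. (\<forall>i. c i \<in> prime_subfield) \<and> (\<exists>i<n. c i \<noteq> 0) \<longrightarrow> vnorm (\<Sum>i<n. c i * r i) = 1)"

text \<open>Sort a dependence over F_p[T] by powers of T. Its coefficients are integral, and
  residual independence gives the top one norm 1. As T has norm above 1, the top term dominates and
  the sum cannot vanish.\<close>

lemma residually_independent_bound: "\<exists>N. \<forall>r. \<not> residually_independent N r"
proof -
  obtain T where T: "T \<in> K" "T \<noteq> 0" "v T = - 1" using ex_K_val by blast
  then have T1: "1 < vnorm T" by (simp add: vnorm_def)
  obtain N where N: "\<And>r::nat \<Rightarrow> 'k. (\<forall>i<N. r i \<in> K) \<Longrightarrow> \<exists>f. (\<forall>i. poly_over prime_subfield (f i)) \<and>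
      (\<exists>i<N. f i \<noteq> 0) \<and> (\<Sum>i<N. poly (f i) T * r i) = 0"
    using global_function_field_dependence[OF gff T(1)] by auto
  have "\<not> residually_independent N r" for r
  proof
    assume r: "residually_independent N r"
    then obtain f where f: "\<And>i. poly_over prime_subfield (f i)" "\<exists>i<N. f i \<noteq> 0"
      "(\<Sum>i<N. poly (f i) T * r i) = 0" using N[of r] by (auto simp: residually_independent_def)
    define m where "m = Max ((\<lambda>i. degree (f i)) ` {i. i < N \<and> f i \<noteq> 0})"
    have deg: "degree (f i) \<le> m" if "i < N" for i
    proof (cases "f i = 0")
      case False
      then show ?thesis unfolding m_def using that by (intro Max_ge) auto
    qed simp
    have "m \<in> (\<lambda>i. degree (f i)) ` {i. i < N \<and> f i \<noteq> 0}"
      unfolding m_def using f(2) by (intro Max_in) auto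
    then obtain i0 where i0: "i0 < N" "f i0 \<noteq> 0" "degree (f i0) = m" by auto
    have co: "coeff (f i) k \<in> prime_subfield" for i k using f(1)[of i] by (simp add: poly_over_def)
    define a where "a k = (\<Sum>i<N. coeff (f i) k * r i)" for k
    have "vnorm (a k) \<le> 1" for k unfolding a_def
    proof (rule vnorm_sum_le)
      fix i assume "i \<in> {..<N}"
      then have "vnorm (r i) \<le> 1" using r by (auto simp: residually_independent_def)
      moreover have "vnorm (coeff (f i) k) \<le> 1"
        using vnorm_prime_subfield[OF co] by (cases "coeff (f i) k = 0") auto
      ultimately show "vnorm (coeff (f i) k * r i) \<le> 1" by (simp add: vnorm_mult mult_le_one)
    qed simp
    moreover have "vnorm (a m) = 1"
    proof -
      have "\<exists>i<N. coeff (f i) m \<noteq> 0" using i0 leading_coeff_neq_0[of "f i0"] by auto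
      then have "(\<forall>i. coeff (f i) m \<in> prime_subfield) \<and> (\<exists>i<N. coeff (f i) m \<noteq> 0)" using co by simp
      then show ?thesis
        using r unfolding residually_independent_def a_def
        by (elim conjE[of "\<forall>i<N. _ i"]) (drule spec[of _ "\<lambda>i. coeff (f i) m"], simp)
    qed
    ultimately have "vnorm (\<Sum>k\<le>m. T ^ k * a k) = vnorm T ^ m" using vnorm_expansion[OF T1] by blast
    moreover have "(\<Sum>k\<le>m. T ^ k * a k) = (\<Sum>i<N. poly (f i) T * r i)"
    proof -
      have "poly (f i) T = (\<Sum>k\<le>m. coeff (f i) k * T ^ k)" if "i < N" for i
        unfolding poly_altdef using deg[OF that]
        by (intro sum.mono_neutral_left) (auto intro: coeff_eq_0)
      then have "(\<Sum>i<N. poly (f i) T * r i) = (\<Sum>i<N. \<Sum>k\<le>m. T ^ k * (coeff (f i) k * r i))"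
        by (intro sum.cong) (auto simp: sum_distrib_right sum_distrib_left algebra_simps)
      also have "\<dots> = (\<Sum>k\<le>m. \<Sum>i<N. T ^ k * (coeff (f i) k * r i))" by (rule sum.swap)
      finally show ?thesis by (simp add: a_def sum_distrib_left)
    qed
    ultimately show False using f(3) T(2) by simp
  qed
  then show ?thesis by blast
qed

text \<open>The representatives are taken in K and not merely in its completion, because
  \<open>ex_monic_multiple\<close> is later applied to products formed from them.\<close>

lemma finite_residue_K:
  "\<exists>R. finite R \<and> R \<subseteq> K \<and> (\<forall>x. vnorm x \<le> 1 \<longrightarrow> (\<exists>r\<in>R. vnorm (x - r) < 1))"
proof -
  \<comment> \<open>One less than this N is the size of a maximal residually independent family,
    whose combinations over the prime field represent all residues.\<close>
  define N where "N = (LEAST n. \<forall>r. \<not> residually_independent n r)"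
  have N: "\<not> residually_independent N r" for r
    unfolding N_def using residually_independent_bound by (rule LeastI2_ex) blast
  have "residually_independent 0 r" for r by (simp add: residually_independent_def)
  then obtain n where n: "N = Suc n" using N by (cases N) auto
  have "\<not> (\<forall>r. \<not> residually_independent n r)"
    using not_less_Least[of n "\<lambda>n. \<forall>r. \<not> residually_independent n r"] n by (simp add: N_def)
  then obtain r where r: "residually_independent n r" by blast
  define R where "R = (\<lambda>c. \<Sum>i<n. c i * r i) ` ({..<n} \<rightarrow>\<^sub>E prime_subfield)"
  have rK: "r i \<in> K" "vnorm (r i) \<le> 1" if "i < n" for i
    using r that by (auto simp: residually_independent_def)
  have RI: "(\<Sum>i<n. c i * r i) \<in> R" if "\<And>i. c i \<in> prime_subfield" for c
    unfolding R_def using that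
    by (intro image_eqI[of _ _ "restrict c {..<n}"]) auto
  have near: "\<exists>s\<in>R. vnorm (x - s) < 1" if x: "x \<in> K" "vnorm x \<le> 1" for x
  proof -
    define r' where "r' i = (if i < n then r i else x)" for i
    have r': "r' i \<in> K \<and> vnorm (r' i) \<le> 1" if "i < N" for i
      using rK x by (simp add: r'_def)
    with N[of r'] obtain c where c: "\<And>i. c i \<in> prime_subfield" "\<exists>i<N. c i \<noteq> 0"
      "vnorm (\<Sum>i<N. c i * r' i) \<noteq> 1" unfolding residually_independent_def by blast
    have sum: "(\<Sum>i<N. c i * r' i) = (\<Sum>i<n. c i * r i) + c n * x"
      by (simp add: n r'_def)
    have "vnorm (c i * r' i) \<le> 1" if "i < N" for i
      using r'[OF that] vnorm_prime_subfield[OF c(1), of i]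
      by (cases "c i = 0") (auto simp: vnorm_mult)
    then have "vnorm (\<Sum>i<N. c i * r' i) \<le> 1" by (intro vnorm_sum_le) auto
    with c(3) have less: "vnorm (\<Sum>i<N. c i * r' i) < 1" by simp
    have cn: "c n \<noteq> 0"
    proof
      assume 0: "c n = 0"
      then have "\<exists>i<n. c i \<noteq> 0" using c(2) n by (auto simp: less_Suc_eq)
      then have "vnorm (\<Sum>i<n. c i * r i) = 1" using r c(1) unfolding residually_independent_def by blast
      then show False using c(3) sum 0 by simp
    qed
    define s where "s = (\<Sum>i<n. (- c i * inverse (c n)) * r i)"
    have "x - s = inverse (c n) * (\<Sum>i<N. c i * r' i)"
      using cn by (simp add: sum s_def sum_negf sum_distrib_left algebra_simps)
    then have "vnorm (x - s) < 1"
      using less vnorm_prime_subfield[OF c(1) cn] by (simp add: vnorm_mult vnorm_inverse)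
    moreover have "s \<in> R" unfolding s_def using c(1) prime_subfield_inverse[OF char]
      by (intro RI) auto
    ultimately show ?thesis by blast
  qed
  have "\<exists>s\<in>R. vnorm (x - s) < 1" if x: "vnorm x \<le> 1" for x
  proof -
    obtain y where y: "y \<in> K" "vnorm (y - x) < 1" using dense[of x 0] by auto
    then have "vnorm (x + (y - x)) \<le> 1" using x by (intro vnorm_add_le) auto
    then have "vnorm y \<le> 1" by simp
    then obtain s where s: "s \<in> R" "vnorm (y - s) < 1" using near y by blast
    have "vnorm ((y - s) - (y - x)) < 1" using s(2) y(2) by (rule vnorm_diff_less)
    then show ?thesis using s(1) by (intro bexI[of _ s]) auto
  qed
  moreover have "finite R" unfolding R_def
    using finite_prime_subfield[OF char] by (intro finite_imageI finite_PiE) auto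
  moreover have "R \<subseteq> K"
  proof
    fix s assume "s \<in> R"
    then obtain c where c: "s = (\<Sum>i<n. c i * r i)" "\<And>i. i < n \<Longrightarrow> c i \<in> prime_subfield"
      by (auto simp: R_def)
    then show "s \<in> K" using prime_subfield_subset[OF K] rK
      by (auto intro!: subfield_sum[OF K] subfield_closed(5)[OF K])
  qed
  ultimately show ?thesis by blast
qed

sublocale local_field v
proof
  show "\<exists>L. \<forall>n. \<exists>N. \<forall>m\<ge>N. s m \<in> vball v L n"
    if "\<And>n. \<exists>N. \<forall>m\<ge>N. \<forall>k\<ge>N. s m \<in> vball v (s k) n" for s :: "nat \<Rightarrow> 'k"
    using compl that unfolding is_completion_def by blast
  show "\<exists>R. finite R \<and> (\<forall>x. vnorm x \<le> 1 \<longrightarrow> (\<exists>r\<in>R. vnorm (x - r) < 1))"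
    using finite_residue_K by blast
qed

section \<open>Discreteness and cocompactness of the ring of \<nu>-integers\<close>

abbreviation \<O> :: "'k set"
  where "\<O> \<equiv> nu_integers K v"

text \<open>An element of $K$ without poles outside $\nu$ and with a zero at $\nu$ must vanish,
  because a nonzero one would have a pole at an extension of the place $1/x = 0$ of
  $\mathbb{F}_p(x)$.\<close>
lemma \<O>_discrete:
  assumes x: "x \<in> \<O>" "vnorm x < 1"
  shows "x = 0"
proof (rule ccontr)
  assume x0: "x \<noteq> 0"
  have xK: "x \<in> K" using x by (simp add: nu_integers_def)
  define T where "T = inverse x"
  have T: "T \<noteq> 0" "1 < vnorm T" "inverse T = x" "T \<in> K"
    using x x0 xK subfield_closed(6)[OF K] by (auto simp: T_def vnorm_inverse one_less_inverse_iff)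
  \<comment> \<open>This is F_p[T]. Its nonzero elements have norm at least 1, so it omits x = 1/T
    and there is a place w at which T vanishes. Then x has a pole at w but a zero at \<nu>, so w
    differs from \<nu> and x is not integral at w.\<close>
  define S where "S = {poly p T | p. poly_over prime_subfield p}"
  have "subring_of K S"
  proof
    have 1: "poly_over prime_subfield (1 :: 'k poly)" by (simp add: poly_over_def coeff_1)
    show "1 \<in> S" unfolding S_def using 1 by (auto intro: exI[of _ 1])
    show "S \<subseteq> K"
    proof
      fix s assume "s \<in> S"
      then obtain p where "s = poly p T" "poly_over prime_subfield p" by (auto simp: S_def)
      then show "s \<in> K" unfolding poly_altdef poly_over_def using prime_subfield_subset[OF K] T(4)
        by (auto intro!: subfield_sum[OF K] subfield_closed(5,9)[OF K])
    qed
    show "a - b \<in> S" if ab: "a \<in> S" "b \<in> S" for a b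
    proof -
      obtain p q where "a = poly p T" "b = poly q T" "poly_over prime_subfield p" "poly_over prime_subfield q"
        using ab by (auto simp: S_def)
      then show ?thesis unfolding S_def by (auto intro!: exI[of _ "p - q"] simp: poly_over_def)
    qed
    show "a * b \<in> S" if ab: "a \<in> S" "b \<in> S" for a b
    proof -
      obtain p q where "a = poly p T" "b = poly q T" "poly_over prime_subfield p" "poly_over prime_subfield q"
        using ab by (auto simp: S_def)
      then show ?thesis unfolding S_def by (auto intro!: exI[of _ "p * q"] poly_over_mult)
    qed
  qed (rule K)
  moreover have "T \<in> S"
    unfolding S_def by (rule CollectI, rule exI[of _ "[:0, 1:]"])
      (auto simp: poly_over_def coeff_pCons split: nat.split)
  moreover have "inverse T \<notin> S"
  proof
    assume "inverse T \<in> S"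
    then obtain p where p: "x = poly p T" "poly_over prime_subfield p" using T(3) by (auto simp: S_def)
    then have "p \<noteq> 0" using x0 by auto
    then have "vnorm x = vnorm T ^ degree p" using p vnorm_poly[OF T(2)] by simp
    moreover have "1 \<le> vnorm T ^ degree p" using T(2) by (intro one_le_power) auto
    ultimately show False using x(2) by simp
  qed
  ultimately obtain w where w: "normalized_discrete_valuation K w" "0 < w T"
    using ex_place_positive[OF gff _ _ T(1)] by blast
  interpret w: place K w using w(1) K by (simp add: place_def)
  have "w x = - w T" using w.mult[of x T] xK T x0 w.one by (simp add: T_def)
  moreover have "v x > 0" using x x0 by (simp add: vnorm_less_1)
  ultimately have "w x < 0" "w x \<noteq> v x" using w(2) by auto
  then have "x = 0 \<or> w x \<ge> 0" using x(1) w(1) xK x0 unfolding nu_integers_def by blast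
  then show False using x0 \<open>w x < 0\<close> by simp
qed

text \<open>Multiplying an algebraic equation of b over F_p[T] by a power of its leading coefficient
  h turns it into an integral equation for h b. A monic p is wanted because p(T) then differs from
  T^m, m its degree, by an element of smaller norm.\<close>

lemma ex_monic_multiple:
  assumes T: "T \<in> \<O>" "1 < vnorm T" and b: "b \<in> K"
  shows "\<exists>p. poly_over prime_subfield p \<and> lead_coeff p = 1 \<and> poly p T * b \<in> \<O>"
proof -
  have TK: "T \<in> K" using T by (simp add: nu_integers_def)
  obtain N where "\<And>r::nat \<Rightarrow> 'k. (\<forall>i<N. r i \<in> K) \<Longrightarrow> \<exists>f. (\<forall>i. poly_over prime_subfield (f i)) \<and>
      (\<exists>i<N. f i \<noteq> 0) \<and> (\<Sum>i<N. poly (f i) T * r i) = 0"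
    using global_function_field_dependence[OF gff TK] by auto
  from this[of "\<lambda>i. b ^ i"] obtain f where f: "\<And>i. poly_over prime_subfield (f i)" "\<exists>i<N. f i \<noteq> 0"
    "(\<Sum>i<N. poly (f i) T * b ^ i) = 0" using subfield_closed(9)[OF K b] by auto
  define S where "S = {i. i < N \<and> f i \<noteq> 0}"
  define m where "m = Max S"
  have S: "finite S" "S \<noteq> {}" using f(2) by (auto simp: S_def)
  have m: "m < N" "f m \<noteq> 0" using Max_in[OF S] by (auto simp: m_def S_def)
  have above: "f i = 0" if "i < N" "m < i" for i
  proof (rule ccontr)
    assume "f i \<noteq> 0"
    then have "i \<in> S" using that by (simp add: S_def)
    then show False using Max_ge[OF S(1), of i] that by (simp add: m_def)
  qed
  define h where "h = poly (f m) T"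
  have hnz: "h \<noteq> 0"
  proof -
    have "vnorm h > 0" using vnorm_poly[OF T(2) f(1) m(2)] T(2) unfolding h_def by (simp only:) (rule zero_less_power, linarith)
    then show ?thesis by auto
  qed
  have "(\<Sum>i<N. poly (f i) T * b ^ i) = (\<Sum>i\<le>m. poly (f i) T * b ^ i)"
    using m above by (intro sum.mono_neutral_right) auto
  then have rel: "h * b ^ m = - (\<Sum>i<m. poly (f i) T * b ^ i)"
    using f(3) by (simp add: h_def eq_neg_iff_add_eq_0 add.commute flip: lessThan_Suc_atMost)
  have "m > 0" using rel hnz by (cases m) auto
  have hb: "h * b \<in> \<O>"
  proof (rule nu_integers_integral[OF K _ \<open>m > 0\<close>])
    show "h * b \<in> K"
      using nu_integers_poly[OF K f(1) T(1)] b by (auto simp: h_def nu_integers_def intro!: subfield_closed(5)[OF K])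
    show "- (poly (f i) T * h ^ (m - 1 - i)) \<in> \<O>" for i
      unfolding h_def by (intro nu_integers_closed[OF K] nu_integers_poly[OF K] f(1) T(1))
    have "(h * b) ^ m = h ^ (m - 1) * (h * b ^ m)"
      using \<open>m > 0\<close> by (cases m) (auto simp: power_mult_distrib algebra_simps)
    also have "\<dots> = (\<Sum>i<m. - (poly (f i) T * (h ^ (m - 1) * b ^ i)))"
      by (simp add: rel sum_negf sum_distrib_left algebra_simps)
    also have "\<dots> = (\<Sum>i<m. - (poly (f i) T * h ^ (m - 1 - i)) * (h * b) ^ i)"
    proof (rule sum.cong)
      fix i assume "i \<in> {..<m}"
      then have "h ^ (m - 1) = h ^ (m - 1 - i) * h ^ i" by (simp flip: power_add)
      then show "- (poly (f i) T * (h ^ (m - 1) * b ^ i)) = - (poly (f i) T * h ^ (m - 1 - i)) * (h * b) ^ i"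
        by (simp add: power_mult_distrib)
    qed simp
    finally show "(h * b) ^ m = (\<Sum>i<m. - (poly (f i) T * h ^ (m - 1 - i)) * (h * b) ^ i)" .
  qed
  define c where "c = inverse (lead_coeff (f m))"
  have lc: "lead_coeff (f m) \<noteq> 0" "lead_coeff (f m) \<in> prime_subfield"
    using m f(1) by (auto simp: poly_over_def)
  then have c: "c \<in> prime_subfield" using prime_subfield_inverse[OF char] by (auto simp: c_def)
  have "poly_over prime_subfield (smult c (f m))" using c f(1) by (auto simp: poly_over_def)
  moreover have "lead_coeff (smult c (f m)) = 1" using lc by (simp add: c_def)
  moreover have "poly (smult c (f m)) T * b \<in> \<O>"
    using nu_integers_closed(6)[OF K _ hb] c prime_subfield_nu_integers[OF K]
    by (auto simp: h_def mult.assoc)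
  ultimately show ?thesis by blast
qed

text \<open>With e the pole order of T, write x as g^i T^n u, where i < e and u has norm 1.
  Replacing u by a residue representative gives b T^n with b in the finite set B. If p is monic of
  degree m with p(T) b in \<O>, then T^(n - m) p(T) b lies in \<O> and is close to b T^n. This needs
  n \<ge> m, which the bound 2^(e M) on x ensures.\<close>

lemma \<O>_approx_step:
  assumes T: "T \<in> \<O>" "1 < vnorm T"
  shows "\<exists>C. \<forall>x. C \<le> vnorm x \<longrightarrow> x \<noteq> 0 \<longrightarrow> (\<exists>y\<in>\<O>. vnorm (x - y) < vnorm x)"
proof -
  obtain R where R: "finite R" "R \<subseteq> K" "\<And>x. vnorm x \<le> 1 \<Longrightarrow> \<exists>r\<in>R. vnorm (x - r) < 1"
    using finite_residue_K by blast
  obtain g where g: "g \<in> K" "g \<noteq> 0" "v g = 1" using ex_K_val by blast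
  have T0: "T \<noteq> 0" using T(2) by auto
  define e where "e = nat (- v T)"
  have e: "e > 0" "v T = - int e" using T(2) T0 vnorm_le_1[of T] by (auto simp: e_def not_le)
  have vT: "vnorm T = 2 ^ e" using T0 e by (simp add: vnorm_def)
  have vg: "vnorm g = 1 / 2" using g by (simp add: vnorm_def power_int_minus)
  define B where "B = (\<lambda>(i, r). g ^ i * r) ` ({..<e} \<times> R)"
  have B: "finite B" "B \<subseteq> K" using R g by (auto simp: B_def intro!: subfield_closed(5,9)[OF K])
  have "\<forall>b\<in>B. \<exists>p. poly_over prime_subfield p \<and> lead_coeff p = 1 \<and> poly p T * b \<in> \<O>"
    using ex_monic_multiple[OF T] B(2) by blast
  then obtain p where p: "\<And>b. b \<in> B \<Longrightarrow> poly_over prime_subfield (p b)"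
    "\<And>b. b \<in> B \<Longrightarrow> lead_coeff (p b) = 1" "\<And>b. b \<in> B \<Longrightarrow> poly (p b) T * b \<in> \<O>" by metis
  define M where "M = Max (insert 0 ((\<lambda>b. degree (p b)) ` B))"
  have M: "degree (p b) \<le> M" if "b \<in> B" for b unfolding M_def using B(1) that by (intro Max_ge) auto
  have "\<exists>y\<in>\<O>. vnorm (x - y) < vnorm x" if x: "2 ^ (e * M) \<le> vnorm x" "x \<noteq> 0" for x
  proof -
    define k where "k = - (v x div int e)"
    define i where "i = nat (v x mod int e)"
    have i: "i < e" "v x = int i - int e * k"
      using e(1) by (auto simp: i_def k_def nat_less_iff algebra_simps)
    have "- v x \<ge> int (e * M)"
      using x by (simp add: vnorm_def powi_le flip: power_int_of_nat)
    moreover have "int (e * M) = int e * int M" by simp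
    ultimately have "int e * int M \<le> int e * k" using i(2) by linarith
    then have k: "int M \<le> k" using e(1) by simp
    define n where "n = nat k"
    have n: "k = int n" "M \<le> n" using k by (auto simp: n_def)
    define u where "u = x / (g ^ i * T ^ n)"
    have vx: "vnorm x = (1 / 2) ^ i * (2 ^ e) ^ n"
      using x(2) i(2) n(1) by (simp add: vnorm_def power_int_diff power_mult power_int_mult power_one_over
          divide_simps flip: power_int_of_nat)
    then have "vnorm u = 1" by (simp add: u_def vnorm_divide vnorm_mult vnorm_power vg vT)
    then obtain r where r: "r \<in> R" "vnorm (u - r) < 1" using R(3)[of u] by auto
    have vr: "vnorm r = 1" using vnorm_eqI[of r u] r(2) \<open>vnorm u = 1\<close> by (simp add: vnorm_diff_commute)
    define b where "b = g ^ i * r"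
    have b: "b \<in> B" using i r by (auto simp: B_def b_def)
    have "x - b * T ^ n = g ^ i * T ^ n * (u - r)"
      using g(2) T0 by (simp add: u_def b_def field_simps)
    then have 1: "vnorm (x - b * T ^ n) < vnorm x"
      using r(2) by (simp add: vnorm_mult vnorm_power vg vT vx)
    define m where "m = degree (p b)"
    have mn: "m \<le> n" using M[OF b] n by (simp add: m_def)
    define y where "y = T ^ (n - m) * (poly (p b) T * b)"
    have y: "y \<in> \<O>" unfolding y_def by (intro nu_integers_closed[OF K] T(1) p(3) b)
    have "T ^ m - poly (p b) T = - (\<Sum>i<m. coeff (p b) i * T ^ i)"
      using p(2)[OF b] by (simp add: poly_altdef m_def flip: lessThan_Suc_atMost)
    moreover have "vnorm (\<Sum>i<m. coeff (p b) i * T ^ i) < vnorm T ^ m"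
    proof (cases m)
      case (Suc l)
      have "vnorm (\<Sum>i<m. coeff (p b) i * T ^ i) \<le> vnorm T ^ l"
      proof (rule vnorm_sum_le)
        fix i assume i: "i \<in> {..<m}"
        have "coeff (p b) i \<in> prime_subfield" using p(1)[OF b] by (simp add: poly_over_def)
        then have "vnorm (coeff (p b) i) \<le> 1"
          using vnorm_prime_subfield by (cases "coeff (p b) i = 0") auto
        moreover have "vnorm T ^ i \<le> vnorm T ^ l" using T(2) i Suc by (intro power_increasing) auto
        ultimately have "vnorm (coeff (p b) i) * vnorm T ^ i \<le> 1 * vnorm T ^ l"
          by (intro mult_mono) auto
        then show "vnorm (coeff (p b) i * T ^ i) \<le> vnorm T ^ l" by (simp add: vnorm_mult vnorm_power)
      qed simp
      also have "\<dots> < vnorm T ^ m" using T(2) unfolding Suc by (intro power_strict_increasing) auto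
      finally show ?thesis .
    qed simp
    ultimately have "vnorm (T ^ m - poly (p b) T) < vnorm T ^ m" by simp
    moreover have "b * T ^ n - y = T ^ (n - m) * b * (T ^ m - poly (p b) T)"
    proof -
      have "T ^ n = T ^ (n - m) * T ^ m" using mn by (simp flip: power_add)
      then show ?thesis by (simp add: y_def algebra_simps)
    qed
    moreover have "vnorm (T ^ (n - m) * b) * vnorm T ^ m = vnorm x"
    proof -
      have "vnorm T ^ n = vnorm T ^ (n - m) * vnorm T ^ m" using mn by (simp flip: power_add)
      then show ?thesis by (simp add: vnorm_mult vnorm_power b_def vr vx vg vT[symmetric])
    qed
    moreover have "vnorm (T ^ (n - m) * b) > 0"
      using T0 g(2) vr by (auto simp: b_def)
    ultimately have 2: "vnorm (b * T ^ n - y) < vnorm x"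
      by (metis vnorm_mult mult_strict_left_mono)
    have "vnorm ((x - b * T ^ n) + (b * T ^ n - y)) < vnorm x" using 1 2 by (rule vnorm_add_less)
    then show ?thesis using y by (intro bexI[of _ y]) auto
  qed
  then show ?thesis by blast
qed

text \<open>Each application of \<open>\<O>_approx_step\<close> lowers the norm, hence at least
  halves it, until it is at most D.\<close>

lemma \<O>_cocompact:
  assumes "T \<in> \<O>" "1 < vnorm T"
  shows "\<exists>C. \<forall>x. \<exists>y\<in>\<O>. vnorm (x - y) \<le> C"
proof -
  obtain C where C: "\<And>x. C \<le> vnorm x \<Longrightarrow> x \<noteq> 0 \<Longrightarrow> \<exists>y\<in>\<O>. vnorm (x - y) < vnorm x"
    using \<O>_approx_step[OF assms] by blast
  define D where "D = max C 1"
  have D: "D \<ge> 1" "D \<ge> C" by (auto simp: D_def)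
  have "\<forall>x. vnorm x \<le> D * 2 ^ n \<longrightarrow> (\<exists>y\<in>\<O>. vnorm (x - y) \<le> D)" for n
  proof (induction n)
    case 0
    show ?case using nu_integers_closed(1)[OF K] by (auto intro!: bexI[of _ 0])
  next
    case (Suc n)
    show ?case
    proof (intro allI impI)
      fix x assume x: "vnorm x \<le> D * 2 ^ Suc n"
      show "\<exists>y\<in>\<O>. vnorm (x - y) \<le> D"
      proof (cases "vnorm x \<le> D")
        case True
        then show ?thesis using nu_integers_closed(1)[OF K] by (auto intro!: bexI[of _ 0])
      next
        case False
        then have x0: "x \<noteq> 0" using D by auto
        then obtain y where y: "y \<in> \<O>" "vnorm (x - y) < vnorm x" using C[of x] False D by auto
        then have "vnorm ((x - y) / x) < 1" using x0 by (simp add: vnorm_divide)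
        then have "vnorm ((x - y) / x) \<le> 1 / 2" by (rule vnorm_less_1_half)
        then have "vnorm (x - y) \<le> vnorm x / 2" using x0 by (simp add: vnorm_divide field_simps)
        then have "vnorm (x - y) \<le> D * 2 ^ n" using x by simp
        then obtain z where z: "z \<in> \<O>" "vnorm (x - y - z) \<le> D" using Suc by blast
        then show ?thesis using nu_integers_closed(3)[OF K y(1) z(1)]
          by (intro bexI[of _ "y + z"]) (auto simp: diff_diff_eq)
      qed
    qed
  qed
  moreover have "\<exists>n. vnorm x \<le> D * 2 ^ n" for x
  proof -
    obtain n where "vnorm x < 2 ^ n" using real_arch_pow[of 2 "vnorm x"] by auto
    moreover have "2 ^ n \<le> D * 2 ^ n" using D by simp
    ultimately show ?thesis by (intro exI[of _ n]) linarith
  qed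
  ultimately show ?thesis by blast
qed

end

section \<open>The homogeneous space in terms of sequences\<close>

definition adj3 :: "'k::comm_ring_1^3^3 \<Rightarrow> 'k^3^3"
  where "adj3 A = vector [
    vector [A$2$2 * A$3$3 - A$2$3 * A$3$2, A$1$3 * A$3$2 - A$1$2 * A$3$3, A$1$2 * A$2$3 - A$1$3 * A$2$2],
    vector [A$2$3 * A$3$1 - A$2$1 * A$3$3, A$1$1 * A$3$3 - A$1$3 * A$3$1, A$1$3 * A$2$1 - A$1$1 * A$2$3],
    vector [A$2$1 * A$3$2 - A$2$2 * A$3$1, A$1$2 * A$3$1 - A$1$1 * A$3$2, A$1$1 * A$2$2 - A$1$2 * A$2$1]]"

text \<open>Through the explicit adjugate, inversion is polynomial in the entries up to the
  determinant. So it is continuous, and for determinant 1 it preserves integrality.\<close>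

definition inv3 :: "'k::field^3^3 \<Rightarrow> 'k^3^3"
  where "inv3 A = (\<chi> i j. adj3 A $ i $ j / det A)"

lemma mult3: "(A ** B) $ i $ j = A$i$1 * B$1$j + A$i$2 * B$2$j + A$i$3 * (B :: 'k::semiring_1^3^3)$3$j"
  by (simp add: matrix_matrix_mult_def sum_3)

lemma vmult3: "(A *v w) $ i = A$i$1 * w$1 + A$i$2 * w$2 + (A :: 'k::semiring_1^3^3)$i$3 * w$3"
  by (simp add: matrix_vector_mult_def sum_3)

lemma mat_one_3: "(mat 1 :: 'k::{zero,one}^3^3) $ i $ j = (if i = j then 1 else 0)"
  by (simp add: mat_def)

lemma mat3_eqI:
  "A$1$1 = B$1$1 \<Longrightarrow> A$1$2 = B$1$2 \<Longrightarrow> A$1$3 = B$1$3 \<Longrightarrow> A$2$1 = B$2$1 \<Longrightarrow> A$2$2 = B$2$2 \<Longrightarrow> A$2$3 = B$2$3 \<Longrightarrow>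
   A$3$1 = B$3$1 \<Longrightarrow> A$3$2 = B$3$2 \<Longrightarrow> A$3$3 = B$3$3 \<Longrightarrow> A = (B :: 'k^3^3)"
  by (simp add: vec_eq_iff forall_3)

lemma adj3_mult: "A ** adj3 A = mat (det A)" "adj3 A ** A = mat (det A)"
  by (rule mat3_eqI; simp add: mult3 adj3_def det_3 mat_def algebra_simps)+

lemma inv3:
  fixes A :: "'k::field^3^3"
  assumes "det A \<noteq> 0"
  shows "A ** inv3 A = mat 1" "inv3 A ** A = mat 1"
proof -
  have "(A ** inv3 A) $ i $ j = (A ** adj3 A) $ i $ j / det A"
    "(inv3 A ** A) $ i $ j = (adj3 A ** A) $ i $ j / det A" for i j
    by (simp_all add: mult3 inv3_def add_divide_distrib)
  then show "A ** inv3 A = mat 1" "inv3 A ** A = mat 1"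
    using assms by (auto simp: adj3_mult vec_eq_iff mat_def)
qed

lemma inv3_cancel:
  fixes A B :: "'k::field^3^3"
  assumes "det A \<noteq> 0"
  shows "A ** (inv3 A ** B) = B" "inv3 A ** (A ** B) = B" "(B ** A) ** inv3 A = B" "(B ** inv3 A) ** A = B"
  using inv3[OF assms] by (simp_all add: matrix_mul_assoc) (simp_all flip: matrix_mul_assoc)

lemma det_inv3: "det (A :: 'k::field^3^3) \<noteq> 0 \<Longrightarrow> det (inv3 A) = inverse (det A)"
  using inv3(1)[of A] by (metis det_I det_mul inverse_unique)

lemma inv3_unique: "det A \<noteq> 0 \<Longrightarrow> A ** B = mat 1 \<Longrightarrow> inv3 A = (B :: 'k::field^3^3)"
  using inv3_cancel(2)[of A B] by simp

lemma inv3_mult: "det A \<noteq> 0 \<Longrightarrow> det B \<noteq> 0 \<Longrightarrow> inv3 (A ** B) = inv3 B ** inv3 (A :: 'k::field^3^3)"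
  by (rule inv3_unique) (simp_all add: det_mul inv3 inv3_cancel flip: matrix_mul_assoc)

lemma inv3_inv3: "det A \<noteq> 0 \<Longrightarrow> inv3 (inv3 A) = (A :: 'k::field^3^3)"
  by (rule inv3_unique) (simp_all add: det_inv3 inv3)

lemma inv3_det1: "det A = 1 \<Longrightarrow> inv3 A = adj3 (A :: 'k::field^3^3)"
  by (simp add: inv3_def vec_eq_iff)

context discrete_valued_field
begin

section \<open>Convergence of matrices and the topology of G\<close>

definition mconv :: "(nat \<Rightarrow> 'k^3^3) \<Rightarrow> 'k^3^3 \<Rightarrow> bool"
  where "mconv s L \<longleftrightarrow> (\<forall>i j. vconv (\<lambda>n. s n $ i $ j) (L $ i $ j))"

lemma mconvD: "mconv s L \<Longrightarrow> vconv (\<lambda>n. s n $ i $ j) (L $ i $ j)"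
  by (simp add: mconv_def)

lemma mconv_const [simp]: "mconv (\<lambda>n. A) A"
  by (simp add: mconv_def)

lemma mconv_mult: "mconv s A \<Longrightarrow> mconv t B \<Longrightarrow> mconv (\<lambda>n. s n ** t n) (A ** B)"
  unfolding mconv_def mult3 by (intro allI vconv_add vconv_mult) auto

lemma mconv_transpose: "mconv s A \<Longrightarrow> mconv (\<lambda>n. transpose (s n)) (transpose A)"
  by (simp add: mconv_def transpose_def)

lemma mconv_subseq: "mconv s A \<Longrightarrow> strict_mono r \<Longrightarrow> mconv (\<lambda>n. s (r n)) A"
  unfolding mconv_def by (auto intro: vconv_subseq[of "\<lambda>n. s n $ _ $ _"])

lemma mconv_Suc: "mconv s A \<Longrightarrow> mconv (\<lambda>n. s (Suc n)) A"
  using mconv_subseq[of s A Suc] by (simp add: strict_mono_Suc_iff)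

lemma mconv_det: "mconv s A \<Longrightarrow> vconv (\<lambda>n. det (s n)) (det A)"
  unfolding mconv_def det_3 by (intro vconv_diff vconv_add vconv_mult) auto

lemma mconv_adj3: "mconv s A \<Longrightarrow> mconv (\<lambda>n. adj3 (s n)) (adj3 A)"
  unfolding mconv_def adj3_def forall_3 vector_3
  by (intro conjI vconv_diff vconv_mult) auto

lemma mconv_inv3:
  assumes "mconv s A" "det A \<noteq> 0"
  shows "mconv (\<lambda>n. inv3 (s n)) (inv3 A)"
  using mconv_adj3[OF assms(1)] mconv_det[OF assms(1)] assms(2)
  unfolding mconv_def inv3_def by (auto intro: vconv_divide)

lemma mconv_vec: "mconv s A \<Longrightarrow> vconv (\<lambda>n. (s n *v w) $ i) ((A *v w) $ i)"
  unfolding mconv_def vmult3 by (intro vconv_add vconv_mult) auto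

lemma mconv_det_eq: "mconv s A \<Longrightarrow> (\<And>n. det (s n) = d) \<Longrightarrow> det A = d"
  using mconv_det[of s A] vconv_unique[of "\<lambda>n. d" "det A" d] by simp

definition near :: "int \<Rightarrow> 'k^3^3 \<Rightarrow> 'k^3^3 \<Rightarrow> bool"
  where "near n A B \<longleftrightarrow> (\<forall>i j. B $ i $ j \<in> vball v (A $ i $ j) n)"

lemma near_refl [simp]: "near n A A"
  by (simp add: near_def mem_vball)

lemma near_trans: "near n A B \<Longrightarrow> near n B C \<Longrightarrow> near n A C"
  unfolding near_def mem_vball
proof (intro allI)
  fix i j
  assume "\<forall>i j. vnorm (B $ i $ j - A $ i $ j) < 2 powi - n" "\<forall>i j. vnorm (C $ i $ j - B $ i $ j) < 2 powi - n"
  then have "vnorm ((B $ i $ j - A $ i $ j) + (C $ i $ j - B $ i $ j)) < 2 powi - n"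
    by (intro vnorm_add_less) auto
  then show "vnorm (C $ i $ j - A $ i $ j) < 2 powi - n" by simp
qed

lemma near_mono: "near n A B \<Longrightarrow> m \<le> n \<Longrightarrow> near m A B"
  unfolding near_def mem_vball by (meson neg_le_iff_le order_less_le_trans powi_le)

lemma mconv_near: "mconv s A \<Longrightarrow> \<forall>\<^sub>F k in sequentially. near n A (s k)"
proof -
  assume "mconv s A"
  then have "\<forall>\<^sub>F k in sequentially. vnorm (s k $ i $ j - A $ i $ j) < 2 powi (- n)" for i j
    unfolding mconv_def vconv_iff by simp
  then have "\<forall>\<^sub>F k in sequentially. \<forall>i\<in>UNIV. \<forall>j\<in>UNIV. vnorm (s k $ i $ j - A $ i $ j) < 2 powi (- n)"
    by (intro eventually_ball_finite ballI) auto
  then show ?thesis by (simp add: near_def mem_vball)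
qed

lemma near_mconv:
  assumes "\<And>k::nat. near (int k) A (s k)"
  shows "mconv s A"
  unfolding mconv_def
proof (intro allI vconv_powi exI impI)
  fix i j :: 3 and n :: int and m :: nat
  assume m: "nat n \<le> m"
  have "near n A (s m)" using assms[of m] by (rule near_mono) (use m in linarith)
  then show "s m $ i $ j \<in> vball v (A $ i $ j) n" by (simp add: near_def)
qed

lemma openin_G_topology:
  "openin (G_topology v) S \<longleftrightarrow> S \<subseteq> SL3 UNIV \<and> (\<forall>A\<in>S. \<exists>n. \<forall>B\<in>SL3 UNIV. near n A B \<longrightarrow> B \<in> S)"
proof -
  define op where "op U \<longleftrightarrow> (\<forall>A\<in>U. \<exists>n. {B. \<forall>i j. B $ i $ j \<in> vball v (A $ i $ j) n} \<subseteq> U)" for U :: "('k^3^3) set"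
  have op: "op U \<longleftrightarrow> (\<forall>A\<in>U. \<exists>n. \<forall>B. near n A B \<longrightarrow> B \<in> U)" for U
    by (simp add: op_def near_def subset_eq)
  have istop: "istopology op"
    unfolding istopology_def
  proof (intro conjI allI impI)
    fix S T assume ST: "op S" "op T"
    show "op (S \<inter> T)"
      unfolding op
    proof
      fix A assume A: "A \<in> S \<inter> T"
      obtain m where "\<forall>B. near m A B \<longrightarrow> B \<in> S" using ST(1) A unfolding op by auto
      moreover obtain n where "\<forall>B. near n A B \<longrightarrow> B \<in> T" using ST(2) A unfolding op by auto
      ultimately show "\<exists>n. \<forall>B. near n A B \<longrightarrow> B \<in> S \<inter> T"
        by (intro exI[of _ "max m n"]) (meson IntI max.cobounded1 max.cobounded2 near_mono)
    qed
  next
    fix \<K> assume \<K>: "\<forall>S\<in>\<K>. op S"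
    show "op (\<Union>\<K>)"
      unfolding op
    proof
      fix A assume "A \<in> \<Union>\<K>"
      then obtain S where S: "S \<in> \<K>" "A \<in> S" by blast
      then have "op S" using \<K> by simp
      then obtain n where "\<forall>B. near n A B \<longrightarrow> B \<in> S" using S(2) unfolding op by auto
      then show "\<exists>n. \<forall>B. near n A B \<longrightarrow> B \<in> \<Union>\<K>" using S(1) by blast
    qed
  qed
  have "G_topology v = subtopology (topology op) (SL3 UNIV)"
    unfolding G_topology_def op_def[abs_def] by (rule refl)
  then have eq: "openin (G_topology v) S \<longleftrightarrow> (\<exists>T. op T \<and> S = T \<inter> SL3 UNIV)"
    by (simp add: openin_subtopology topology_inverse'[OF istop])
  show ?thesis
  proof
    assume "openin (G_topology v) S"
    then obtain T where T: "op T" "S = T \<inter> SL3 UNIV" using eq by blast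
    show "S \<subseteq> SL3 UNIV \<and> (\<forall>A\<in>S. \<exists>n. \<forall>B\<in>SL3 UNIV. near n A B \<longrightarrow> B \<in> S)"
    proof (intro conjI ballI)
      fix A assume "A \<in> S"
      then obtain n where "\<forall>B. near n A B \<longrightarrow> B \<in> T" using T unfolding op by auto
      then show "\<exists>n. \<forall>B\<in>SL3 UNIV. near n A B \<longrightarrow> B \<in> S" using T(2) by blast
    qed (use T in blast)
  next
    assume S: "S \<subseteq> SL3 UNIV \<and> (\<forall>A\<in>S. \<exists>n. \<forall>B\<in>SL3 UNIV. near n A B \<longrightarrow> B \<in> S)"
    \<comment> \<open>The union of all ambient balls around points of S whose trace on
      \<open>SL3 UNIV\<close> lies in S. It is open because every point of an ultrametric ball is a
      centre of it.\<close>
    define T where "T = {C. \<exists>A\<in>S. \<exists>n. near n A C \<and> (\<forall>B\<in>SL3 UNIV. near n A B \<longrightarrow> B \<in> S)}"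
    have "op T"
      unfolding op
    proof
      fix C assume "C \<in> T"
      then obtain A n where A: "A \<in> S" "near n A C" "\<forall>B\<in>SL3 UNIV. near n A B \<longrightarrow> B \<in> S"
        by (auto simp: T_def)
      then have "\<forall>B. near n C B \<longrightarrow> B \<in> T" unfolding T_def using near_trans by blast
      then show "\<exists>n. \<forall>B. near n C B \<longrightarrow> B \<in> T" by blast
    qed
    moreover have "S = T \<inter> SL3 UNIV"
    proof (intro equalityI subsetI)
      fix A assume A: "A \<in> S"
      then obtain n where "\<forall>B\<in>SL3 UNIV. near n A B \<longrightarrow> B \<in> S" using S by blast
      then show "A \<in> T \<inter> SL3 UNIV" using A S unfolding T_def by (auto intro: near_refl)
    next
      fix A assume "A \<in> T \<inter> SL3 UNIV"
      then show "A \<in> S" by (auto simp: T_def)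
    qed
    ultimately show "openin (G_topology v) S" using eq by blast
  qed
qed

lemma openin_G_topology_seq:
  assumes "S \<subseteq> SL3 UNIV"
  shows "openin (G_topology v) S \<longleftrightarrow> (\<forall>A\<in>S. \<forall>s. (\<forall>k. s k \<in> SL3 UNIV) \<and> mconv s A \<longrightarrow>
    (\<forall>\<^sub>F k in sequentially. s k \<in> S))"
proof
  assume op: "openin (G_topology v) S"
  show "\<forall>A\<in>S. \<forall>s. (\<forall>k. s k \<in> SL3 UNIV) \<and> mconv s A \<longrightarrow> (\<forall>\<^sub>F k in sequentially. s k \<in> S)"
  proof (intro ballI allI impI)
    fix A s assume A: "A \<in> S" and s: "(\<forall>k. s k \<in> SL3 UNIV) \<and> mconv s A"
    obtain n where n: "\<forall>B\<in>SL3 UNIV. near n A B \<longrightarrow> B \<in> S"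
      using op A unfolding openin_G_topology by blast
    have "\<forall>\<^sub>F k in sequentially. near n A (s k)" using s by (intro mconv_near) simp
    then show "\<forall>\<^sub>F k in sequentially. s k \<in> S" by (rule eventually_mono) (use s n in blast)
  qed
next
  assume seq: "\<forall>A\<in>S. \<forall>s. (\<forall>k. s k \<in> SL3 UNIV) \<and> mconv s A \<longrightarrow> (\<forall>\<^sub>F k in sequentially. s k \<in> S)"
  have "\<exists>n. \<forall>B\<in>SL3 UNIV. near n A B \<longrightarrow> B \<in> S" if A: "A \<in> S" for A
  proof (rule ccontr)
    assume "\<not> ?thesis"
    then have "\<forall>k. \<exists>B. B \<in> SL3 UNIV \<and> near (int k) A B \<and> B \<notin> S" by blast
    then obtain s where s: "\<And>k. s k \<in> SL3 UNIV" "\<And>k. near (int k) A (s k)" "\<And>k. s k \<notin> S" by metis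
    then have "mconv s A" by (intro near_mconv)
    then have "\<forall>\<^sub>F k in sequentially. s k \<in> S" using seq A s by blast
    then show False using s(3) by simp
  qed
  then show "openin (G_topology v) S" unfolding openin_G_topology using assms by blast
qed

end

lemma SL3_mult: "A \<in> SL3 UNIV \<Longrightarrow> B \<in> SL3 UNIV \<Longrightarrow> A ** B \<in> SL3 (UNIV :: 'k::field set)"
  by (simp add: SL3_def det_mul)

lemma SL3_det: "A \<in> SL3 R \<Longrightarrow> det A = 1"
  by (simp add: SL3_def)

context completion
begin

section \<open>Cosets of \<Gamma> and the quotient topology\<close>

abbreviation \<Gamma> :: "('k^3^3) set"
  where "\<Gamma> \<equiv> SL3 \<O>"

abbreviation G :: "('k^3^3) set"
  where "G \<equiv> SL3 UNIV"

lemma \<Gamma>_G: "\<gamma> \<in> \<Gamma> \<Longrightarrow> \<gamma> \<in> G"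
  by (simp add: SL3_def)

lemma \<Gamma>_mult: "\<gamma> \<in> \<Gamma> \<Longrightarrow> \<delta> \<in> \<Gamma> \<Longrightarrow> \<gamma> ** \<delta> \<in> \<Gamma>"
  by (simp add: SL3_def det_mul mult3 nu_integers_closed[OF K])

lemma \<Gamma>_one: "mat 1 \<in> \<Gamma>"
  by (simp add: SL3_def mat_one_3 nu_integers_closed[OF K])

lemma \<Gamma>_inv3: "\<gamma> \<in> \<Gamma> \<Longrightarrow> inv3 \<gamma> \<in> \<Gamma>"
proof -
  assume "\<gamma> \<in> \<Gamma>"
  then have d: "det \<gamma> = 1" and e: "\<gamma> $ i $ j \<in> \<O>" for i j by (auto simp: SL3_def)
  have "\<forall>i j. adj3 \<gamma> $ i $ j \<in> \<O>"
    unfolding adj3_def forall_3 vector_3 by (intro conjI nu_integers_closed(5,6)[OF K] e)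
  then show ?thesis using d by (simp add: SL3_def det_inv3 inv3_det1[OF d, symmetric])
qed

lemma \<Gamma>_discrete: "\<gamma> \<in> \<Gamma> \<Longrightarrow> near 0 (mat 1) \<gamma> \<Longrightarrow> \<gamma> = mat 1"
proof -
  assume g: "\<gamma> \<in> \<Gamma>" "near 0 (mat 1) \<gamma>"
  have "\<gamma> $ i $ j - mat 1 $ i $ j = 0" for i j
  proof (rule \<O>_discrete)
    show "\<gamma> $ i $ j - mat 1 $ i $ j \<in> \<O>"
      using g(1) \<Gamma>_one by (intro nu_integers_closed[OF K]) (auto simp: SL3_def)
    show "vnorm (\<gamma> $ i $ j - mat 1 $ i $ j) < 1" using g(2) by (simp add: near_def mem_vball)
  qed
  then show ?thesis by (simp add: vec_eq_iff)
qed

abbreviation coset :: "'k^3^3 \<Rightarrow> ('k^3^3) set"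
  where "coset A \<equiv> left_coset A \<Gamma>"

abbreviation Q :: "('k^3^3) set set"
  where "Q \<equiv> coset_space G \<Gamma>"

abbreviation \<X> :: "('k^3^3) set topology"
  where "\<X> \<equiv> homogeneous_space K v"

lemma coset_Q: "A \<in> G \<Longrightarrow> coset A \<in> Q"
  by (auto simp: coset_space_def)

lemma QE: "c \<in> Q \<Longrightarrow> \<exists>A\<in>G. c = coset A"
  by (auto simp: coset_space_def)

lemma coset_self: "A \<in> coset A"
  using \<Gamma>_one by (auto simp: left_coset_def intro!: image_eqI[of _ _ "mat 1"])

lemma coset_mult: "\<gamma> \<in> \<Gamma> \<Longrightarrow> coset (A ** \<gamma>) = coset A"
proof -
  have sub: "coset (A ** \<gamma>) \<subseteq> coset A" if "\<gamma> \<in> \<Gamma>" for A \<gamma>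
    using that \<Gamma>_mult by (auto simp: left_coset_def simp flip: matrix_mul_assoc)
  assume g: "\<gamma> \<in> \<Gamma>"
  then have "det \<gamma> \<noteq> 0" using SL3_det by fastforce
  then have "A ** \<gamma> ** inv3 \<gamma> = A" by (simp add: inv3_cancel)
  then have "coset A \<subseteq> coset (A ** \<gamma>)" using sub[OF \<Gamma>_inv3[OF g], of "A ** \<gamma>"] by simp
  with sub[OF g] show ?thesis by blast
qed

lemma coset_eqD: "coset A = coset B \<Longrightarrow> \<exists>\<gamma>\<in>\<Gamma>. A = B ** \<gamma>"
  using coset_self[of A] by (auto simp: left_coset_def)

lemma left_coset_coset: "left_coset h (coset A) = coset (h ** A)"
  by (auto simp: left_coset_def matrix_mul_assoc image_image)

lemma mem_cosetD: "A \<in> coset B \<Longrightarrow> coset A = coset B"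
proof -
  assume "A \<in> coset B"
  then obtain \<gamma> where "\<gamma> \<in> \<Gamma>" "A = B ** \<gamma>" unfolding left_coset_def by blast
  then show ?thesis using coset_mult by simp
qed

lemma coset_G: "B \<in> G \<Longrightarrow> A \<in> coset B \<Longrightarrow> A \<in> G"
  using \<Gamma>_G SL3_mult by (auto simp: left_coset_def)

lemma mem_Union_Q: "U \<subseteq> Q \<Longrightarrow> A \<in> \<Union>U \<longleftrightarrow> A \<in> G \<and> coset A \<in> U"
proof
  assume U: "U \<subseteq> Q" and "A \<in> \<Union>U"
  then obtain c where c: "c \<in> U" "A \<in> c" by blast
  then obtain B where "B \<in> G" "c = coset B" using U QE by blast
  then show "A \<in> G \<and> coset A \<in> U" using c mem_cosetD[of A B] coset_G[of B A] by auto
qed (use coset_self in blast)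

lemma openin_T: "openin \<X> U \<longleftrightarrow> U \<subseteq> Q \<and> openin (G_topology v) (\<Union>U)"
proof -
  have "istopology (\<lambda>S. S \<subseteq> Q \<and> openin (G_topology v) (\<Union>S))"
    unfolding istopology_def
  proof (intro conjI allI impI)
    fix S U assume SU: "S \<subseteq> Q \<and> openin (G_topology v) (\<Union>S)" "U \<subseteq> Q \<and> openin (G_topology v) (\<Union>U)"
    then show "S \<inter> U \<subseteq> Q" by blast
    have "\<Union>(S \<inter> U) = \<Union>S \<inter> \<Union>U"
    proof (intro set_eqI)
      fix A
      show "A \<in> \<Union>(S \<inter> U) \<longleftrightarrow> A \<in> \<Union>S \<inter> \<Union>U"
        using SU mem_Union_Q[of S A] mem_Union_Q[of U A] mem_Union_Q[of "S \<inter> U" A] by blast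
    qed
    then show "openin (G_topology v) (\<Union>(S \<inter> U))" using SU by auto
  next
    fix \<K> assume \<K>: "\<forall>S\<in>\<K>. S \<subseteq> Q \<and> openin (G_topology v) (\<Union>S)"
    then show "\<Union>\<K> \<subseteq> Q" by blast
    have "\<Union>(\<Union>\<K>) = \<Union>((\<lambda>S. \<Union>S) ` \<K>)" by blast
    then show "openin (G_topology v) (\<Union>(\<Union>\<K>))" using \<K> by (auto intro: openin_Union)
  qed
  then show ?thesis unfolding homogeneous_space_def quotient_top_def by simp
qed

lemma openin_T_seq:
  assumes "U \<subseteq> Q"
  shows "openin \<X> U \<longleftrightarrow> (\<forall>A\<in>G. coset A \<in> U \<longrightarrow> (\<forall>s. (\<forall>k. s k \<in> G) \<and> mconv s A \<longrightarrow>
    (\<forall>\<^sub>F k in sequentially. coset (s k) \<in> U)))"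
proof -
  have UG: "\<Union>U \<subseteq> G" using mem_Union_Q[OF assms] by blast
  have mem: "(\<forall>\<^sub>F k in sequentially. s k \<in> \<Union>U) \<longleftrightarrow> (\<forall>\<^sub>F k in sequentially. coset (s k) \<in> U)"
    if "\<forall>k. s k \<in> G" for s :: "nat \<Rightarrow> 'k^3^3"
  proof -
    have "s k \<in> \<Union>U \<longleftrightarrow> coset (s k) \<in> U" for k
      using that mem_Union_Q[OF assms, of "s k"] by (simp only: simp_thms)
    then show ?thesis by (simp only:)
  qed
  show ?thesis
  proof
    assume op: "openin \<X> U"
    show "\<forall>A\<in>G. coset A \<in> U \<longrightarrow> (\<forall>s. (\<forall>k. s k \<in> G) \<and> mconv s A \<longrightarrow>
      (\<forall>\<^sub>F k in sequentially. coset (s k) \<in> U))"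
    proof (intro ballI impI allI)
      fix A s assume A: "A \<in> G" "coset A \<in> U" and s: "(\<forall>k. s k \<in> G) \<and> mconv s A"
      have "A \<in> \<Union>U" by (rule iffD2[OF mem_Union_Q[OF assms] conjI[OF A]])
      moreover have "\<forall>A\<in>\<Union>U. \<forall>s. (\<forall>k. s k \<in> G) \<and> mconv s A \<longrightarrow> (\<forall>\<^sub>F k in sequentially. s k \<in> \<Union>U)"
        using op unfolding openin_T openin_G_topology_seq[OF UG] by (rule conjunct2)
      ultimately have "\<forall>\<^sub>F k in sequentially. s k \<in> \<Union>U" using s by (metis (no_types))
      then show "\<forall>\<^sub>F k in sequentially. coset (s k) \<in> U" using mem s by (simp only: simp_thms)
    qed
  next
    assume seq: "\<forall>A\<in>G. coset A \<in> U \<longrightarrow> (\<forall>s. (\<forall>k. s k \<in> G) \<and> mconv s A \<longrightarrow>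
      (\<forall>\<^sub>F k in sequentially. coset (s k) \<in> U))"
    show "openin \<X> U"
      unfolding openin_T openin_G_topology_seq[OF UG]
    proof (intro conjI assms ballI allI impI)
      fix A s assume A: "A \<in> \<Union>U" and s: "(\<forall>k. s k \<in> G) \<and> mconv s A"
      have "A \<in> G \<and> coset A \<in> U" by (rule iffD1[OF mem_Union_Q[OF assms] A])
      then have "\<forall>\<^sub>F k in sequentially. coset (s k) \<in> U" using seq s by blast
      then show "\<forall>\<^sub>F k in sequentially. s k \<in> \<Union>U" using mem s by (simp only: simp_thms)
    qed
  qed
qed

lemma topspace_T: "topspace \<X> = Q"
proof -
  have "openin \<X> Q" using coset_Q by (subst openin_T_seq) auto
  then have "Q \<subseteq> topspace \<X>" by (rule openin_subset)
  moreover have "topspace \<X> \<subseteq> Q" using openin_topspace[of \<X>] unfolding openin_T by blast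
  ultimately show ?thesis by blast
qed

lemma closedin_T_seq:
  assumes "C \<subseteq> Q"
  shows "closedin \<X> C \<longleftrightarrow>
    (\<forall>s A. (\<forall>k. s k \<in> G \<and> coset (s k) \<in> C) \<and> A \<in> G \<and> mconv s A \<longrightarrow> coset A \<in> C)"
proof -
  have cl: "closedin \<X> C \<longleftrightarrow> openin \<X> (Q - C)" using assms by (simp add: closedin_def topspace_T)
  have op: "openin \<X> (Q - C) \<longleftrightarrow> (\<forall>A\<in>G. coset A \<in> Q - C \<longrightarrow> (\<forall>s. (\<forall>k. s k \<in> G) \<and> mconv s A \<longrightarrow>
    (\<forall>\<^sub>F k in sequentially. coset (s k) \<in> Q - C)))" by (rule openin_T_seq) blast
  show ?thesis
  proof
    assume "closedin \<X> C"
    then have op': "\<And>A s. A \<in> G \<Longrightarrow> coset A \<in> Q - C \<Longrightarrow> \<forall>k. s k \<in> G \<Longrightarrow> mconv s A \<Longrightarrow>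
      \<forall>\<^sub>F k in sequentially. coset (s k) \<in> Q - C" using op cl by blast
    show "\<forall>s A. (\<forall>k. s k \<in> G \<and> coset (s k) \<in> C) \<and> A \<in> G \<and> mconv s A \<longrightarrow> coset A \<in> C"
    proof (intro allI impI, rule ccontr)
      fix s A assume s: "(\<forall>k. s k \<in> G \<and> coset (s k) \<in> C) \<and> A \<in> G \<and> mconv s A" and "coset A \<notin> C"
      then have "\<forall>\<^sub>F k in sequentially. coset (s k) \<in> Q - C" using coset_Q by (intro op') auto
      then show False using s by simp
    qed
  next
    assume seq: "\<forall>s A. (\<forall>k. s k \<in> G \<and> coset (s k) \<in> C) \<and> A \<in> G \<and> mconv s A \<longrightarrow> coset A \<in> C"
    have "\<forall>\<^sub>F k in sequentially. coset (s k) \<in> Q - C"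
      if A: "A \<in> G" "coset A \<in> Q - C" and s: "\<forall>k. s k \<in> G" "mconv s A" for A s
    proof (rule ccontr)
      assume n: "\<not> (\<forall>\<^sub>F k in sequentially. coset (s k) \<in> Q - C)"
      obtain r :: "nat \<Rightarrow> nat" where "strict_mono r \<and> (\<forall>n. coset (s (r n)) \<notin> Q - C)"
        using not_eventually_sequentiallyD[OF n] by (rule exE)
      then have r: "strict_mono r" "\<And>n. coset (s (r n)) \<notin> Q - C" by auto
      have "mconv (\<lambda>n. s (r n)) A" using s(2) r(1) by (rule mconv_subseq)
      moreover have "s (r n) \<in> G \<and> coset (s (r n)) \<in> C" for n using r(2)[of n] s(1) coset_Q by auto
      ultimately have "coset A \<in> C" using seq[rule_format, of "\<lambda>n. s (r n)" A] A(1) by blast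
      then show False using A(2) by blast
    qed
    then show "closedin \<X> C" using op cl by blast
  qed
qed

text \<open>The quotient map is open: right translation by \<gamma> is continuous and does not
  change cosets.\<close>

lemma openin_near:
  assumes "A \<in> G"
  shows "openin \<X> {coset B | B. B \<in> G \<and> near n A B}"
proof (subst openin_T_seq)
  show "{coset B | B. B \<in> G \<and> near n A B} \<subseteq> Q" using coset_Q by blast
  show "\<forall>C\<in>G. coset C \<in> {coset B | B. B \<in> G \<and> near n A B} \<longrightarrow> (\<forall>s. (\<forall>k. s k \<in> G) \<and> mconv s C \<longrightarrow>
      (\<forall>\<^sub>F k in sequentially. coset (s k) \<in> {coset B | B. B \<in> G \<and> near n A B}))"
  proof (intro ballI impI allI)
    fix C s
    assume C: "C \<in> G" "coset C \<in> {coset B | B. B \<in> G \<and> near n A B}" and s: "(\<forall>k. s k \<in> G) \<and> mconv s C"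
    then obtain B where B: "B \<in> G" "near n A B" "coset B = coset C" by auto
    then obtain \<gamma> where g: "\<gamma> \<in> \<Gamma>" "B = C ** \<gamma>" using coset_eqD[of B C] by blast
    have "mconv (\<lambda>k. s k ** \<gamma>) B" unfolding g(2) using s by (intro mconv_mult) auto
    then have "\<forall>\<^sub>F k in sequentially. near n B (s k ** \<gamma>)" by (rule mconv_near)
    then show "\<forall>\<^sub>F k in sequentially. coset (s k) \<in> {coset B | B. B \<in> G \<and> near n A B}"
    proof eventually_elim
      case (elim k)
      have "s k ** \<gamma> \<in> G" using s g(1) \<Gamma>_G by (auto intro: SL3_mult)
      then show ?case using near_trans[OF B(2) elim] coset_mult[OF g(1), of "s k"] by blast
    qed
  qed
qed

lemma closure_of_seq:
  assumes S: "S \<subseteq> Q" and A: "A \<in> G" "coset A \<in> \<X> closure_of S"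
  shows "\<exists>s. (\<forall>k. s k \<in> G \<and> coset (s k) \<in> S) \<and> mconv s A"
proof -
  have meet: "\<exists>y. y \<in> S \<and> y \<in> U" if "coset A \<in> U" "openin \<X> U" for U
    using A(2) that unfolding in_closure_of by blast
  have "\<exists>B. B \<in> G \<and> near (int k) A B \<and> coset B \<in> S" for k :: nat
  proof -
    have "coset A \<in> {coset B | B. B \<in> G \<and> near (int k) A B}" using A(1) near_refl by blast
    then have "\<exists>y. y \<in> S \<and> y \<in> {coset B | B. B \<in> G \<and> near (int k) A B}"
      using openin_near[OF A(1)] by (rule meet)
    then show ?thesis by auto
  qed
  then obtain s where s: "\<And>k. s k \<in> G" "\<And>k. near (int k) A (s k)" "\<And>k. coset (s k) \<in> S" by metis
  then have "mconv s A" by (intro near_mconv)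
  with s show ?thesis by blast
qed

text \<open>Compactness of the quotient gives convergence only after the lifts are corrected by
  elements of \<Gamma>. If no such limit existed, every coset in X would have a neighbourhood
  visited only finitely often, and finitely many of these neighbourhoods cover X.\<close>

lemma compactin_T_seq:
  fixes s :: "nat \<Rightarrow> 'k^3^3"
  assumes X: "compactin \<X> X" and s: "\<And>k. s k \<in> G" "\<And>k. coset (s k) \<in> X"
  shows "\<exists>r \<gamma> L. strict_mono r \<and> (\<forall>k. \<gamma> k \<in> \<Gamma>) \<and> L \<in> G \<and> coset L \<in> X \<and> mconv (\<lambda>k. s (r k) ** \<gamma> k) L"
proof -
  have "\<exists>A. A \<in> G \<and> coset A \<in> X \<and> (\<forall>n N. \<exists>k\<ge>N. \<exists>\<gamma>\<in>\<Gamma>. near n A (s k ** \<gamma>))"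
  proof (rule ccontr)
    assume "\<not> ?thesis"
    then have "\<forall>A. A \<in> G \<and> coset A \<in> X \<longrightarrow> (\<exists>n N. \<forall>k\<ge>N. \<forall>\<gamma>\<in>\<Gamma>. \<not> near n A (s k ** \<gamma>))" by blast
    then obtain n N where nN: "\<And>A k \<gamma>. A \<in> G \<Longrightarrow> coset A \<in> X \<Longrightarrow> N A \<le> k \<Longrightarrow> \<gamma> \<in> \<Gamma> \<Longrightarrow> \<not> near (n A) A (s k ** \<gamma>)"
      by metis
    define \<U> where "\<U> A = {coset B | B. B \<in> G \<and> near (n A) A B}" for A
    define J where "J = {A. A \<in> G \<and> coset A \<in> X}"
    have "\<forall>U\<in>\<U> ` J. openin \<X> U" using openin_near by (auto simp: \<U>_def J_def)
    moreover have "X \<subseteq> \<Union>(\<U> ` J)"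
    proof
      fix c assume c: "c \<in> X"
      then have "c \<in> Q" using X topspace_T by (auto simp: compactin_def)
      then obtain A where "A \<in> G" "c = coset A" using QE by blast
      then have "A \<in> J" "c \<in> \<U> A" using c near_refl by (auto simp: \<U>_def J_def)
      then show "c \<in> \<Union>(\<U> ` J)" by blast
    qed
    ultimately obtain \<F> where "finite \<F>" "\<F> \<subseteq> \<U> ` J" "X \<subseteq> \<Union>\<F>"
      using X unfolding compactin_def by meson
    then obtain F where F: "finite F" "F \<subseteq> J" "X \<subseteq> \<Union>(\<U> ` F)" by (metis finite_subset_image)
    define k where "k = Max (insert 0 (N ` F))"
    have "coset (s k) \<in> \<Union>(\<U> ` F)" using s(2) F(3) by blast
    then obtain A B where A: "A \<in> F" "coset (s k) = coset B" "near (n A) A B" by (auto simp: \<U>_def)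
    then obtain \<gamma> where g: "\<gamma> \<in> \<Gamma>" "B = s k ** \<gamma>" using coset_eqD[of B "s k"] by auto
    have "N A \<le> k" unfolding k_def using F(1) A(1) by (intro Max_ge) auto
    then show False using nN[of A k \<gamma>] A F(2) g by (auto simp: J_def)
  qed
  then obtain L where L: "L \<in> G" "coset L \<in> X" "\<And>n N. \<exists>k\<ge>N. \<exists>\<gamma>\<in>\<Gamma>. near n L (s k ** \<gamma>)" by blast
  have "\<exists>r. \<forall>n. (\<exists>\<gamma>\<in>\<Gamma>. near (int n) L (s (r n) ** \<gamma>)) \<and> r n < r (Suc n)"
  proof (rule dependent_nat_choice)
    show "\<exists>x. \<exists>\<gamma>\<in>\<Gamma>. near (int 0) L (s x ** \<gamma>)" using L(3)[of 0 "int 0"] by blast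
    show "\<exists>y. (\<exists>\<gamma>\<in>\<Gamma>. near (int (Suc n)) L (s y ** \<gamma>)) \<and> x < y" for x n
      using L(3)[of "Suc x" "int (Suc n)"] by (auto simp: Suc_le_eq)
  qed
  then obtain r where r: "\<And>n. \<exists>\<gamma>\<in>\<Gamma>. near (int n) L (s (r n) ** \<gamma>)" "\<And>n. r n < r (Suc n)" by blast
  then obtain \<gamma> where g: "\<And>n. \<gamma> n \<in> \<Gamma>" "\<And>n. near (int n) L (s (r n) ** \<gamma> n)" by metis
  then have "mconv (\<lambda>n. s (r n) ** \<gamma> n) L" by (intro near_mconv)
  moreover have "strict_mono r" using r(2) by (simp add: strict_mono_Suc_iff)
  ultimately show ?thesis using g(1) L(1,2) by blast
qed

text \<open>Otherwise the complements would cover X, and finitely many of them would; but in a chain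
  a finite family has a least member, and this one is nonempty.\<close>

lemma compactin_T_chain:
  assumes X: "compactin \<X> X" and C: "\<C> \<noteq> {}" "\<And>C. C \<in> \<C> \<Longrightarrow> closedin \<X> C \<and> C \<noteq> {} \<and> C \<subseteq> X"
    and chain: "\<And>C D. C \<in> \<C> \<Longrightarrow> D \<in> \<C> \<Longrightarrow> C \<subseteq> D \<or> D \<subseteq> C"
  shows "\<Inter>\<C> \<noteq> {}"
proof
  assume empty: "\<Inter>\<C> = {}"
  have "\<forall>U\<in>(\<lambda>C. Q - C) ` \<C>. openin \<X> U" using C(2) by (auto simp: closedin_def topspace_T)
  moreover have "X \<subseteq> \<Union>((\<lambda>C. Q - C) ` \<C>)"
  proof
    fix c assume "c \<in> X"
    then have "c \<in> Q" using X topspace_T by (auto simp: compactin_def)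
    moreover obtain D where "D \<in> \<C>" "c \<notin> D" using empty by blast
    ultimately show "c \<in> \<Union>((\<lambda>C. Q - C) ` \<C>)" by blast
  qed
  ultimately obtain \<F> where "finite \<F>" "\<F> \<subseteq> (\<lambda>C. Q - C) ` \<C>" "X \<subseteq> \<Union>\<F>"
    using X unfolding compactin_def by meson
  then obtain F where F: "finite F" "F \<subseteq> \<C>" "X \<subseteq> \<Union>((\<lambda>C. Q - C) ` F)" by (metis finite_subset_image)
  obtain D where D: "D \<in> \<C>" using C(1) by blast
  then have "F \<noteq> {}" using F(3) C(2)[OF D] by auto
  then obtain M where M: "M \<in> F" "\<And>D. D \<in> F \<Longrightarrow> D \<subseteq> M \<Longrightarrow> D = M"
    using finite_has_minimal[OF F(1)] by metis
  then have least: "M \<subseteq> D" if "D \<in> F" for D using chain[of M D] F(2) that by blast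
  obtain c where "c \<in> M" using C(2) M(1) F(2) by blast
  then show False using F(3) C(2)[of M] M(1) F(2) least by blast
qed

end

section \<open>Ternary forms and the orbit dynamics\<close>

text \<open>Gram matrix of $y^2 - 2xz + cz^2$.\<close>
definition normal_form :: "'k::field \<Rightarrow> 'k^3^3"
  where "normal_form c = vector [vector [0, 0, -1], vector [0, 1, 0], vector [-1, 0, c]]"

definition upper_unip :: "'k::field \<Rightarrow> 'k^3^3"
  where "upper_unip t = vector [vector [1, t, t * t / 2], vector [0, 1, t], vector [0, 0, 1]]"

definition lower_unip :: "'k::field \<Rightarrow> 'k^3^3"
  where "lower_unip t = vector [vector [1, 0, 0], vector [t, 1, 0], vector [t * t / 2, t, 1]]"

definition torus :: "'k::field \<Rightarrow> 'k^3^3"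
  where "torus m = vector [vector [inverse m, 0, 0], vector [0, 1, 0], vector [0, 0, m]]"

definition weyl :: "'k::field^3^3"
  where "weyl = vector [vector [0, 0, 1], vector [0, -1, 0], vector [1, 0, 0]]"

text \<open>The Gram matrix of the form composed with g, hence a right action.\<close>

definition act :: "'k::field^3^3 \<Rightarrow> 'k^3^3 \<Rightarrow> 'k^3^3"
  where "act M g = transpose g ** M ** g"

definition SO :: "'k::field^3^3 \<Rightarrow> bool"
  where "SO h \<longleftrightarrow> det h = 1 \<and> act (normal_form 0) h = normal_form 0"

lemmas mat3_simps = mult3 det_3 transpose_def normal_form_def upper_unip_def lower_unip_def torus_def weyl_def

lemma act_act: "act (act M g) h = act M (g ** h)"
  by (simp add: act_def matrix_transpose_mul matrix_mul_assoc)

lemma act_one: "act M (mat 1) = M"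
  by (simp add: act_def)

lemma qform_act: "qform (act M g) w = qform M (g *v w)"
  by (simp add: qform_def sum_3 act_def mult3 vmult3 transpose_def algebra_simps)

lemma qform_normal: "qform (normal_form c) w = w$2 * w$2 - 2 * w$1 * w$3 + c * w$3 * w$3"
  by (simp add: qform_def sum_3 normal_form_def algebra_simps)

lemma act_normal:
  "act (normal_form c) g $ i $ j = g$2$i * g$2$j - g$1$i * g$3$j - g$3$i * g$1$j + c * g$3$i * g$3$j"
  by (simp add: act_def mult3 transpose_def normal_form_def algebra_simps)

lemma upper_unip_add: "(2::'k::field) \<noteq> 0 \<Longrightarrow> upper_unip s ** upper_unip t = upper_unip (s + t :: 'k)"
  by (rule mat3_eqI; simp add: mult3 upper_unip_def field_simps)

lemma upper_unip_0: "upper_unip 0 = mat 1"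
  by (rule mat3_eqI; simp add: upper_unip_def mat_def)

lemma det_unip [simp]: "det (upper_unip t) = 1" "det (lower_unip t) = 1"
  by (simp_all add: mat3_simps)

lemma det_torus: "m \<noteq> 0 \<Longrightarrow> det (torus m) = 1"
  by (simp add: mat3_simps)

lemma act_upper_unip: "(2::'k::field) \<noteq> 0 \<Longrightarrow> act (normal_form c) (upper_unip t :: 'k^3^3) = normal_form c"
  by (rule mat3_eqI; simp add: act_normal upper_unip_def; simp add: normal_form_def field_simps)

lemma act_torus: "m \<noteq> 0 \<Longrightarrow> act (normal_form c) (torus m) = normal_form (c * m * m)"
  by (rule mat3_eqI; simp add: act_normal torus_def; simp add: normal_form_def)

lemma SO_upper_unip: "(2::'k::field) \<noteq> 0 \<Longrightarrow> SO (upper_unip t :: 'k^3^3)"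
  by (simp add: SO_def act_upper_unip)

lemma SO_torus: "m \<noteq> 0 \<Longrightarrow> SO (torus m)"
  by (simp add: SO_def act_torus det_torus)

lemma SO_weyl: "SO weyl"
proof -
  have "act (normal_form 0) weyl = normal_form 0"
    by (rule mat3_eqI; simp add: act_normal weyl_def; simp add: normal_form_def)
  then show ?thesis by (simp add: SO_def mat3_simps)
qed

lemma SO_mult: "SO g \<Longrightarrow> SO h \<Longrightarrow> SO (g ** h)"
  by (simp add: SO_def det_mul act_act[symmetric])

lemma SO_one: "SO (mat 1)"
  by (simp add: SO_def act_one)

text \<open>The identity of fractional linear transformations behind the reparametrisation
  $t \mapsto t/(1 - kt/2)$.\<close>
lemma lower_upper_commute:
  assumes "(2::'k::field) \<noteq> 0" "m = 1 - k * t / 2" "m \<noteq> 0"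
  shows "lower_unip k ** upper_unip (t / m) = upper_unip t ** torus (inverse (m * m)) ** lower_unip (k * m :: 'k)"
proof -
  have four: "(4 :: 'k) \<noteq> 0"
  proof -
    have "(4 :: 'k) = 2 * 2" by simp
    then show ?thesis using assms(1) by (metis mult_eq_0_iff)
  qed
  show ?thesis
  proof (cases "t = 0")
    case True
    then show ?thesis using assms(1,2)
      by (auto intro!: mat3_eqI simp: mult3 lower_unip_def upper_unip_def torus_def)
  next
    case False
    then have k: "k = (2 - 2 * m) / t" using assms(1,2) by (simp add: field_simps)
    show ?thesis unfolding k
      by (rule mat3_eqI;
          simp add: mult3 lower_unip_def upper_unip_def torus_def assms(1,3) four False divide_simps;
          simp add: algebra_simps four)
  qed
qed

lemma trace_3: "trace (A :: 'k::semiring_1^3^3) = A$1$1 + A$2$2 + A$3$3"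
  by (simp add: trace_def sum_3)

text \<open>\<open>XX\<close> stands for the compact orbit closure, lifted to matrices and written
  in coordinates in which the form is \<open>normal_form 0\<close>. The change of coordinates need
  not have determinant 1, which accounts for D. Compactness holds only modulo \<Gamma>.\<close>

locale orbit_dynamics = completion K v for K :: "'k::field set" and v :: "'k \<Rightarrow> int" +
  fixes D :: 'k and XX :: "('k^3^3) set"
  assumes two: "(2 :: 'k) \<noteq> 0" and D: "D \<noteq> 0"
    and det_XX: "A \<in> XX \<Longrightarrow> det A = D"
    and XX_\<Gamma>: "A \<in> XX \<Longrightarrow> \<gamma> \<in> \<Gamma> \<Longrightarrow> A ** \<gamma> \<in> XX"
    and XX_SO: "A \<in> XX \<Longrightarrow> SO h \<Longrightarrow> h ** A \<in> XX"
    and XX_compact: "(\<And>k::nat. s k \<in> XX) \<Longrightarrow>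
      \<exists>r \<gamma> L. strict_mono r \<and> (\<forall>k. \<gamma> k \<in> \<Gamma>) \<and> L \<in> XX \<and> mconv (\<lambda>k. s (r k) ** \<gamma> k) L"
begin

definition closed_inv :: "('k^3^3) set \<Rightarrow> bool"
  where "closed_inv Y \<longleftrightarrow> Y \<subseteq> XX \<and> (\<forall>A\<in>Y. \<forall>\<gamma>\<in>\<Gamma>. A ** \<gamma> \<in> Y) \<and>
    (\<forall>s A. (\<forall>k. s k \<in> Y) \<and> mconv s A \<longrightarrow> A \<in> Y)"

abbreviation integral :: "'k^3 \<Rightarrow> bool"
  where "integral m \<equiv> \<forall>i. m $ i \<in> \<O>"

lemma integral_\<Gamma>: "\<gamma> \<in> \<Gamma> \<Longrightarrow> integral m \<Longrightarrow> integral (\<gamma> *v m)"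
  unfolding SL3_def vmult3 by (auto intro!: nu_integers_closed[OF K])

lemma vnorm_2: "vnorm 2 = 1"
proof -
  have "of_int 2 \<in> (prime_subfield :: 'k set)" unfolding prime_subfield_def by (rule rangeI)
  then show ?thesis using vnorm_prime_subfield[of 2] two by simp
qed

lemma ex_vnorm_between:
  assumes "0 < \<delta>"
  shows "\<exists>x. x \<noteq> 0 \<and> \<delta> \<le> vnorm x \<and> vnorm x < 2 * \<delta>"
proof -
  define j where "j = \<lceil>log 2 \<delta>\<rceil>"
  obtain x where x: "x \<noteq> 0" "v x = - j" using v_surj by blast
  have "log 2 \<delta> \<le> of_int j" "of_int j < log 2 \<delta> + 1"
    using ceiling_correct[of "log 2 \<delta>"] unfolding j_def by linarith+
  then have "2 powr (log 2 \<delta>) \<le> 2 powr (of_int j)" "2 powr (of_int j) < 2 powr (log 2 \<delta> + 1)"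
    by simp_all
  moreover have "vnorm x = 2 powr (of_int j)" using x powr_real_of_int'[of 2 j] by (simp add: vnorm_def)
  ultimately show ?thesis using x(1) assms by (intro exI[of _ x]) (auto simp: powr_add)
qed

text \<open>Shearing by \<open>upper_unip\<close> removes y and leaves the value -2xz. The torus
  then balances x against z: the norm of z is moved into the interval from \<delta> to 2\<delta>, as
  the discrete set of norms allows, and x falls below \<delta>. If z = 0 and x is nonzero,
  \<open>weyl\<close> first exchanges the two.\<close>

lemma shrink_vector:
  assumes d: "0 < \<delta>" and Q: "vnorm (qform (normal_form 0) w) < \<delta> ^ 2"
  shows "\<exists>h. SO h \<and> (\<forall>i. vnorm ((h *v w) $ i) < 2 * \<delta>)"
proof -
  have main: "\<exists>h. SO h \<and> (\<forall>i. vnorm ((h *v w) $ i) < 2 * \<delta>)"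
    if Q: "vnorm (qform (normal_form 0) w) < \<delta> ^ 2" and z: "w $ 3 \<noteq> 0" for w
  proof -
    define u where "u = upper_unip (- w$2 / w$3)"
    define w' where "w' = u *v w"
    have w': "w' $ 2 = 0" "w' $ 3 = w $ 3"
      using z by (simp_all add: w'_def u_def upper_unip_def vmult3)
    have "qform (normal_form 0) w' = qform (normal_form 0) w"
      unfolding w'_def qform_act[symmetric] u_def act_upper_unip[OF two] by simp
    moreover have "qform (normal_form 0) w' = - (2 * w'$1 * w'$3)"
      by (simp add: qform_normal w'(1))
    ultimately have "vnorm (- (2 * w'$1 * w'$3)) < \<delta> ^ 2" using Q by metis
    then have less: "vnorm (w'$1) * vnorm (w'$3) < \<delta> ^ 2"
      by (simp only: vnorm_minus vnorm_mult vnorm_2 mult_1_left)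
    obtain x where x: "x \<noteq> 0" "\<delta> \<le> vnorm x" "vnorm x < 2 * \<delta>"
      using ex_vnorm_between[OF d] by blast
    define \<mu> where "\<mu> = x / w$3"
    have \<mu>: "\<mu> \<noteq> 0" "\<mu> * w'$3 = x" using x z by (auto simp: \<mu>_def w')
    have comp: "(torus \<mu> *v w') $ 1 = inverse \<mu> * w'$1" "(torus \<mu> *v w') $ 2 = 0" "(torus \<mu> *v w') $ 3 = x"
      by (simp_all add: torus_def vmult3 w' \<mu>(2)[unfolded w'])
    have "vnorm (inverse \<mu> * w'$1) * vnorm x = vnorm (w'$1) * vnorm (w'$3)"
      using \<mu> by (simp add: vnorm_mult vnorm_inverse flip: \<mu>(2))
    then have "vnorm (inverse \<mu> * w'$1) * vnorm x < \<delta> ^ 2" using less by simp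
    moreover have "vnorm (inverse \<mu> * w'$1) * \<delta> \<le> vnorm (inverse \<mu> * w'$1) * vnorm x"
      using x by (intro mult_left_mono) auto
    ultimately have "vnorm (inverse \<mu> * w'$1) * \<delta> < \<delta> * \<delta>" by (simp add: power2_eq_square)
    then have "vnorm (inverse \<mu> * w'$1) < \<delta>" using d by simp
    then have "\<forall>i. vnorm ((torus \<mu> *v w') $ i) < 2 * \<delta>" using comp x d by (simp add: forall_3)
    moreover have "torus \<mu> *v w' = (torus \<mu> ** u) *v w" by (simp add: w'_def matrix_vector_mul_assoc)
    moreover have "SO (torus \<mu> ** u)"
      unfolding u_def using \<mu>(1) by (intro SO_mult SO_torus SO_upper_unip two)
    ultimately show ?thesis by metis
  qed
  consider "w $ 3 \<noteq> 0" | "w $ 3 = 0" "w $ 1 \<noteq> 0" | "w $ 3 = 0" "w $ 1 = 0" by blast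
  then show ?thesis
  proof cases
    case 1
    then show ?thesis using main Q by blast
  next
    case 2
    have "vnorm (qform (normal_form 0) (weyl *v w)) < \<delta> ^ 2"
      using Q unfolding qform_act[symmetric] by (simp add: conjunct2[OF SO_weyl[unfolded SO_def]])
    moreover have "(weyl *v w) $ 3 \<noteq> 0" using 2 by (simp add: weyl_def vmult3)
    ultimately obtain h where "SO h" "\<forall>i. vnorm ((h *v (weyl *v w)) $ i) < 2 * \<delta>" using main by blast
    then show ?thesis using SO_mult[OF _ SO_weyl]
      by (intro exI[of _ "h ** weyl"]) (simp add: matrix_vector_mul_assoc)
  next
    case 3
    then have "vnorm (w$2) ^ 2 < \<delta> ^ 2" using Q by (simp add: qform_normal vnorm_mult power2_eq_square)
    then have "vnorm (w$2) < \<delta>" using d by (simp add: power_less_imp_less_base)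
    then show ?thesis using 3 d SO_one by (intro exI[of _ "mat 1"]) (simp add: forall_3)
  qed
qed

text \<open>A lattice vector with a small value of the form could be shrunk by the stabiliser, which a
  compact family of lattices does not allow.\<close>
lemma form_values_bounded_below:
  "\<exists>\<epsilon>>0. \<forall>A\<in>XX. \<forall>m. integral m \<and> m \<noteq> 0 \<longrightarrow> \<epsilon> \<le> vnorm (qform (normal_form 0) (A *v m))"
proof (rule ccontr)
  assume "\<not> ?thesis"
  then have neg: "\<exists>A\<in>XX. \<exists>m. integral m \<and> m \<noteq> 0 \<and> vnorm (qform (normal_form 0) (A *v m)) < \<epsilon>"
    if "\<epsilon> > 0" for \<epsilon> using that by (meson linorder_not_le)
  have "\<exists>A m h. A \<in> XX \<and> integral m \<and> m \<noteq> 0 \<and> SO h \<and> (\<forall>i. vnorm ((h *v (A *v m)) $ i) < 2 * (1 / 2) ^ n)"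
    for n :: nat
  proof -
    obtain A m where "A \<in> XX" "integral m" "m \<noteq> 0" "vnorm (qform (normal_form 0) (A *v m)) < ((1 / 2) ^ n) ^ 2"
      using neg[of "((1 / 2) ^ n) ^ 2"] by auto
    then show ?thesis using shrink_vector[of "(1 / 2) ^ n" "A *v m"] by force
  qed
  then obtain A m h where A: "\<And>n. A n \<in> XX" and m: "\<And>n. integral (m n)" "\<And>n. m n \<noteq> 0"
    and h: "\<And>n. SO (h n)" "\<And>n i. vnorm ((h n *v (A n *v m n)) $ i) < 2 * (1 / 2) ^ n"
    by metis
  define s where "s n = h n ** A n" for n
  have "s n \<in> XX" for n using XX_SO[OF A h(1)] by (simp add: s_def)
  then obtain r \<gamma> L where r: "strict_mono r" "\<And>k. \<gamma> k \<in> \<Gamma>" "L \<in> XX" "mconv (\<lambda>k. s (r k) ** \<gamma> k) L"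
    using XX_compact[of s] by auto
  define F where "F k = s (r k) ** \<gamma> k" for k
  have FXX: "F k \<in> XX" for k unfolding F_def using XX_\<Gamma>[OF \<open>s (r k) \<in> XX\<close> r(2)] .
  have inv: "mconv (\<lambda>k. inv3 (F k)) (inv3 L)"
    using r(4) det_XX[OF r(3)] D unfolding F_def by (intro mconv_inv3) auto
  define w where "w k = s (r k) *v m (r k)" for k
  have w: "vconv (\<lambda>k. w k $ i) 0" for i
  proof -
    have "(\<lambda>n. 2 * (1 / 2 :: real) ^ n) \<longlonglongrightarrow> 2 * 0" by (intro tendsto_intros LIMSEQ_power_zero) auto
    then have "(\<lambda>n. vnorm ((s n *v m n) $ i)) \<longlonglongrightarrow> 0"
      using h(2)[THEN less_imp_le]
      by (intro real_tendsto_sandwich[of "\<lambda>n. 0" "\<lambda>n. vnorm ((s n *v m n) $ i)" sequentially "\<lambda>n. 2 * (1 / 2) ^ n"])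
        (simp_all add: always_eventually s_def matrix_vector_mul_assoc)
    then have "vconv (\<lambda>n. (s n *v m n) $ i) 0" by (simp add: vconv_def)
    then show ?thesis unfolding w_def by (rule vconv_subseq[OF _ r(1)])
  qed
  \<comment> \<open>The same lattice vector in terms of the corrected bases \<open>F k\<close>. As
    these converge and the vectors \<open>w k\<close> tend to 0, so do the coefficients
    \<open>m' k\<close>, and being integral they vanish for some k.\<close>
  define m' where "m' k = inv3 (\<gamma> k) *v m (r k)" for k
  have det\<gamma>: "det (\<gamma> k) \<noteq> 0" for k using SL3_det[OF r(2)] by simp
  have int: "integral (m' k)" for k unfolding m'_def by (rule integral_\<Gamma>[OF \<Gamma>_inv3[OF r(2)] m(1)])
  have "w k = F k *v m' k" for k
    unfolding w_def F_def m'_def matrix_vector_mul_assoc inv3_cancel(3)[OF det\<gamma>] by simp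
  then have m'w: "m' k = inv3 (F k) *v w k" for k
    using inv3(2)[of "F k"] det_XX[OF FXX] D by (simp add: matrix_vector_mul_assoc)
  have "vconv (\<lambda>k. m' k $ i) (inv3 L $ i $ 1 * 0 + inv3 L $ i $ 2 * 0 + inv3 L $ i $ 3 * 0)" for i
    unfolding m'w vmult3 by (intro vconv_add vconv_mult w mconvD[OF inv])
  then have "\<forall>\<^sub>F k in sequentially. vnorm (m' k $ i) < 1" for i
    unfolding vconv_iff by (auto dest: spec[of _ 1])
  then have "\<forall>\<^sub>F k in sequentially. \<forall>i\<in>UNIV. vnorm (m' k $ i) < 1"
    by (intro eventually_ball_finite ballI) auto
  then obtain k where k: "\<And>i. vnorm (m' k $ i) < 1" by (auto simp: eventually_sequentially)
  have "m' k = 0" unfolding vec_eq_iff using \<O>_discrete[OF _ k] int by simp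
  then have "\<gamma> k *v m' k = 0" by simp
  then have "m (r k) = 0" by (simp add: m'_def matrix_vector_mul_assoc inv3[OF det\<gamma>])
  then show False using m(2) by blast
qed

text \<open>The nonempty intersection of chains is assumed here, since it comes from covers of the
  quotient and not from the sequential compactness of \<open>XX\<close>.\<close>

lemma ex_minimal:
  assumes chains: "\<And>\<C>. \<C> \<noteq> {} \<Longrightarrow> (\<And>C. C \<in> \<C> \<Longrightarrow> closed_inv C \<and> C \<noteq> {}) \<Longrightarrow>
      (\<And>C C'. C \<in> \<C> \<Longrightarrow> C' \<in> \<C> \<Longrightarrow> C \<subseteq> C' \<or> C' \<subseteq> C) \<Longrightarrow> \<Inter>\<C> \<noteq> {}"
    and E: "closed_inv E" "E \<noteq> {}" "\<And>A t. A \<in> E \<Longrightarrow> upper_unip t ** A \<in> E"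
  shows "\<exists>Y. closed_inv Y \<and> Y \<noteq> {} \<and> Y \<subseteq> E \<and> (\<forall>A\<in>Y. \<forall>t. upper_unip t ** A \<in> Y) \<and>
    (\<forall>Z\<subseteq>Y. closed_inv Z \<and> Z \<noteq> {} \<and> (\<forall>A\<in>Z. \<forall>t. upper_unip t ** A \<in> Z) \<longrightarrow> Z = Y)"
proof -
  define adm where "adm Y \<longleftrightarrow> closed_inv Y \<and> Y \<noteq> {} \<and> Y \<subseteq> E \<and> (\<forall>A\<in>Y. \<forall>t. upper_unip t ** A \<in> Y)" for Y
  \<comment> \<open>Complements turn the minimal set sought into a maximal element for Zorn's
    lemma.\<close>
  define \<A> where "\<A> = uminus ` {Y. adm Y}"
  have "\<exists>M\<in>\<A>. \<forall>X\<in>\<A>. M \<subseteq> X \<longrightarrow> X = M"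
  proof (rule subset_Zorn_nonempty)
    show "\<A> \<noteq> {}" using E by (auto simp: \<A>_def adm_def)
    fix \<C> assume C: "\<C> \<noteq> {}" "subset.chain \<A> \<C>"
    define \<D> where "\<D> = uminus ` \<C>"
    have adm: "adm Y" if "Y \<in> \<D>" for Y
      using that C(2) unfolding \<D>_def \<A>_def subset_chain_def by auto
    have ch: "Y \<subseteq> Z \<or> Z \<subseteq> Y" if "Y \<in> \<D>" "Z \<in> \<D>" for Y Z
      using that C(2) unfolding \<D>_def subset_chain_def by auto
    have "\<Inter>\<D> \<noteq> {}" using adm ch C(1) by (intro chains) (auto simp: adm_def \<D>_def)
    moreover obtain Y0 where Y0: "Y0 \<in> \<D>" using C(1) by (auto simp: \<D>_def)
    moreover have "closed_inv (\<Inter>\<D>)"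
      unfolding closed_inv_def
    proof (intro conjI ballI allI impI)
      show "\<Inter>\<D> \<subseteq> XX" using adm[OF Y0] Y0 by (auto simp: adm_def closed_inv_def)
      show "A ** \<gamma> \<in> \<Inter>\<D>" if "A \<in> \<Inter>\<D>" "\<gamma> \<in> \<Gamma>" for A \<gamma>
        using that adm by (auto simp: adm_def closed_inv_def)
      show "A \<in> \<Inter>\<D>" if s: "(\<forall>k. s k \<in> \<Inter>\<D>) \<and> mconv s A" for s A
      proof
        fix Y assume Y: "Y \<in> \<D>"
        then have "\<forall>s A. (\<forall>k. s k \<in> Y) \<and> mconv s A \<longrightarrow> A \<in> Y" using adm[OF Y] by (simp add: adm_def closed_inv_def)
        moreover have "\<forall>k. s k \<in> Y" using s Y by blast
        ultimately show "A \<in> Y" using s by blast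
      qed
    qed
    moreover have "\<Inter>\<D> \<subseteq> E" using adm[OF Y0] Y0 by (auto simp: adm_def)
    moreover have "\<forall>A\<in>\<Inter>\<D>. \<forall>t. upper_unip t ** A \<in> \<Inter>\<D>" using adm by (auto simp: adm_def)
    ultimately have "adm (\<Inter>\<D>)" by (simp add: adm_def)
    moreover have "\<Union>\<C> = - \<Inter>\<D>" by (auto simp: \<D>_def)
    ultimately show "\<Union>\<C> \<in> \<A>" by (auto simp: \<A>_def)
  qed
  then obtain Y where Y: "adm Y" "\<And>X. X \<in> \<A> \<Longrightarrow> - Y \<subseteq> X \<Longrightarrow> X = - Y" by (auto simp: \<A>_def)
  have "Z = Y" if "Z \<subseteq> Y" "adm Z" for Z using Y(2)[of "- Z"] that by (auto simp: \<A>_def)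
  moreover have "adm Z"
    if "Z \<subseteq> Y" "closed_inv Z \<and> Z \<noteq> {} \<and> (\<forall>A\<in>Z. \<forall>t. upper_unip t ** A \<in> Z)" for Z
    using that Y(1) by (auto simp: adm_def)
  ultimately have "\<forall>Z\<subseteq>Y. closed_inv Z \<and> Z \<noteq> {} \<and> (\<forall>A\<in>Z. \<forall>t. upper_unip t ** A \<in> Z) \<longrightarrow> Z = Y"
    by simp
  then show ?thesis using Y(1) unfolding adm_def by blast
qed

end

section \<open>Minimal sets for the unipotent flow\<close>

locale minimal_dynamics = orbit_dynamics K v D XX
  for K :: "'k::field set" and v :: "'k \<Rightarrow> int" and D :: 'k and XX :: "('k^3^3) set" +
  fixes \<epsilon> :: real and Y :: "('k^3^3) set"
  assumes eps: "0 < \<epsilon>" "\<And>A m. A \<in> XX \<Longrightarrow> integral m \<Longrightarrow> m \<noteq> 0 \<Longrightarrow> \<epsilon> \<le> vnorm (qform (normal_form 0) (A *v m))"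
    and Y: "closed_inv Y" "Y \<noteq> {}" "\<And>A t. A \<in> Y \<Longrightarrow> upper_unip t ** A \<in> Y"
    and minimal: "\<And>Z. Z \<subseteq> Y \<Longrightarrow> closed_inv Z \<Longrightarrow> Z \<noteq> {} \<Longrightarrow> (\<And>A t. A \<in> Z \<Longrightarrow> upper_unip t ** A \<in> Z) \<Longrightarrow> Z = Y"
begin

lemma Y_XX: "A \<in> Y \<Longrightarrow> A \<in> XX"
  using Y(1) by (auto simp: closed_inv_def)

lemma Y_\<Gamma>: "A \<in> Y \<Longrightarrow> \<gamma> \<in> \<Gamma> \<Longrightarrow> A ** \<gamma> \<in> Y"
  using Y(1) by (auto simp: closed_inv_def)

lemma Y_closed: "(\<And>k. s k \<in> Y) \<Longrightarrow> mconv s A \<Longrightarrow> A \<in> Y"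
  using Y(1) unfolding closed_inv_def by blast

lemma Y_det: "A \<in> Y \<Longrightarrow> det A \<noteq> 0"
  using det_XX[OF Y_XX] D by simp

lemma Y_compact:
  assumes "\<And>k::nat. s k \<in> Y"
  shows "\<exists>r \<gamma> L. strict_mono r \<and> (\<forall>k. \<gamma> k \<in> \<Gamma>) \<and> L \<in> Y \<and> mconv (\<lambda>k. s (r k) ** \<gamma> k) L"
proof -
  obtain r \<gamma> L where r: "strict_mono r" "\<And>k. \<gamma> k \<in> \<Gamma>" "mconv (\<lambda>k. s (r k) ** \<gamma> k) L"
    using XX_compact[of s] Y_XX[OF assms] by auto
  moreover have "L \<in> Y" using Y_closed[OF Y_\<Gamma>[OF assms r(2)] r(3)] .
  ultimately show ?thesis by blast
qed

text \<open>The bound is the same \<epsilon> for all points and forms, so that the condition passes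
  to limits.\<close>

definition bounded_below :: "'k^3^3 \<Rightarrow> 'k^3^3 \<Rightarrow> bool"
  where "bounded_below A M \<longleftrightarrow> (\<forall>m. integral m \<and> m \<noteq> 0 \<longrightarrow> \<epsilon> \<le> vnorm (qform M (A *v m)))"

lemma bounded_below_act: "bounded_below (g ** A) M \<longleftrightarrow> bounded_below A (act M g)"
  by (simp add: bounded_below_def qform_act matrix_vector_mul_assoc)

lemma bounded_below_\<Gamma>:
  assumes g: "\<gamma> \<in> \<Gamma>" and A: "bounded_below A M"
  shows "bounded_below (A ** \<gamma>) M"
  unfolding bounded_below_def
proof (intro allI impI)
  fix m assume m: "integral m \<and> m \<noteq> 0"
  have "\<gamma> *v m \<noteq> 0"
  proof
    assume "\<gamma> *v m = 0"
    then have "inv3 \<gamma> *v (\<gamma> *v m) = 0" by simp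
    then show False using m inv3(2)[of \<gamma>] SL3_det[OF g] by (simp add: matrix_vector_mul_assoc)
  qed
  then show "\<epsilon> \<le> vnorm (qform M ((A ** \<gamma>) *v m))"
    using A integral_\<Gamma>[OF g] m unfolding bounded_below_def by (simp add: matrix_vector_mul_assoc[symmetric])
qed

lemma bounded_below_limit:
  assumes "mconv s A" "mconv Ms M" "\<And>n. bounded_below (s n) (Ms n)"
  shows "bounded_below A M"
  unfolding bounded_below_def
proof (intro allI impI)
  fix m assume m: "integral m \<and> m \<noteq> 0"
  have "vconv (\<lambda>n. qform (Ms n) (s n *v m)) (qform M (A *v m))"
    unfolding qform_def by (intro vconv_sum vconv_mult mconvD[OF assms(2)] mconv_vec[OF assms(1)])
  then show "\<epsilon> \<le> vnorm (qform M (A *v m))"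
    by (rule vnorm_limit_ge) (use assms(3) m in \<open>simp add: bounded_below_def\<close>)
qed

lemma bounded_below_XX: "A \<in> XX \<Longrightarrow> bounded_below A (normal_form 0)"
  using eps(2) by (simp add: bounded_below_def)

text \<open>Since $Y$ is minimal, it does not matter for which of its points the form is bounded below.\<close>
definition CC :: "'k set"
  where "CC = {c. \<forall>A\<in>Y. bounded_below A (normal_form c)}"

text \<open>The points of Y at which \<open>normal_form c\<close> is bounded below form a closed
  set, invariant under \<open>upper_unip\<close> because this group fixes
  \<open>normal_form c\<close>. By minimality, one such point gives all of Y.\<close>

lemma CC_I:
  assumes "A \<in> Y" "bounded_below A (normal_form c)"
  shows "c \<in> CC"
proof -
  define Z where "Z = {A \<in> Y. bounded_below A (normal_form c)}"
  have "closed_inv Z"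
    unfolding closed_inv_def
  proof (intro conjI ballI allI impI)
    show "Z \<subseteq> XX" using Y_XX by (auto simp: Z_def)
    show "A ** \<gamma> \<in> Z" if "A \<in> Z" "\<gamma> \<in> \<Gamma>" for A \<gamma>
      using that Y_\<Gamma> bounded_below_\<Gamma> by (auto simp: Z_def)
    show "A \<in> Z" if s: "(\<forall>k. s k \<in> Z) \<and> mconv s A" for s A
    proof -
      have "A \<in> Y" by (rule Y_closed[of s]) (use s in \<open>auto simp: Z_def\<close>)
      moreover have "bounded_below A (normal_form c)"
        by (rule bounded_below_limit[of s A "\<lambda>n. normal_form c"]) (use s in \<open>auto simp: Z_def\<close>)
      ultimately show ?thesis by (simp add: Z_def)
    qed
  qed
  moreover have "upper_unip t ** A \<in> Z" if "A \<in> Z" for A t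
    using that Y(3) by (simp add: Z_def bounded_below_act act_upper_unip[OF two])
  moreover have "Z \<subseteq> Y" "Z \<noteq> {}" using assms by (auto simp: Z_def)
  ultimately have "Z = Y" by (intro minimal)
  then show ?thesis by (auto simp: CC_def Z_def)
qed

lemma CC_0: "0 \<in> CC"
  using bounded_below_XX[OF Y_XX] by (simp add: CC_def)

lemma CC_closed:
  assumes "\<And>n. c n \<in> CC" "vconv c L"
  shows "L \<in> CC"
proof -
  have "mconv (\<lambda>n. normal_form (c n)) (normal_form L)"
    using assms(2) by (simp add: mconv_def normal_form_def forall_3)
  then have "bounded_below A (normal_form L)" if "A \<in> Y" for A
    by (rule bounded_below_limit[OF mconv_const]) (use assms(1) that in \<open>auto simp: CC_def\<close>)
  then show ?thesis by (simp add: CC_def)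
qed

text \<open>Moving the base points by \<open>upper_unip (- t n)\<close> keeps them in Y and shears
  the forms by \<open>upper_unip (t n)\<close>. The times may tend to infinity: only the sheared
  forms have to converge, and the points do so modulo \<Gamma> along a subsequence.\<close>

lemma CC_transfer:
  assumes C: "\<And>n::nat. C n \<in> Y" "\<And>n. bounded_below (C n) (Ms n)"
    and lim: "mconv (\<lambda>n. act (Ms n) (upper_unip (t n))) (normal_form c)"
  shows "c \<in> CC"
proof -
  define s where "s n = upper_unip (- t n) ** C n" for n
  have "s n \<in> Y" for n using Y(3)[OF C(1)] by (simp add: s_def)
  then obtain r \<gamma> L where r: "strict_mono r" "\<And>k. \<gamma> k \<in> \<Gamma>" "L \<in> Y" "mconv (\<lambda>k. s (r k) ** \<gamma> k) L"
    using Y_compact[of s] by auto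
  have "bounded_below (s n) (act (Ms n) (upper_unip (t n)))" for n
    unfolding s_def bounded_below_act act_act upper_unip_add[OF two] using C(2)[of n]
    by (simp add: upper_unip_0 act_one)
  then have "bounded_below (s (r k) ** \<gamma> k) (act (Ms (r k)) (upper_unip (t (r k))))" for k
    by (rule bounded_below_\<Gamma>[OF r(2)])
  then have "bounded_below L (normal_form c)"
    using bounded_below_limit[OF r(4) mconv_subseq[OF lim r(1)]] by blast
  then show ?thesis using r(3) by (rule CC_I[rotated])
qed

definition entries_le :: "real \<Rightarrow> 'k^3^3 \<Rightarrow> bool"
  where "entries_le C M \<longleftrightarrow> (\<forall>i j. vnorm (M $ i $ j) \<le> C)"

lemma entries_le_mult:
  assumes "entries_le C M" "entries_le C' M'"
  shows "entries_le (C * C') (M ** M')"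
proof -
  have C: "0 \<le> C" using assms(1) vnorm_nonneg order_trans unfolding entries_le_def by blast
  have "vnorm (M $ i $ k * M' $ k $ j) \<le> C * C'" for i j k
    unfolding vnorm_mult using assms C by (intro mult_mono) (auto simp: entries_le_def)
  then show ?thesis unfolding entries_le_def mult3 by (intro allI vnorm_add_le)
qed

lemma mconv_bounded: "mconv s A \<Longrightarrow> \<exists>C. \<forall>n. entries_le C (s n)"
proof -
  assume "mconv s A"
  then have "\<forall>i j. \<exists>C>0. \<forall>n. vnorm (s n $ i $ j) \<le> C" using vconv_bounded[OF mconvD] by blast
  then obtain C where C: "\<And>i j. 0 < C i j" "\<And>i j n. vnorm (s n $ i $ j) \<le> C i j" by metis
  have nonneg: "0 \<le> C i j" for i j using C(1)[of i j] by simp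
  have "vnorm (s n $ i $ j) \<le> (\<Sum>i\<in>UNIV. \<Sum>j\<in>UNIV. C i j)" for n i j
  proof -
    have "C i j \<le> (\<Sum>j\<in>UNIV. C i j)"
      using nonneg by (intro member_le_sum) auto
    also have "\<dots> \<le> (\<Sum>i\<in>UNIV. \<Sum>j\<in>UNIV. C i j)"
      using nonneg by (intro member_le_sum) (auto intro: sum_nonneg)
    finally show ?thesis using C(2)[of n i j] by linarith
  qed
  then show ?thesis unfolding entries_le_def by blast
qed

section \<open>Unbounded \<nu>-integers and values of the form on lattice vectors\<close>

definition times :: "nat \<Rightarrow> 'k"
  where "times n = inverse unif ^ n"

lemma vnorm_times: "vnorm (times n) = 2 ^ n"
  by (simp add: times_def vnorm_power vnorm_inverse)

text \<open>If all \<nu>-integers had norm at most 1, \<Gamma> would be bounded. Then so would be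
  the matrices \<open>upper_unip (times (r k))\<close>, which can be recovered from a convergent
  sequence in Y by undoing the correction in \<Gamma>.\<close>

lemma \<O>_unbounded: "\<exists>T\<in>\<O>. 1 < vnorm T"
proof (rule ccontr)
  assume "\<not> ?thesis"
  then have \<O>_le: "vnorm x \<le> 1" if "x \<in> \<O>" for x using that by force
  obtain A where A: "A \<in> Y" using Y(2) by blast
  obtain r \<gamma> L where r: "strict_mono r" "\<And>k. \<gamma> k \<in> \<Gamma>"
    "mconv (\<lambda>k. (upper_unip (times (r k)) ** A) ** \<gamma> k) L"
    using Y_compact[of "\<lambda>k. upper_unip (times k) ** A"] Y(3)[OF A] by auto
  obtain C where C: "\<And>k. entries_le C ((upper_unip (times (r k)) ** A) ** \<gamma> k)"
    using mconv_bounded[OF r(3)] by blast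
  obtain C' where C': "entries_le C' (inv3 A)" using mconv_bounded[OF mconv_const] by blast
  have "2 ^ r k \<le> C * 1 * C'" for k
  proof -
    have "entries_le 1 (inv3 (\<gamma> k))" using \<O>_le \<Gamma>_inv3[OF r(2)] by (simp add: entries_le_def SL3_def)
    then have "entries_le (C * 1 * C') (((upper_unip (times (r k)) ** A) ** \<gamma> k) ** inv3 (\<gamma> k) ** inv3 A)"
      by (intro entries_le_mult C C')
    moreover have "det (\<gamma> k) \<noteq> 0" using SL3_det[OF r(2)] by simp
    ultimately have "entries_le (C * 1 * C') (upper_unip (times (r k)))"
      using Y_det[OF A] by (simp add: inv3_cancel(3))
    then have "vnorm (upper_unip (times (r k)) $ 1 $ 2) \<le> C * 1 * C'" unfolding entries_le_def by blast
    then show ?thesis by (simp add: upper_unip_def vnorm_times)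
  qed
  moreover obtain n where "C * 1 * C' < 2 ^ n" using real_arch_pow[of 2 "C * 1 * C'"] by auto
  moreover have "(2::real) ^ n \<le> 2 ^ r n" using seq_suble[OF r(1), of n] by (intro power_increasing) auto
  ultimately show False by (meson linorder_not_less order_trans)
qed

text \<open>The vectors on which the form and the square of the last coordinate are in approximately
  prescribed ratio form an open cone, which contains lattice points because the lattice is cocompact.\<close>
lemma ex_lattice_vector_ratio:
  assumes A: "det A \<noteq> 0" and d: "0 < d"
  shows "\<exists>m. integral m \<and> (A *v m) $ 3 \<noteq> 0 \<and>
    vnorm (qform (normal_form 0) (A *v m) / ((A *v m) $ 3 * (A *v m) $ 3) - l) < d"
proof -
  obtain C where C: "\<And>x. \<exists>y\<in>\<O>. vnorm (x - y) \<le> C" using \<O>_unbounded \<O>_cocompact by metis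
  \<comment> \<open>The form takes the value l at \<open>w0\<close>, whose last coordinate is 1. The
    ratio is invariant under scaling, so lattice vectors near large multiples of p nearly attain
    it.\<close>
  define w0 :: "'k^3" where "w0 = vector [- l / 2, 0, 1]"
  define p where "p = inv3 A *v w0"
  have Ap: "A *v p = w0" unfolding p_def by (simp add: matrix_vector_mul_assoc inv3[OF A])
  have "\<exists>m. integral m \<and> (\<forall>i. vnorm (times n * p $ i - m $ i) \<le> C)" for n
  proof -
    have "\<forall>i. \<exists>y. y \<in> \<O> \<and> vnorm (times n * p $ i - y) \<le> C" using C by blast
    then obtain f where "\<forall>i. f i \<in> \<O> \<and> vnorm (times n * p $ i - f i) \<le> C" by metis
    then show ?thesis by (intro exI[of _ "\<chi> i. f i"]) simp
  qed
  then obtain m where m: "\<And>n. integral (m n)" "\<And>n i. vnorm (times n * p $ i - m n $ i) \<le> C" by metis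
  define x where "x n i = unif ^ n * (A *v m n) $ i" for n i
  have ut: "unif ^ n * times n = 1" for n by (simp add: times_def power_inverse)
  have "vconv (\<lambda>n. unif ^ n * m n $ i) (p $ i)" for i
  proof -
    have "vconv (\<lambda>n. unif ^ n * (times n * p $ i - m n $ i)) 0"
      using m(2) by (intro vconv_mult_0[OF vconv_unif_power])
    then have "vconv (\<lambda>n. p $ i - unif ^ n * (times n * p $ i - m n $ i)) (p $ i - 0)"
      by (intro vconv_diff vconv_const)
    moreover have "p $ i - unif ^ n * (times n * p $ i - m n $ i) = unif ^ n * m n $ i" for n
      using ut[of n] by (simp add: right_diff_distrib flip: mult.assoc)
    ultimately show ?thesis by simp
  qed
  then have "vconv (\<lambda>n. A$i$1 * (unif ^ n * m n $ 1) + A$i$2 * (unif ^ n * m n $ 2) + A$i$3 * (unif ^ n * m n $ 3))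
    ((A *v p) $ i)" for i
    unfolding vmult3 by (intro vconv_add vconv_mult vconv_const)
  then have x: "vconv (\<lambda>n. x n i) (w0 $ i)" for i
    unfolding Ap x_def vmult3 by (simp add: algebra_simps)
  have "vconv (\<lambda>n. (x n 2 * x n 2 - 2 * x n 1 * x n 3) / (x n 3 * x n 3))
    ((w0$2 * w0$2 - 2 * w0$1 * w0$3) / (w0$3 * w0$3))"
    by (intro vconv_divide vconv_diff vconv_mult vconv_const x) (simp add: w0_def)
  also have "(w0$2 * w0$2 - 2 * w0$1 * w0$3) / (w0$3 * w0$3) = l" using two by (simp add: w0_def)
  finally have "\<forall>\<^sub>F n in sequentially. vnorm ((x n 2 * x n 2 - 2 * x n 1 * x n 3) / (x n 3 * x n 3) - l) < d"
    using d unfolding vconv_iff by blast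
  moreover have "\<forall>\<^sub>F n in sequentially. x n 3 \<noteq> 0" using vconv_nz[OF x[of 3]] by (simp add: w0_def)
  ultimately have "\<forall>\<^sub>F n in sequentially. x n 3 \<noteq> 0 \<and>
     vnorm ((x n 2 * x n 2 - 2 * x n 1 * x n 3) / (x n 3 * x n 3) - l) < d"
    by (simp add: eventually_conj)
  then obtain n where n: "x n 3 \<noteq> 0"
     "vnorm ((x n 2 * x n 2 - 2 * x n 1 * x n 3) / (x n 3 * x n 3) - l) < d"
    by (auto simp: eventually_sequentially)
  have "(x n 2 * x n 2 - 2 * x n 1 * x n 3) / (x n 3 * x n 3)
      = qform (normal_form 0) (A *v m n) / ((A *v m n) $ 3 * (A *v m n) $ 3)"
    using n(1) by (simp add: qform_normal x_def field_simps)
  then show ?thesis using n m(1) by (intro exI[of _ "m n"]) (auto simp: x_def)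
qed

text \<open>By Hensel the values of - A / B fill a neighbourhood of \<open>l0\<close>, so they
  include the ratio l of the form to z^2 at some lattice vector; there
  \<open>normal_form (- l)\<close> vanishes, against the lower bound. In positive characteristic a
  vanishing derivative leaves more than constants, which is why characteristic 3 is special.\<close>

lemma quotient_in_CC_constant:
  assumes AB: "\<And>t. poly B t \<noteq> 0 \<Longrightarrow> poly A t / poly B t \<in> CC"
  shows "pderiv A * B = A * pderiv B"
proof (rule ccontr)
  assume "pderiv A * B \<noteq> A * pderiv B"
  \<comment> \<open>With the extra factor B, one nonroot serves both conditions.\<close>
  then have "(pderiv A * B - A * pderiv B) * B \<noteq> 0" by auto
  then obtain t0 where "poly ((pderiv A * B - A * pderiv B) * B) t0 \<noteq> 0" using poly_nonroot by blast
  then have t0: "poly (pderiv A) t0 * poly B t0 - poly A t0 * poly (pderiv B) t0 \<noteq> 0" "poly B t0 \<noteq> 0"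
    by auto
  define l0 where "l0 = - (poly A t0 / poly B t0)"
  have "\<exists>d>0. \<forall>l. vnorm (l - l0) < d \<longrightarrow> (\<exists>t. poly A t + l * poly B t = 0 \<and> poly B t \<noteq> 0)"
    using t0 by (intro hensel_family[of A t0]) (auto simp: l0_def field_simps)
  then obtain d where d: "0 < d" "\<And>l. vnorm (l - l0) < d \<Longrightarrow> \<exists>t. poly A t + l * poly B t = 0 \<and> poly B t \<noteq> 0"
    by blast
  obtain C where C: "C \<in> Y" using Y(2) by blast
  obtain m where m: "integral m" "(C *v m) $ 3 \<noteq> 0"
    "vnorm (qform (normal_form 0) (C *v m) / ((C *v m) $ 3 * (C *v m) $ 3) - l0) < d"
    using ex_lattice_vector_ratio[OF Y_det[OF C] d(1)] by blast
  define l where "l = qform (normal_form 0) (C *v m) / ((C *v m) $ 3 * (C *v m) $ 3)"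
  obtain t where t: "poly A t + l * poly B t = 0" "poly B t \<noteq> 0"
    using d(2)[OF m(3), folded l_def] by blast
  define c where "c = poly A t / poly B t"
  have "poly A t = - l * poly B t" using t(1) by (simp add: eq_neg_iff_add_eq_0)
  then have c: "c = - l" using t(2) by (simp add: c_def)
  have "qform (normal_form c) (C *v m) = qform (normal_form 0) (C *v m) + c * ((C *v m) $ 3 * (C *v m) $ 3)"
    by (simp add: qform_normal)
  then have "qform (normal_form c) (C *v m) = 0" using m(2) by (simp add: c l_def)
  moreover have "c \<in> CC" using AB[OF t(2)] by (simp add: c_def)
  moreover have "m \<noteq> 0" using m(2) by auto
  ultimately have "\<epsilon> \<le> 0" using m(1) C by (force simp: CC_def bounded_below_def)
  then show False using eps(1) by simp
qed

text \<open>These are the displacements for which all quantities rescaled in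
  \<open>contradiction\<close> vanish: the pulled back form is fixed by the flow, and no lower
  unipotent factor is present. \<open>recurrence\<close> has to avoid them.\<close>

definition unipotent_type :: "'k^3^3 \<Rightarrow> bool"
  where "unipotent_type g \<longleftrightarrow> act (normal_form 0) g $ 1 $ 1 = 0 \<and> act (normal_form 0) g $ 1 $ 2 = 0 \<and>
    act (normal_form 0) g $ 2 $ 3 = 0 \<and> act (normal_form 0) g $ 1 $ 3 + act (normal_form 0) g $ 2 $ 2 = 0 \<and>
    g $ 3 $ 1 = 0 \<and> g $ 3 $ 2 = 0"

lemma trace_conj: "det (A :: 'k^3^3) \<noteq> 0 \<Longrightarrow> trace (A ** M ** inv3 A) = trace M"
  by (subst trace_mul_sym) (simp add: matrix_mul_assoc inv3)

lemma trace_3_eq: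
  assumes s: "\<sigma> \<in> \<Gamma>" and "vnorm (trace \<sigma> - 3) < 1"
  shows "trace \<sigma> = 3"
proof -
  have "\<sigma> $ i $ i \<in> \<O>" for i using s by (simp add: SL3_def)
  moreover have "1 + 1 + 1 \<in> \<O>" by (intro nu_integers_closed[OF K])
  moreover have "1 + 1 + 1 = (3 :: 'k)" by simp
  ultimately have "trace \<sigma> - 3 \<in> \<O>" unfolding trace_3 by (metis nu_integers_closed(3,5)[OF K])
  then have "trace \<sigma> - 3 = 0" using assms(2) by (rule \<O>_discrete)
  then show ?thesis by simp
qed

lemma unipotent_typeD:
  assumes g: "unipotent_type g" "det g = 1"
  shows "g$2$1 = 0" "g$3$1 = 0" "g$3$2 = 0" "g$1$1 * g$2$2 * g$3$3 = 1" "g$2$2 * g$2$3 = g$1$2 * g$3$3"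
proof -
  show 3: "g$3$1 = 0" "g$3$2 = 0" using g(1) by (auto simp: unipotent_type_def)
  show 2: "g$2$1 = 0" using g(1) 3 by (simp add: unipotent_type_def act_normal)
  show "g$2$2 * g$2$3 = g$1$2 * g$3$3" using g(1) 3 by (simp add: unipotent_type_def act_normal)
  show "g$1$1 * g$2$2 * g$3$3 = 1" using g(2) 2 3 by (simp add: det_3)
qed

text \<open>No point of $Y$ has a nontrivial stabiliser in the upper triangular unipotent group,
  as the torus would contract it.\<close>
lemma no_unipotent_stabilizer:
  assumes A: "A \<in> Y" and s: "\<sigma> \<in> \<Gamma>" and e: "A ** \<sigma> = \<eta> ** A"
    and \<eta>: "\<eta> = vector [vector [1, x, y], vector [0, 1, x], vector [0, 0, 1]]"
  shows "x = 0"
proof -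
  \<comment> \<open>Conjugation by these elements shrinks the entries of \<eta> above the diagonal,
    while \<open>a n ** A\<close> stays in the compact set. Hence some conjugate of \<sigma> in
    \<Gamma> is so close to 1 that it equals 1.\<close>
  define a where "a n = torus (times n)" for n
  have tnz: "times n \<noteq> 0" for n by (simp add: times_def)
  have SOa: "SO (a n)" for n using tnz by (simp add: a_def SO_torus)
  have aXX: "a n ** A \<in> XX" for n using XX_SO[OF Y_XX[OF A] SOa] .
  then obtain r \<gamma> L where r: "strict_mono r" "\<And>k. \<gamma> k \<in> \<Gamma>" "L \<in> XX" "mconv (\<lambda>k. (a (r k) ** A) ** \<gamma> k) L"
    using XX_compact[of "\<lambda>n. a n ** A"] by auto
  define F where "F k = (a (r k) ** A) ** \<gamma> k" for k
  have dF: "det (F k) \<noteq> 0" for k using det_XX[OF XX_\<Gamma>[OF aXX r(2)]] D by (simp add: F_def)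
  have dL: "det L \<noteq> 0" using det_XX[OF r(3)] D by simp
  have d\<gamma>: "det (\<gamma> k) \<noteq> 0" for k using SL3_det[OF r(2)] by simp
  have da: "det (a n) \<noteq> 0" for n using SOa by (simp add: SO_def)
  define N :: "nat \<Rightarrow> 'k^3^3" where "N n = vector [vector [1, unif ^ n * x, unif ^ n * unif ^ n * y],
    vector [0, 1, unif ^ n * x], vector [0, 0, 1]]" for n
  have aN: "a n ** \<eta> = N n ** a n" for n
    unfolding a_def N_def \<eta>
    by (rule mat3_eqI; simp add: mult3 torus_def times_def power_inverse field_simps)
  have "mconv N (mat 1)"
  proof -
    have "vconv (\<lambda>n. unif ^ n * x) (0 * x)" "vconv (\<lambda>n. unif ^ n * unif ^ n * y) (0 * 0 * y)"
      by (intro vconv_mult vconv_unif_power vconv_const)+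
    then show ?thesis by (simp add: mconv_def N_def mat_def forall_3)
  qed
  then have "mconv (\<lambda>k. inv3 (F k) ** N (r k) ** F k) (inv3 L ** mat 1 ** L)"
    using mconv_subseq[OF _ r(1)] mconv_inv3[OF r(4) dL] r(4) unfolding F_def by (intro mconv_mult) auto
  then have "mconv (\<lambda>k. inv3 (F k) ** N (r k) ** F k) (mat 1)" by (simp add: inv3[OF dL])
  then have "\<forall>\<^sub>F k in sequentially. near 0 (mat 1) (inv3 (F k) ** N (r k) ** F k)" by (rule mconv_near)
  then obtain k where k: "near 0 (mat 1) (inv3 (F k) ** N (r k) ** F k)" by (auto simp: eventually_sequentially)
  have "N (r k) ** F k = F k ** (inv3 (\<gamma> k) ** \<sigma> ** \<gamma> k)"
  proof -
    have "N (r k) ** F k = (a (r k) ** (\<eta> ** A)) ** \<gamma> k"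
      by (simp add: F_def aN[symmetric] matrix_mul_assoc)
    also have "\<dots> = a (r k) ** A ** \<sigma> ** \<gamma> k" by (simp add: e[symmetric] matrix_mul_assoc)
    also have "\<dots> = F k ** (inv3 (\<gamma> k) ** \<sigma> ** \<gamma> k)"
      by (simp add: F_def matrix_mul_assoc inv3_cancel(3)[OF d\<gamma>])
    finally show ?thesis .
  qed
  then have eq: "inv3 (F k) ** N (r k) ** F k = inv3 (\<gamma> k) ** \<sigma> ** \<gamma> k"
    by (simp add: inv3_cancel(2)[OF dF] flip: matrix_mul_assoc)
  have "inv3 (\<gamma> k) ** \<sigma> ** \<gamma> k = mat 1"
    using k unfolding eq by (intro \<Gamma>_discrete \<Gamma>_mult \<Gamma>_inv3 r(2) s)
  then have "inv3 (F k) ** (N (r k) ** F k) = mat 1" by (simp add: eq matrix_mul_assoc)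
  then have "N (r k) ** F k = F k" using inv3_cancel(1)[OF dF, of k "N (r k) ** F k"] by simp
  then have "N (r k) = mat 1" using inv3_cancel(3)[OF dF, of "N (r k)" k] inv3(1)[OF dF] by metis
  then have "N (r k) $ 1 $ 2 = (mat 1 :: 'k^3^3) $ 1 $ 2" by simp
  then show ?thesis by (simp add: N_def mat_one_3)
qed

text \<open>Recurrence in $Y$ along the upper unipotent group. A return whose displacement is of
  unipotent type would, by discreteness of traces, come from a unipotent stabiliser.\<close>
lemma recurrence:
  "\<exists>C g. (\<forall>n::nat. C n \<in> Y \<and> g n ** C n \<in> Y \<and> det (g n) = 1 \<and> \<not> unipotent_type (g n)) \<and> mconv g (mat 1)"
proof -
  obtain A where A: "A \<in> Y" using Y(2) by blast
  obtain r \<gamma> L where r: "strict_mono r" "\<And>k. \<gamma> k \<in> \<Gamma>" "L \<in> Y"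
    "mconv (\<lambda>k. (upper_unip (times (r k)) ** A) ** \<gamma> k) L"
    using Y_compact[of "\<lambda>k. upper_unip (times k) ** A"] Y(3)[OF A] by auto
  define C where "C k = (upper_unip (times (r k)) ** A) ** \<gamma> k" for k
  have CY: "C k \<in> Y" for k unfolding C_def by (rule Y_\<Gamma>[OF Y(3)[OF A] r(2)])
  have dC: "det (C k) = D" "det (C k) \<noteq> 0" for k using det_XX[OF Y_XX[OF CY]] D by auto
  have dL: "det L \<noteq> 0" by (rule Y_det[OF r(3)])
  have CL: "mconv C L" using r(4) by (simp add: C_def[abs_def])
  define g where "g k = C (Suc k) ** inv3 (C k)" for k
  have gC: "g k ** C k = C (Suc k)" for k by (simp add: g_def inv3_cancel(4)[OF dC(2)])
  have dg: "det (g k) = 1" for k using D by (simp add: g_def det_mul det_inv3 dC)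
  have "mconv g (L ** inv3 L)" unfolding g_def by (intro mconv_mult mconv_Suc mconv_inv3 CL dL)
  then have g1: "mconv g (mat 1)" by (simp add: inv3[OF dL])
  have "vconv (\<lambda>k. trace (g k)) (trace (mat 1 :: 'k^3^3))"
    unfolding trace_3 by (intro vconv_add mconvD[OF g1])
  then have tr: "\<forall>\<^sub>F k in sequentially. vnorm (trace (g k) - 3) < 1"
    unfolding vconv_iff by (auto simp: trace_3 mat_one_3 dest: spec[of _ 1])
  have "mconv (\<lambda>k. inv3 (g k)) (inv3 (mat 1))" by (intro mconv_inv3 g1) simp
  moreover have "inv3 (mat 1) = (mat 1 :: 'k^3^3)" by (rule inv3_unique) auto
  ultimately have "mconv (\<lambda>k. inv3 (g k)) (mat 1)" by simp
  then have "vconv (\<lambda>k. trace (inv3 (g k))) (trace (mat 1 :: 'k^3^3))"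
    unfolding trace_3 by (intro vconv_add mconvD)
  then have tr': "\<forall>\<^sub>F k in sequentially. vnorm (trace (inv3 (g k)) - 3) < 1"
    unfolding vconv_iff by (auto simp: trace_3 mat_one_3 dest: spec[of _ 1])
  have nr: "\<forall>\<^sub>F k in sequentially. near 0 (mat 1) (g k)" using g1 by (rule mconv_near)
  have "\<forall>\<^sub>F k in sequentially. \<not> unipotent_type (g k)"
    using tr tr' nr
  proof eventually_elim
    case (elim k)
    show ?case
    proof
      assume u: "unipotent_type (g k)"
      define h where "h = g k"
      note hD = unipotent_typeD[OF u dg, folded h_def]
      define t t' where "t = times (r k)" and "t' = times (r (Suc k))"
      \<comment> \<open>The displacement h transported back to A along the flow. There it is
        conjugate to \<sigma> in \<Gamma>, so its trace and the trace of its inverse are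
        \<nu>-integers; for upper triangular h they agree with those of h.\<close>
      define \<eta> where "\<eta> = upper_unip (- t') ** h ** upper_unip t"
      define \<sigma> where "\<sigma> = \<gamma> (Suc k) ** inv3 (\<gamma> k)"
      have s: "\<sigma> \<in> \<Gamma>" unfolding \<sigma>_def by (intro \<Gamma>_mult \<Gamma>_inv3 r(2))
      have d\<gamma>: "det (\<gamma> k) \<noteq> 0" using SL3_det[OF r(2)] by simp
      have "A ** \<sigma> = \<eta> ** A"
      proof -
        have "\<eta> ** A ** \<gamma> k = upper_unip (- t') ** (h ** C k)"
          by (simp add: \<eta>_def C_def t_def matrix_mul_assoc)
        also have "\<dots> = (upper_unip (- t') ** upper_unip t') ** A ** \<gamma> (Suc k)"
          unfolding h_def gC by (simp add: C_def t'_def matrix_mul_assoc)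
        also have "\<dots> = A ** \<gamma> (Suc k)" by (simp add: upper_unip_add[OF two] upper_unip_0)
        finally have "\<eta> ** A ** \<gamma> k ** inv3 (\<gamma> k) = A ** \<gamma> (Suc k) ** inv3 (\<gamma> k)" by simp
        then show ?thesis by (simp add: inv3_cancel(3)[OF d\<gamma>] \<sigma>_def matrix_mul_assoc)
      qed
      then have \<eta>\<sigma>: "\<eta> = A ** \<sigma> ** inv3 A" by (simp add: inv3_cancel(3)[OF Y_det[OF A]])
      have d\<sigma>: "det \<sigma> = 1" using s by (rule SL3_det)
      have d\<eta>: "det \<eta> = 1" by (simp add: \<eta>_def det_mul dg h_def)
      have tr\<eta>: "trace \<eta> = trace \<sigma>" unfolding \<eta>\<sigma> by (rule trace_conj[OF Y_det[OF A]])
      have "inv3 \<eta> = A ** inv3 \<sigma> ** inv3 A"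
        using Y_det[OF A] d\<sigma> unfolding \<eta>\<sigma>
        by (simp add: inv3_mult inv3_inv3 det_mul det_inv3 matrix_mul_assoc)
      then have tr\<eta>': "trace (inv3 \<eta>) = trace (inv3 \<sigma>)" by (simp add: trace_conj[OF Y_det[OF A]])
      have "trace \<eta> = trace h"
        by (simp add: trace_3 \<eta>_def mult3 upper_unip_def hD)
      then have e1: "trace h = 3" using trace_3_eq[OF s] elim(1) tr\<eta> by (simp add: h_def)
      have "trace (inv3 \<eta>) = trace (inv3 h)"
        unfolding inv3_det1[OF d\<eta>] unfolding inv3_det1[OF dg[of k, folded h_def]]
        by (simp add: trace_3 adj3_def \<eta>_def mult3 upper_unip_def hD)
      then have "trace (inv3 h) = 3" using trace_3_eq[OF \<Gamma>_inv3[OF s]] elim(2) tr\<eta>' by (simp add: h_def)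
      then have e2: "h$2$2 * h$3$3 + h$1$1 * h$3$3 + h$1$1 * h$2$2 = 3"
        unfolding inv3_det1[OF dg[of k, folded h_def]] by (simp add: trace_3 adj3_def hD)
      \<comment> \<open>The diagonal entries of h are the roots of its characteristic polynomial,
        whose coefficients are now those of (x - 1)^3.\<close>
      have cube: "x = 1" if x: "(x - h$1$1) * (x - h$2$2) * (x - h$3$3) = 0" for x
      proof -
        have "(x - h$1$1) * (x - h$2$2) * (x - h$3$3) = x ^ 3 - trace h * x ^ 2
           + (h$2$2 * h$3$3 + h$1$1 * h$3$3 + h$1$1 * h$2$2) * x - h$1$1 * h$2$2 * h$3$3"
          by (simp add: trace_3 power2_eq_square power3_eq_cube algebra_simps)
        also have "\<dots> = (x - 1) ^ 3"
          unfolding e1 e2 hD(4) by (simp add: power2_eq_square power3_eq_cube algebra_simps)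
        finally show ?thesis using x by simp
      qed
      have diag: "h$1$1 = 1" "h$2$2 = 1" "h$3$3 = 1" by (rule cube; simp)+
      have h23: "h$2$3 = h$1$2" using hD(5) by (simp add: diag)
      have "\<eta> = vector [vector [1, \<eta>$1$2, \<eta>$1$3], vector [0, 1, \<eta>$1$2], vector [0, 0, 1]]"
        by (rule mat3_eqI; simp add: \<eta>_def mult3 upper_unip_def hD diag h23)
      then have "\<eta>$1$2 = 0" using no_unipotent_stabilizer[OF A s \<open>A ** \<sigma> = \<eta> ** A\<close>] by blast
      \<comment> \<open>The two flow times would differ by the small entry \<open>h$1$2\<close>,
        although \<open>t'\<close> has larger norm than t and norm at least 1.\<close>
      then have "t + (h$1$2 - t') = 0" by (simp add: \<eta>_def mult3 upper_unip_def hD diag)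
      then have "h$1$2 = t' - t" by algebra
      moreover have "vnorm (h$1$2 - (mat 1 :: 'k^3^3) $ 1 $ 2) < 1"
        using elim(3) unfolding near_def mem_vball h_def by (metis minus_zero power_int_0_right)
      then have "vnorm (h$1$2) < 1" by (simp add: mat_one_3)
      moreover have "vnorm (t' - t) = vnorm t'"
      proof -
        have "(2::real) ^ r k < 2 ^ r (Suc k)"
          using r(1) by (intro power_strict_increasing) (auto simp: strict_mono_Suc_iff)
        then show ?thesis using vnorm_add_eq[of "- t" t'] by (simp add: t_def t'_def vnorm_times)
      qed
      moreover have "1 \<le> vnorm t'" by (simp add: t'_def vnorm_times)
      ultimately show False by simp
    qed
  qed
  then obtain N where N: "\<And>k. N \<le> k \<Longrightarrow> \<not> unipotent_type (g k)" by (auto simp: eventually_sequentially)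
  have "mconv (\<lambda>k. g (N + k)) (mat 1)"
    using mconv_subseq[OF g1, of "\<lambda>k. N + k"] by (simp add: strict_mono_def)
  then show ?thesis using CY dg N gC
    by (intro exI[of _ "\<lambda>k. C (N + k)"] exI[of _ "\<lambda>k. g (N + k)"]) auto
qed

end

section \<open>Limits of nearby forms under the flow\<close>

definition sym3 :: "'k \<Rightarrow> 'k \<Rightarrow> 'k \<Rightarrow> 'k \<Rightarrow> 'k \<Rightarrow> 'k \<Rightarrow> 'k::field^3^3"
  where "sym3 a b c d e f = vector [vector [a, b, d], vector [b, c, e], vector [d, e, f]]"

text \<open>Each of a, b, c + d and e enters the lower right entry with its highest power of t,
  namely 4, 3, 2 and 1. These are the weights for rescaling, and they make the lower right entry the
  last one to survive.\<close>

lemma act_sym3: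
  assumes "(2 :: 'k::field) \<noteq> 0"
  shows "act (sym3 a b c d e f) (upper_unip (t :: 'k)) = sym3 a (a * t + b) (a * t^2 + 2 * b * t + c)
    (a * t^2 / 2 + b * t + d) (a * t^3 / 2 + 3 * b * t^2 / 2 + (c + d) * t + e)
    (a * t^4 / 4 + b * t^3 + (c + d) * t^2 + 2 * e * t + f)"
proof -
  have four: "(4 :: 'k) \<noteq> 0"
  proof -
    have "(4 :: 'k) = 2 * 2" by simp
    then show ?thesis using assms by (metis mult_eq_0_iff)
  qed
  \<comment> \<open>Naming t^2 / 2 makes the identity polynomial, with no division left.\<close>
  define h where "h = t * t / 2"
  have tt: "t * t = 2 * h" using assms by (simp add: h_def)
  have U: "upper_unip t = vector [vector [1, t, h], vector [0, 1, t], vector [0, 0, 1]]"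
    by (simp add: upper_unip_def h_def)
  have 1: "a * t^2 / 2 = a * h" "a * t^3 / 2 = a * h * t" "3 * b * t^2 / 2 = 3 * b * h"
    using assms by (simp_all add: h_def field_simps eval_nat_numeral)
  have 2: "a * t^4 / 4 = a * (h * h)" using assms four by (simp add: h_def field_simps eval_nat_numeral)
  show ?thesis
    unfolding U 1 2
    by (rule mat3_eqI; simp add: act_def mult3 transpose_def sym3_def;
        ((simp add: algebra_simps power2_eq_square; fail) | (use tt in algebra)))
qed

text \<open>With \<open>g $ 3 $ 2 = 0\<close> the pullback of s z^2 does not involve y, so s changes
  only the entries with both indices different from 2.\<close>

lemma act_normal_sym3:
  fixes g :: "'k::field^3^3"
  assumes "g $ 3 $ 2 = 0" and q: "q = act (normal_form 0) g"
  shows "act (normal_form s) g = sym3 (q$1$1 + s * (g$3$1)^2) (q$1$2) (q$2$2) (q$1$3 + s * g$3$1 * g$3$3) (q$2$3)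
    (q$3$3 + s * (g$3$3)^2)"
  unfolding q by (rule mat3_eqI; simp add: act_normal sym3_def assms(1) power2_eq_square algebra_simps)

text \<open>The last row of \<open>g\<close> is isotropic for the dual of the form \<open>q\<close>.\<close>
lemma dual_isotropic:
  fixes g :: "'k::field^3^3"
  assumes "g $ 3 $ 2 = 0" and q: "q = act (normal_form 0) g"
  shows "(g$3$3)^2 * (q$1$1 * q$2$2 - (q$1$2)^2)
    + g$3$1 * (2 * g$3$3 * (q$1$2 * q$2$3 - q$2$2 * q$1$3) + g$3$1 * (q$2$2 * q$3$3 - (q$2$3)^2)) = 0"
  unfolding q by (simp add: act_normal assms(1) power2_eq_square algebra_simps)

lemma det_act_normal: "det (act (normal_form c) g) = - ((det g)^2)"
  by (simp add: act_def det_mul det_3[of "normal_form c"]) (simp add: normal_form_def power2_eq_square)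

context discrete_valued_field
begin

lemma mconv_act: "mconv Ms M \<Longrightarrow> mconv h H \<Longrightarrow> mconv (\<lambda>n. act (Ms n) (h n)) (act M H)"
  unfolding act_def by (intro mconv_mult mconv_transpose)

lemma mconv_cong: "\<forall>\<^sub>F n in sequentially. s n = s' n \<Longrightarrow> mconv s L \<Longrightarrow> mconv s' L"
  unfolding mconv_def
proof (intro allI)
  fix i j
  assume ev: "\<forall>\<^sub>F n in sequentially. s n = s' n" and s: "\<forall>i j. vconv (\<lambda>n. s n $ i $ j) (L $ i $ j)"
  have "\<forall>\<^sub>F n in sequentially. s n $ i $ j = s' n $ i $ j" using ev by eventually_elim simp
  then show "vconv (\<lambda>n. s' n $ i $ j) (L $ i $ j)"
    using s by (auto intro: iffD1[OF vconv_cong])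
qed

lemma mconv_sym3:
  "vconv a a' \<Longrightarrow> vconv b b' \<Longrightarrow> vconv c c' \<Longrightarrow> vconv d d' \<Longrightarrow> vconv e e' \<Longrightarrow> vconv f f' \<Longrightarrow>
   mconv (\<lambda>n. sym3 (a n) (b n) (c n) (d n) (e n) (f n)) (sym3 a' b' c' d' e' f')"
  by (simp add: mconv_def sym3_def forall_3)

lemma vconv_eq: "vconv a L \<Longrightarrow> (\<And>n. a n = b n) \<Longrightarrow> L = M \<Longrightarrow> vconv b M"
  by (metis ext)

text \<open>If B stayed away from 0, the ultrametric inequality would give the two factors the norms
  of B and B^2, and their product could not be small.\<close>

lemma vconv_cubic:
  assumes e1: "vconv e1 0" and e2: "vconv e2 0" and prod: "vconv (\<lambda>n. (e1 n - B n) * ((B n)^2 - e2 n)) 0"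
  shows "vconv B 0"
  unfolding vconv_iff
proof (intro allI impI)
  fix d :: real assume d: "0 < d"
  have "\<forall>\<^sub>F n in sequentially. vnorm (e1 n - 0) < d" using e1 d unfolding vconv_iff by blast
  moreover have "\<forall>\<^sub>F n in sequentially. vnorm (e2 n - 0) < d ^ 2" using e2 d unfolding vconv_iff by simp
  moreover have "\<forall>\<^sub>F n in sequentially. vnorm ((e1 n - B n) * ((B n)^2 - e2 n) - 0) < d ^ 3"
    using prod d unfolding vconv_iff by simp
  ultimately show "\<forall>\<^sub>F n in sequentially. vnorm (B n - 0) < d"
  proof eventually_elim
    case (elim n)
    show ?case
    proof (rule ccontr)
      assume "\<not> vnorm (B n - 0) < d"
      then have B: "d \<le> vnorm (B n)" by simp
      then have B2: "d ^ 2 \<le> vnorm ((B n)^2)" using d by (simp add: vnorm_power power_mono)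
      have "vnorm (e1 n - B n) = vnorm (B n)"
        using vnorm_add_eq[of "e1 n" "- B n"] elim(1) B by simp
      moreover have "vnorm ((B n)^2 - e2 n) = vnorm ((B n)^2)"
        using vnorm_add_eq[of "- e2 n" "(B n)^2"] elim(2) B2 by simp
      ultimately have "vnorm ((e1 n - B n) * ((B n)^2 - e2 n)) = vnorm (B n) ^ 3"
        by (simp add: vnorm_mult vnorm_power power2_eq_square power3_eq_cube)
      moreover have "d ^ 3 \<le> vnorm (B n) ^ 3" using B d by (intro power_mono) auto
      ultimately show False using elim(3) by simp
    qed
  qed
qed

text \<open>The powers of \<tau> that survive in the lower right entry. Degrees 1 to 4 are those of
  \<open>act_sym3\<close>. Letting the parameter be c0 + w t^3 instead of c0 adds w p^2 to b in
  degree 3 and creates w u p t^5 and w u^2 t^7 / 4; nothing arises in degree 6.\<close>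

definition limit_poly :: "'k \<Rightarrow> 'k \<Rightarrow> 'k \<Rightarrow> 'k \<Rightarrow> 'k \<Rightarrow> 'k \<Rightarrow> 'k poly"
  where "limit_poly X1 X2 X3 X4 X5 X7 = [:0, 2 * X1, X2, X3, X4 / 4, X5, 0, X7 / 4:]"

text \<open>Every entry is rewritten in the convergent rescaled quantities and the leftover powers
  of R = 1 / T. Outside of the lower right entry all terms with \<tau> carry a factor tending to 0.
  The terms with c0 u disappear because u T^2 tends to 0.\<close>

lemma scaled_limit:
  assumes two: "(2 :: 'k) \<noteq> 0" and T: "\<And>n. T n \<noteq> 0" and R: "vconv (\<lambda>n. inverse (T n)) 0"
    and x1: "vconv (\<lambda>n. e n * T n) X1" and x2: "vconv (\<lambda>n. (c n + d n) * T n ^ 2) X2"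
    and x3: "vconv (\<lambda>n. (b n + w n * (p n)^2) * T n ^ 3) X3" and x4: "vconv (\<lambda>n. a n * T n ^ 4) X4"
    and x5: "vconv (\<lambda>n. w n * u n * p n * T n ^ 5) X5" and x7: "vconv (\<lambda>n. w n * (u n)^2 * T n ^ 7) X7"
    and \<omega>: "vconv (\<lambda>n. u n * T n ^ 2) 0" and \<beta>: "vconv (\<lambda>n. b n * T n) 0"
    and c: "vconv c 1" and d: "vconv d (- 1)" and f: "vconv f 0" and p: "vconv p 1"
    and w3: "\<And>n. 3 * w n = 0"
  shows "mconv (\<lambda>n. act (sym3 (a n + (c0 + w n * (T n * \<tau>)^3) * (u n)^2) (b n) (c n)
      (d n + (c0 + w n * (T n * \<tau>)^3) * u n * p n) (e n) (f n + (c0 + w n * (T n * \<tau>)^3) * (p n)^2))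
      (upper_unip (T n * \<tau>))) (normal_form (poly (limit_poly X1 X2 X3 X4 X5 X7) \<tau> + c0))"
proof -
  have four: "(4 :: 'k) \<noteq> 0"
  proof -
    have "(4 :: 'k) = 2 * 2" by simp
    then show ?thesis using two by (metis mult_eq_0_iff)
  qed
  define R where "R n = inverse (T n)" for n
  have R0: "vconv R 0" using R by (simp add: R_def[abs_def])
  define E1 S2 S3 A4 W5 W7 U2 B1 where "E1 n = e n * T n" and "S2 n = (c n + d n) * T n ^ 2"
    and "S3 n = (b n + w n * (p n)^2) * T n ^ 3" and "A4 n = a n * T n ^ 4"
    and "W5 n = w n * u n * p n * T n ^ 5" and "W7 n = w n * (u n)^2 * T n ^ 7"
    and "U2 n = u n * T n ^ 2" and "B1 n = b n * T n" for n
  have lims: "vconv E1 X1" "vconv S2 X2" "vconv S3 X3" "vconv A4 X4" "vconv W5 X5" "vconv W7 X7"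
    "vconv U2 0" "vconv B1 0"
    using x1 x2 x3 x4 x5 x7 \<omega> \<beta>
    by (simp_all add: E1_def[abs_def] S2_def[abs_def] S3_def[abs_def] A4_def[abs_def] W5_def[abs_def]
        W7_def[abs_def] U2_def[abs_def] B1_def[abs_def])
  \<comment> \<open>In degree 3 only b + w p^2 is controlled. As 3 w = 0, this suffices for the
    entry in which b occurs with the factor 3.\<close>
  have b3: "3 * b n = 3 * (b n + w n * (p n)^2)" for n using w3[of n] by (simp add: algebra_simps flip: mult.assoc)
  note defs = E1_def S2_def S3_def A4_def W5_def W7_def U2_def B1_def R_def
  note ints = vconv_add vconv_mult vconv_power vconv_const lims R0 c d f p
  have l11: "vconv (\<lambda>n. a n + (c0 + w n * (T n * \<tau>)^3) * (u n)^2) 0"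
  proof (rule vconv_eq)
    show "vconv (\<lambda>n. A4 n * R n ^ 4 + c0 * U2 n ^ 2 * R n ^ 4 + W7 n * \<tau>^3 * R n ^ 4)
       (X4 * 0 ^ 4 + c0 * 0 ^ 2 * 0 ^ 4 + X7 * \<tau>^3 * 0 ^ 4)" by (intro ints)
  qed (use T in \<open>simp_all add: defs field_simps eval_nat_numeral\<close>)
  have l12: "vconv (\<lambda>n. (a n + (c0 + w n * (T n * \<tau>)^3) * (u n)^2) * (T n * \<tau>) + b n) 0"
  proof (rule vconv_eq)
    show "vconv (\<lambda>n. A4 n * R n ^ 3 * \<tau> + c0 * U2 n ^ 2 * R n ^ 3 * \<tau> + W7 n * \<tau>^4 * R n ^ 3 + B1 n * R n)
       (X4 * 0 ^ 3 * \<tau> + c0 * 0 ^ 2 * 0 ^ 3 * \<tau> + X7 * \<tau>^4 * 0 ^ 3 + 0 * 0)" by (intro ints)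
  qed (use T in \<open>simp_all add: defs field_simps eval_nat_numeral\<close>)
  have l22: "vconv (\<lambda>n. (a n + (c0 + w n * (T n * \<tau>)^3) * (u n)^2) * (T n * \<tau>)^2 + 2 * b n * (T n * \<tau>) + c n) 1"
  proof (rule vconv_eq)
    show "vconv (\<lambda>n. A4 n * R n ^ 2 * \<tau>^2 + c0 * U2 n ^ 2 * R n ^ 2 * \<tau>^2 + W7 n * \<tau>^5 * R n ^ 2 + 2 * B1 n * \<tau> + c n)
       (X4 * 0 ^ 2 * \<tau>^2 + c0 * 0 ^ 2 * 0 ^ 2 * \<tau>^2 + X7 * \<tau>^5 * 0 ^ 2 + 2 * 0 * \<tau> + 1)" by (intro ints)
  qed (use T in \<open>simp_all add: defs field_simps eval_nat_numeral\<close>)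
  have l13: "vconv (\<lambda>n. (a n + (c0 + w n * (T n * \<tau>)^3) * (u n)^2) * (T n * \<tau>)^2 / 2 + b n * (T n * \<tau>)
      + (d n + (c0 + w n * (T n * \<tau>)^3) * u n * p n)) (- 1)"
  proof (rule vconv_eq)
    show "vconv (\<lambda>n. (A4 n * R n ^ 2 * \<tau>^2 + c0 * U2 n ^ 2 * R n ^ 2 * \<tau>^2 + W7 n * \<tau>^5 * R n ^ 2) * inverse 2
        + B1 n * \<tau> + d n + c0 * U2 n * R n ^ 2 * p n + W5 n * \<tau>^3 * R n ^ 2)
       ((X4 * 0 ^ 2 * \<tau>^2 + c0 * 0 ^ 2 * 0 ^ 2 * \<tau>^2 + X7 * \<tau>^5 * 0 ^ 2) * inverse 2 + 0 * \<tau> + (- 1)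
        + c0 * 0 * 0 ^ 2 * 1 + X5 * \<tau>^3 * 0 ^ 2)" by (intro ints)
  qed (use T two in \<open>simp_all add: defs field_simps eval_nat_numeral\<close>)
  have l23: "vconv (\<lambda>n. (a n + (c0 + w n * (T n * \<tau>)^3) * (u n)^2) * (T n * \<tau>)^3 / 2 + 3 * b n * (T n * \<tau>)^2 / 2
      + (c n + (d n + (c0 + w n * (T n * \<tau>)^3) * u n * p n)) * (T n * \<tau>) + e n) 0"
    unfolding b3
  proof (rule vconv_eq)
    show "vconv (\<lambda>n. (A4 n * R n * \<tau>^3 + c0 * U2 n ^ 2 * R n * \<tau>^3 + W7 n * \<tau>^6 * R n + 3 * S3 n * R n * \<tau>^2) * inverse 2
        + S2 n * R n * \<tau> + c0 * U2 n * p n * R n * \<tau> + W5 n * \<tau>^4 * R n + E1 n * R n)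
       ((X4 * 0 * \<tau>^3 + c0 * 0 ^ 2 * 0 * \<tau>^3 + X7 * \<tau>^6 * 0 + 3 * X3 * 0 * \<tau>^2) * inverse 2
        + X2 * 0 * \<tau> + c0 * 0 * 1 * 0 * \<tau> + X5 * \<tau>^4 * 0 + X1 * 0)" by (intro ints)
  qed (use T two four in \<open>simp_all add: defs field_simps eval_nat_numeral\<close>)
  have l33: "vconv (\<lambda>n. (a n + (c0 + w n * (T n * \<tau>)^3) * (u n)^2) * (T n * \<tau>)^4 / 4 + b n * (T n * \<tau>)^3
      + (c n + (d n + (c0 + w n * (T n * \<tau>)^3) * u n * p n)) * (T n * \<tau>)^2 + 2 * e n * (T n * \<tau>)
      + (f n + (c0 + w n * (T n * \<tau>)^3) * (p n)^2)) (poly (limit_poly X1 X2 X3 X4 X5 X7) \<tau> + c0)"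
  proof (rule vconv_eq)
    show "vconv (\<lambda>n. (A4 n * \<tau>^4 + c0 * U2 n ^ 2 * \<tau>^4 + W7 n * \<tau>^7) * inverse 4 + S3 n * \<tau>^3
        + S2 n * \<tau>^2 + c0 * U2 n * p n * \<tau>^2 + W5 n * \<tau>^5 + 2 * E1 n * \<tau> + f n + c0 * (p n)^2)
       ((X4 * \<tau>^4 + c0 * 0 ^ 2 * \<tau>^4 + X7 * \<tau>^7) * inverse 4 + X3 * \<tau>^3
        + X2 * \<tau>^2 + c0 * 0 * 1 * \<tau>^2 + X5 * \<tau>^5 + 2 * X1 * \<tau> + 0 + c0 * 1 ^ 2)" by (intro ints)
  qed (use T four in \<open>simp_all add: defs limit_poly_def field_simps eval_nat_numeral\<close>)
  have "sym3 0 0 1 (- 1) 0 l = normal_form l" for l :: 'k by (simp add: sym3_def normal_form_def)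
  with mconv_sym3[OF l11 l12 l22 l13 l23 l33] show ?thesis unfolding act_sym3[OF two] by simp
qed

end

context minimal_dynamics
begin

section \<open>Splitting off cubic terms in characteristic 3\<close>

definition cubic_subgroup :: "'k set \<Rightarrow> bool"
  where "cubic_subgroup W \<longleftrightarrow> 0 \<in> W \<and> (\<forall>x\<in>W. \<forall>y\<in>W. x + y \<in> W) \<and> (\<forall>x\<in>W. \<forall>a. a ^ 3 * x \<in> W)"

text \<open>In characteristic $3$ the map $t \mapsto ct^3$ is additive, so that the limiting
  polynomials may all be of this form and \<open>CC\<close> need not have interior. The maximal
  subspaces of \<open>CC\<close> over the field of cubes serve to split such terms off.\<close>
lemma ex_maximal_cubic_subgroup:
  "\<exists>W. cubic_subgroup W \<and> W \<subseteq> CC \<and> (\<forall>c L. (\<forall>n. c n \<in> W) \<and> vconv c L \<longrightarrow> L \<in> W) \<and>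
    ((3 :: 'k) \<noteq> 0 \<longrightarrow> W = {0}) \<and>
    ((3 :: 'k) = 0 \<longrightarrow> (\<forall>x. (\<forall>c\<in>W. \<forall>t. c + x * t ^ 3 \<in> CC) \<longrightarrow> x \<in> W))"
proof (cases "(3 :: 'k) = 0")
  case False
  have "L = 0" if "\<And>n. c n \<in> {0}" "vconv c L" for c and L :: 'k
  proof -
    have "c = (\<lambda>n. 0)" using that(1) by auto
    then show ?thesis using that(2) vconv_unique[of "\<lambda>n. 0" L 0] by simp
  qed
  then show ?thesis using False CC_0 by (intro exI[of _ "{0}"]) (auto simp: cubic_subgroup_def)
next
  case True
  define \<A> where "\<A> = {W. cubic_subgroup W \<and> W \<subseteq> CC}"
  have "\<exists>M\<in>\<A>. \<forall>X\<in>\<A>. M \<subseteq> X \<longrightarrow> X = M"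
  proof (rule subset_Zorn_nonempty)
    have "{0} \<in> \<A>" using CC_0 by (auto simp: \<A>_def cubic_subgroup_def)
    then show "\<A> \<noteq> {}" by blast
    fix \<C> assume C: "\<C> \<noteq> {}" "subset.chain \<A> \<C>"
    have cs: "cubic_subgroup W" "W \<subseteq> CC" if "W \<in> \<C>" for W
      using that C(2) by (auto simp: \<A>_def subset_chain_def)
    have two: "\<exists>W\<in>\<C>. x \<in> W \<and> y \<in> W" if "x \<in> \<Union>\<C>" "y \<in> \<Union>\<C>" for x y
      using C(2) that unfolding subset_chain_def by blast
    have "cubic_subgroup (\<Union>\<C>)"
      unfolding cubic_subgroup_def
    proof (intro conjI ballI allI)
      show "0 \<in> \<Union>\<C>" using C(1) cs(1) by (auto simp: cubic_subgroup_def)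
      show "x + y \<in> \<Union>\<C>" if xy: "x \<in> \<Union>\<C>" "y \<in> \<Union>\<C>" for x y
      proof -
        obtain W where W: "W \<in> \<C>" "x \<in> W" "y \<in> W" using two[OF xy] by blast
        then have "x + y \<in> W" using cs(1)[OF W(1)] by (simp add: cubic_subgroup_def)
        then show ?thesis using W(1) by blast
      qed
      show "a ^ 3 * x \<in> \<Union>\<C>" if x: "x \<in> \<Union>\<C>" for x a
      proof -
        obtain W where W: "W \<in> \<C>" "x \<in> W" using x by blast
        then have "a ^ 3 * x \<in> W" using cs(1)[OF W(1)] by (simp add: cubic_subgroup_def)
        then show ?thesis using W(1) by blast
      qed
    qed
    moreover have "\<Union>\<C> \<subseteq> CC" using cs(2) by (rule Union_least)
    ultimately show "\<Union>\<C> \<in> \<A>" by (simp add: \<A>_def)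
  qed
  then obtain W where W: "cubic_subgroup W" "W \<subseteq> CC"
    "\<And>X. cubic_subgroup X \<Longrightarrow> X \<subseteq> CC \<Longrightarrow> W \<subseteq> X \<Longrightarrow> X = W" by (auto simp: \<A>_def)
  have W0: "0 \<in> W" and Wadd: "\<And>x y. x \<in> W \<Longrightarrow> y \<in> W \<Longrightarrow> x + y \<in> W"
    and Wcube: "\<And>x a. x \<in> W \<Longrightarrow> a ^ 3 * x \<in> W" using W(1) by (auto simp: cubic_subgroup_def)
  \<comment> \<open>The closure of W is again such a subgroup inside \<open>CC\<close>, so a maximal
    W is closed.\<close>
  define X where "X = {L. \<exists>c. (\<forall>n. c n \<in> W) \<and> vconv c L}"
  have XI: "L \<in> X" if "\<And>n. c n \<in> W" "vconv c L" for c L using that by (auto simp: X_def)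
  have "cubic_subgroup X"
    unfolding cubic_subgroup_def
  proof (intro conjI ballI allI)
    show "0 \<in> X" using W0 by (rule_tac XI[of "\<lambda>n. 0"]) auto
    show "x + y \<in> X" if xy: "x \<in> X" "y \<in> X" for x y
    proof -
      obtain c c' where "\<And>n. c n \<in> W" "vconv c x" "\<And>n. c' n \<in> W" "vconv c' y" using xy by (auto simp: X_def)
      then show ?thesis using Wadd by (intro XI[of "\<lambda>n. c n + c' n"] vconv_add) auto
    qed
    show "a ^ 3 * x \<in> X" if x: "x \<in> X" for x a
    proof -
      obtain c where "\<And>n. c n \<in> W" "vconv c x" using x by (auto simp: X_def)
      then show ?thesis using Wcube by (intro XI[of "\<lambda>n. a ^ 3 * c n"] vconv_mult) auto
    qed
  qed
  moreover have "X \<subseteq> CC"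
  proof
    fix L assume "L \<in> X"
    then obtain c where c: "\<And>n. c n \<in> W" "vconv c L" by (auto simp: X_def)
    show "L \<in> CC" by (rule CC_closed[of c]) (use c W(2) in auto)
  qed
  moreover have "W \<subseteq> X" by (auto intro!: XI[of "\<lambda>n. _"])
  ultimately have "X = W" by (rule W(3))
  then have closed: "L \<in> W" if "\<forall>n. c n \<in> W" "vconv c L" for c L using XI[of c L] that by simp
  have max: "x \<in> W" if x: "\<forall>c\<in>W. \<forall>t. c + x * t ^ 3 \<in> CC" for x
  proof -
    \<comment> \<open>Adjoins to W all multiples of x by cubes, which in characteristic 3 are closed
      under addition.\<close>
    define Z where "Z = {c + x * t ^ 3 | c t. c \<in> W}"
    have ZI: "c + x * t ^ 3 \<in> Z" if "c \<in> W" for c t using that by (auto simp: Z_def)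
    have cube_add: "s ^ 3 + t ^ 3 = (s + t) ^ 3" for s t :: 'k
    proof -
      have "(s + t) ^ 3 = s ^ 3 + t ^ 3 + 3 * (s * s * t + s * t * t)"
        by (simp add: power3_eq_cube algebra_simps)
      then show ?thesis using True by simp
    qed
    have "cubic_subgroup Z"
      unfolding cubic_subgroup_def
    proof (intro conjI ballI allI)
      show "0 \<in> Z" using ZI[OF W0, of 0] by simp
      show "y + z \<in> Z" if yz: "y \<in> Z" "z \<in> Z" for y z
      proof -
        obtain c s c' t where "c \<in> W" "c' \<in> W" "y = c + x * s ^ 3" "z = c' + x * t ^ 3"
          using yz by (auto simp: Z_def)
        then show ?thesis using ZI[OF Wadd, of c c' "s + t"]
          by (simp add: cube_add[symmetric] algebra_simps)
      qed
      show "a ^ 3 * y \<in> Z" if y: "y \<in> Z" for y a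
      proof -
        obtain c s where "c \<in> W" "y = c + x * s ^ 3" using y by (auto simp: Z_def)
        then show ?thesis using ZI[OF Wcube, of c a "a * s"]
          by (simp add: power_mult_distrib algebra_simps)
      qed
    qed
    moreover have "Z \<subseteq> CC" using x by (auto simp: Z_def)
    moreover have "W \<subseteq> Z" using ZI[of _ 0] by auto
    ultimately have "Z = W" by (rule W(3))
    then show ?thesis using ZI[OF W0, of 1] by simp
  qed
  show ?thesis
  proof (rule exI[of _ W], intro conjI)
    show "cubic_subgroup W" "W \<subseteq> CC" by (rule W)+
    show "\<forall>c L. (\<forall>n. c n \<in> W) \<and> vconv c L \<longrightarrow> L \<in> W"
      by (intro allI impI, elim conjE) (rule closed)
    show "(3 :: 'k) \<noteq> 0 \<longrightarrow> W = {0}" using True by simp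
    show "(3 :: 'k) = 0 \<longrightarrow> (\<forall>x. (\<forall>c\<in>W. \<forall>t. c + x * t ^ 3 \<in> CC) \<longrightarrow> x \<in> W)" using max by simp
  qed
qed

text \<open>The norms are discrete, so a least one is attained unless v is unbounded on the sums. In
  that case w converges to - b / q, which lies in the closed set W and makes the sum vanish. The
  minimiser serves to remove from b the part that W can absorb.\<close>

lemma ex_minimizer:
  assumes W: "0 \<in> W" "\<And>c L. (\<And>n. c n \<in> W) \<Longrightarrow> vconv c L \<Longrightarrow> L \<in> W" and q: "q \<noteq> 0"
  shows "\<exists>w\<in>W. \<forall>w'\<in>W. vnorm (b + w * q) \<le> vnorm (b + w' * q)"
proof (cases "\<exists>w\<in>W. b + w * q = 0")
  case True
  then obtain w where "w \<in> W" "b + w * q = 0" by blast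
  then show ?thesis by (intro bexI[of _ w]) auto
next
  case False
  have "\<exists>M. \<forall>w\<in>W. v (b + w * q) \<le> int M"
  proof (rule ccontr)
    assume "\<not> ?thesis"
    then have "\<forall>M. \<exists>w. w \<in> W \<and> int M < v (b + w * q)" by (meson linorder_not_le)
    then obtain w where w: "\<And>M. w M \<in> W" "\<And>M. int M < v (b + w M * q)" by metis
    have "vconv (\<lambda>M. b + w M * q) 0"
    proof (rule vconv_powi)
      show "\<exists>N. \<forall>m\<ge>N. b + w m * q \<in> vball v 0 n" for n
      proof (intro exI allI impI)
        fix m assume "nat n \<le> m"
        then have "n < v (b + w m * q)" using w(2)[of m] by linarith
        then show "b + w m * q \<in> vball v 0 n" by (simp add: vball_def)
      qed
    qed
    then have "vconv (\<lambda>M. (b + w M * q - b) * inverse q) ((0 - b) * inverse q)"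
      by (intro vconv_mult vconv_diff vconv_const)
    then have "vconv w (- b * inverse q)" using q by (simp add: mult.assoc)
    then have "- b * inverse q \<in> W" using w(1) W(2) by blast
    then show False using False q by force
  qed
  then obtain M where M: "\<And>w. w \<in> W \<Longrightarrow> v (b + w * q) \<le> int M" by blast
  obtain w where w: "w \<in> W" "\<And>w'. w' \<in> W \<Longrightarrow> nat (int M - v (b + w * q)) \<le> nat (int M - v (b + w' * q))"
    using ex_has_least_nat[of "\<lambda>w. w \<in> W" 0 "\<lambda>w. nat (int M - v (b + w * q))"] W(1) by auto
  have "vnorm (b + w * q) \<le> vnorm (b + w' * q)" if w': "w' \<in> W" for w'
  proof -
    have "v (b + w' * q) \<le> v (b + w * q)" using w(2)[OF w'] M[OF w'] M[OF w(1)] by linarith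
    moreover have "b + w * q \<noteq> 0" "b + w' * q \<noteq> 0" using False w(1) w' by auto
    ultimately show ?thesis by (simp add: vnorm_def powi_le)
  qed
  then show ?thesis using w(1) by blast
qed

text \<open>If 3 is nonzero it is a constant of norm 1, and another cube root of unity that close to
  1 would force its norm below 1. In characteristic 3 there are no other cube roots.\<close>

lemma cube_root_one:
  assumes "c ^ 3 = 1" "vnorm (c - 1) < 1"
  shows "c = 1"
proof (rule ccontr)
  assume c: "c \<noteq> 1"
  have "(c - 1) * (c ^ 2 + c + 1) = 0"
    using assms(1) by (simp add: power2_eq_square power3_eq_cube algebra_simps)
  then have "c ^ 2 + c + 1 = 0" using c by simp
  moreover have "c ^ 2 + c + 1 = 3 + (c - 1) * (c - 1 + 3)" by (simp add: power2_eq_square algebra_simps)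
  ultimately have 3: "3 = - ((c - 1) * (c - 1 + 3))" by (simp add: eq_neg_iff_add_eq_0)
  have "vnorm (c - 1 + 3) \<le> 1" using assms(2) vnorm_numeral by (intro vnorm_add_le) auto
  then have "vnorm (c - 1) * vnorm (c - 1 + 3) \<le> vnorm (c - 1) * 1" by (intro mult_left_mono) auto
  then have "vnorm (- ((c - 1) * (c - 1 + 3))) < 1" using assms(2) unfolding vnorm_minus vnorm_mult by linarith
  then have "vnorm 3 < 1" unfolding 3[symmetric] .
  moreover have "(3 :: 'k) \<in> prime_subfield"
    unfolding prime_subfield_def by (rule range_eqI[of _ _ 3]) simp
  ultimately have "(3 :: 'k) = 0" using vnorm_prime_subfield[of 3] by auto
  moreover have "(c - 1) ^ 3 = c ^ 3 - 1 - 3 * (c * c - c)" by (simp add: power3_eq_cube algebra_simps)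
  ultimately have "(c - 1) ^ 3 = 0" using assms(1) by simp
  then show False using c by simp
qed

text \<open>The form \<open>q k\<close> is pulled back along the displacement from A to
  \<open>s k\<close>. If some \<open>q k\<close> close to \<open>normal_form 0\<close> is fixed by
  the flow, its determinant makes it \<open>normal_form f\<close>, with f nonzero by hypothesis.
  Otherwise the entries that move under the flow are rescaled with weights 1 to 4 and yield a
  nonzero polynomial with values in \<open>CC\<close>.\<close>

lemma ex_nonzero_CC:
  assumes A: "A \<in> Y" and s: "\<And>k. s k \<in> XX" "mconv s A"
    and ne: "\<And>k. act (normal_form 0) (s k ** inv3 A) \<noteq> normal_form 0"
  shows "\<exists>c\<in>CC. c \<noteq> 0"
proof -
  have dA: "det A \<noteq> 0" by (rule Y_det[OF A])
  define g where "g k = s k ** inv3 A" for k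
  define q where "q k = act (normal_form 0) (g k)" for k
  have gA: "g k ** A = s k" for k by (simp add: g_def inv3_cancel(4)[OF dA])
  have dg: "det (g k) = 1" for k
    using det_XX[OF s(1)] det_XX[OF Y_XX[OF A]] D by (simp add: g_def det_mul det_inv3)
  have "mconv g (A ** inv3 A)" unfolding g_def by (intro mconv_mult s(2) mconv_const)
  then have g1: "mconv g (mat 1)" by (simp add: inv3[OF dA])
  have "mconv q (act (normal_form 0) (mat 1))" unfolding q_def by (intro mconv_act g1 mconv_const)
  then have q0: "mconv q (normal_form 0)" by (simp add: act_one)
  have bb: "bounded_below A (q k)" for k
    unfolding q_def bounded_below_act[symmetric] gA by (rule bounded_below_XX[OF s(1)])
  have sym: "q k = sym3 (q k$1$1) (q k$1$2) (q k$2$2) (q k$1$3) (q k$2$3) (q k$3$3)" for k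
    unfolding q_def by (rule mat3_eqI; simp add: sym3_def act_normal algebra_simps)
  define z where "z k \<longleftrightarrow> q k$1$1 = 0 \<and> q k$1$2 = 0 \<and> q k$2$3 = 0 \<and> q k$2$2 + q k$1$3 = 0" for k
  note q_lim = mconvD[OF q0]
  show ?thesis
  proof (cases "\<forall>\<^sub>F k in sequentially. z k")
    case True
    have "\<forall>\<^sub>F k in sequentially. vnorm (q k$2$2 - 1) < 1"
      using q_lim[of 2 2] unfolding vconv_iff by (auto simp: normal_form_def dest: spec[of _ 1])
    with True have "\<forall>\<^sub>F k in sequentially. z k \<and> vnorm (q k$2$2 - 1) < 1" by (rule eventually_conj)
    then obtain k where k: "z k" "vnorm (q k$2$2 - 1) < 1" by (auto simp: eventually_sequentially)
    define c f where "c = q k$2$2" and "f = q k$3$3"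
    have "q k$1$3 = - c" using k(1) by (simp add: z_def c_def eq_neg_iff_add_eq_0 add.commute)
    then have qk: "q k = sym3 0 0 c (- c) 0 f"
      using sym[of k] k(1) by (simp add: z_def c_def f_def)
    have "det (q k) = - 1" using dg[of k] by (simp add: q_def det_act_normal)
    moreover have "det (q k) = - (c ^ 3)" unfolding qk by (simp add: det_3 sym3_def power3_eq_cube)
    ultimately have "c ^ 3 = 1" by simp
    then have "c = 1" by (rule cube_root_one) (use k(2) in \<open>simp add: c_def\<close>)
    then have "q k = normal_form f" unfolding qk by (simp add: sym3_def normal_form_def)
    then have "f \<in> CC" "f \<noteq> 0" using CC_I[OF A] bb[of k] ne[of k] by (auto simp: q_def g_def)
    then show ?thesis by blast
  next
    case False
    then obtain r :: "nat \<Rightarrow> nat" where r: "strict_mono r \<and> (\<forall>n. \<not> z (r n))"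
      using not_eventually_sequentiallyD[of z] by blast
    define x where "x i k = (if i = 1 then q (r k)$2$3 else if i = 2 then q (r k)$2$2 + q (r k)$1$3
      else if i = 3 then q (r k)$1$2 else q (r k)$1$1)" for i k :: nat
    have ql: "vconv (\<lambda>k. q (r k) $ i $ j) (normal_form 0 $ i $ j)" for i j
      using vconv_subseq[OF q_lim[of i j]] r by blast
    have "vconv (\<lambda>k. q (r k)$2$2 + q (r k)$1$3) (normal_form 0$2$2 + normal_form 0$1$3)"
      by (intro vconv_add ql)
    define I where "I = {1, 2, 3, 4 :: nat}"
    then have I: "finite I" "\<And>i. i \<in> I \<Longrightarrow> 1 \<le> i" by auto
    have xI: "vconv (x i) 0" if "i \<in> I" for i
      using that \<open>vconv (\<lambda>k. q (r k)$2$2 + q (r k)$1$3) (normal_form 0$2$2 + normal_form 0$1$3)\<close> ql[of 2 3] ql[of 1 2] ql[of 1 1] by (auto simp: I_def x_def[abs_def] normal_form_def)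
    have xnz: "\<exists>i\<in>I. x i k \<noteq> 0" for k
      using r unfolding z_def x_def I_def by (auto dest: spec[of _ k])
    have "\<exists>T r X. strict_mono r \<and> (\<forall>n. T n \<noteq> 0) \<and> vconv (\<lambda>n. inverse (T n)) 0 \<and>
      (\<forall>i\<in>I. vconv (\<lambda>n. x i (r n) * T n ^ i) (X i)) \<and> (\<exists>i\<in>I. X i \<noteq> 0)"
      by (rule vconv_rescale[OF I(1) xI I(2) xnz])
    then obtain T r' X where T: "strict_mono r'" "\<And>n. T n \<noteq> 0" "vconv (\<lambda>n. inverse (T n)) 0"
      and X: "\<And>i. i \<in> I \<Longrightarrow> vconv (\<lambda>n. x i (r' n) * T n ^ i) (X i)" "\<exists>i\<in>I. X i \<noteq> 0"
      by blast
    define Q where "Q n = q (r (r' n))" for n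
    have Ql: "vconv (\<lambda>k. Q k $ i $ j) (normal_form 0 $ i $ j)" for i j
      unfolding Q_def using vconv_subseq[OF ql T(1)] .
    have X': "vconv (\<lambda>n. Q n$2$3 * T n) (X 1)" "vconv (\<lambda>n. (Q n$2$2 + Q n$1$3) * T n ^ 2) (X 2)"
      "vconv (\<lambda>n. Q n$1$2 * T n ^ 3) (X 3)" "vconv (\<lambda>n. Q n$1$1 * T n ^ 4) (X 4)"
      using X(1)[of 1] X(1)[of 2] X(1)[of 3] X(1)[of 4] by (simp_all add: x_def Q_def I_def)
    have "vconv (\<lambda>n. (Q n$1$2 * T n ^ 3) * inverse (T n) ^ 2) (X 3 * 0 ^ 2)"
      by (intro vconv_mult vconv_power X' T)
    then have \<beta>: "vconv (\<lambda>n. Q n$1$2 * T n) 0"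
      using T(2) by (rule_tac vconv_eq) (auto simp: field_simps eval_nat_numeral)
    define S where "S = limit_poly (X 1) (X 2) (X 3) (X 4) 0 0"
    have inCC: "poly S \<tau> \<in> CC" for \<tau>
    proof -
      have "mconv (\<lambda>n. act (sym3 (Q n$1$1 + (0 + 0 * (T n * \<tau>)^3) * 0^2) (Q n$1$2) (Q n$2$2)
        (Q n$1$3 + (0 + 0 * (T n * \<tau>)^3) * 0 * 1) (Q n$2$3) (Q n$3$3 + (0 + 0 * (T n * \<tau>)^3) * 1^2))
        (upper_unip (T n * \<tau>))) (normal_form (poly S \<tau> + 0))"
        unfolding S_def using X' \<beta> Ql[of 2 2] Ql[of 1 3] Ql[of 3 3]
        by (intro scaled_limit[OF two T(2,3)]) (auto simp: normal_form_def)
      then have "mconv (\<lambda>n. act (Q n) (upper_unip (T n * \<tau>))) (normal_form (poly S \<tau>))"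
        unfolding Q_def using sym by simp
      then show ?thesis using A bb by (intro CC_transfer[of "\<lambda>n. A" Q]) (auto simp: Q_def)
    qed
    have "S \<noteq> 0"
    proof
      assume S: "S = 0"
      have four: "(4 :: 'k) \<noteq> 0"
      proof -
        have "(4 :: 'k) = 2 * 2" by simp
        then show ?thesis using two by (metis mult_eq_0_iff)
      qed
      then have "X 1 = 0 \<and> X 2 = 0 \<and> X 3 = 0 \<and> X 4 = 0" using S two by (simp add: S_def limit_poly_def)
      then show False using X(2) by (auto simp: I_def)
    qed
    then obtain \<tau> where "poly S \<tau> \<noteq> 0" using poly_nonroot by blast
    then show ?thesis using inCC by blast
  qed
qed

lemma numerals_nz: "(4 :: 'k) \<noteq> 0"
proof -
  have "(4 :: 'k) = 2 * 2" by simp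
  then show ?thesis using two by (metis mult_eq_0_iff)
qed

text \<open>A displacement \<open>h\<close> close to the identity is split as \<open>g ** lower_unip k'\<close>. The factor in
  the stabiliser only reparametrises the unipotent flow by a fractional linear map, and for
  \<open>g\<close> the part of the limiting polynomial lying in a cubic subgroup can be cancelled
  polynomially.\<close>
lemma contradiction:
  assumes c1: "c1 \<in> CC" "c1 \<noteq> 0"
  shows False
proof -
  obtain W where WW: "cubic_subgroup W \<and> W \<subseteq> CC \<and> (\<forall>c L. (\<forall>n. c n \<in> W) \<and> vconv c L \<longrightarrow> L \<in> W) \<and>
      ((3 :: 'k) \<noteq> 0 \<longrightarrow> W = {0}) \<and>
      ((3 :: 'k) = 0 \<longrightarrow> (\<forall>x. (\<forall>c\<in>W. \<forall>t. c + x * t ^ 3 \<in> CC) \<longrightarrow> x \<in> W))"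
    using ex_maximal_cubic_subgroup by (rule exE)
  then have W: "cubic_subgroup W" "W \<subseteq> CC" and W3: "(3 :: 'k) \<noteq> 0 \<Longrightarrow> W = {0}" by auto
  have Wcl: "L \<in> W" if "\<And>n. c n \<in> W" "vconv c L" for c L
    using WW that by (elim conjE) blast
  have Wmax: "x \<in> W" if "(3 :: 'k) = 0" "\<And>c t. c \<in> W \<Longrightarrow> c + x * t ^ 3 \<in> CC" for x
    using WW that by (elim conjE) blast
  have W0: "0 \<in> W" and Wadd: "\<And>x y. x \<in> W \<Longrightarrow> y \<in> W \<Longrightarrow> x + y \<in> W"
    and Wcube: "\<And>x a. x \<in> W \<Longrightarrow> a ^ 3 * x \<in> W" using W(1) by (auto simp: cubic_subgroup_def)
  obtain C h where C: "\<And>n. C n \<in> Y" "\<And>n. h n ** C n \<in> Y" and dh: "\<And>n. det (h n) = 1"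
    and nu: "\<And>n. \<not> unipotent_type (h n)" and h1: "mconv h (mat 1)"
    using recurrence by auto
  \<comment> \<open>Chosen to make the entry (3, 2) of \<open>g n\<close> vanish, as
    \<open>act_normal_sym3\<close> and \<open>dual_isotropic\<close> require.\<close>
  define k' where "k' n = h n$3$2 / h n$3$3" for n
  define g where "g n = h n ** lower_unip (- k' n)" for n
  define q where "q n = act (normal_form 0) (g n)" for n
  \<comment> \<open>The cofactor of \<open>g n $ 3 $ 1\<close> in \<open>dual_isotropic\<close>. As
    it tends to 2, that identity determines \<open>g n $ 3 $ 1\<close> from the form
    \<open>q n\<close> and \<open>g n $ 3 $ 3\<close>.\<close>
  define K' where "K' n = 2 * g n$3$3 * (q n$1$2 * q n$2$3 - q n$2$2 * q n$1$3)
     + g n$3$1 * (q n$2$2 * q n$3$3 - (q n$2$3)^2)" for n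
  note h_lim = mconvD[OF h1]
  have "vconv k' ((mat 1 :: 'k^3^3)$3$2 / (mat 1 :: 'k^3^3)$3$3)"
    unfolding k'_def by (intro vconv_divide h_lim) (simp add: mat_one_3)
  then have k'0: "vconv k' 0" by (simp add: mat_one_3)
  have "mconv (\<lambda>n. lower_unip (- k' n)) (lower_unip (- 0))"
  proof -
    have 1: "vconv (\<lambda>n. - k' n) (- 0)" by (rule vconv_minus[OF k'0])
    have "vconv (\<lambda>n. (- k' n) * (- k' n) / 2) ((- 0) * (- 0) / 2)"
      by (intro vconv_divide vconv_mult 1 vconv_const two)
    with 1 show ?thesis
      by (simp only: mconv_def lower_unip_def forall_3 vector_3 vconv_const simp_thms)
  qed
  moreover have "lower_unip 0 = (mat 1 :: 'k^3^3)" by (rule mat3_eqI; simp add: lower_unip_def mat_def)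
  ultimately have "mconv g (mat 1 ** mat 1)" unfolding g_def by (intro mconv_mult h1) simp
  then have g1: "mconv g (mat 1)" by simp
  note g_lim = mconvD[OF g1]
  have "mconv q (act (normal_form 0) (mat 1))" unfolding q_def by (intro mconv_act g1 mconv_const)
  then have "mconv q (normal_form 0)" by (simp add: act_one)
  note q_lim = mconvD[OF this]
  have "vconv K' (2 * (mat 1 :: 'k^3^3)$3$3 * (normal_form 0$1$2 * normal_form 0$2$3 - normal_form 0$2$2 * normal_form 0$1$3)
     + (mat 1 :: 'k^3^3)$3$1 * (normal_form 0$2$2 * normal_form 0$3$3 - (normal_form 0$2$3)^2))"
    unfolding K'_def by (intro vconv_add vconv_mult vconv_diff vconv_power vconv_const g_lim q_lim)
  then have K2: "vconv K' 2" by (simp add: mat_one_3 normal_form_def)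
  have "\<forall>\<^sub>F n in sequentially. h n$3$3 \<noteq> 0" using vconv_nz[OF h_lim[of 3 3]] by (simp add: mat_one_3)
  moreover have "\<forall>\<^sub>F n in sequentially. K' n \<noteq> 0" using vconv_nz[OF K2 two] .
  ultimately have "\<forall>\<^sub>F n in sequentially. h n$3$3 \<noteq> 0 \<and> K' n \<noteq> 0" by (rule eventually_conj)
  then obtain N where N: "\<And>n. N \<le> n \<Longrightarrow> h n$3$3 \<noteq> 0 \<and> K' n \<noteq> 0" by (auto simp: eventually_sequentially)
  have g33: "g n$3$3 = h n$3$3" for n by (simp add: g_def mult3 lower_unip_def)
  have g32: "g n$3$2 = 0" if "N \<le> n" for n
    using N[OF that] by (simp add: g_def mult3 lower_unip_def k'_def)
  have null: "(g n$3$3)^2 * (q n$1$1 * q n$2$2 - (q n$1$2)^2) + g n$3$1 * K' n = 0" if "N \<le> n" for n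
    unfolding K'_def by (rule dual_isotropic[OF g32[OF that] q_def])
  \<comment> \<open>The element w of W cancels as much as possible of the coefficient in degree 3.
    Its optimality is what finally excludes a surviving cubic term.\<close>
  have "\<exists>w\<in>W. \<forall>w'\<in>W. vnorm (q n$1$2 + w * (g n$3$3)^2) \<le> vnorm (q n$1$2 + w' * (g n$3$3)^2)" if "N \<le> n" for n
  proof (rule ex_minimizer[OF W0])
    show "L \<in> W" if "\<And>n. c n \<in> W" "vconv c L" for c L using that by (rule Wcl)
    show "(g n$3$3)^2 \<noteq> 0" using N[OF that] by (simp add: g33)
  qed
  then obtain w where w: "\<And>n. N \<le> n \<Longrightarrow> w n \<in> W"
    "\<And>n w'. N \<le> n \<Longrightarrow> w' \<in> W \<Longrightarrow> vnorm (q n$1$2 + w n * (g n$3$3)^2) \<le> vnorm (q n$1$2 + w' * (g n$3$3)^2)"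
    by (metis (no_types, lifting))
  define x where "x i n = (if i = 1 then q (N + n)$2$3 else if i = 2 then q (N + n)$2$2 + q (N + n)$1$3
    else if i = 3 then q (N + n)$1$2 + w (N + n) * (g (N + n)$3$3)^2 else if i = 4 then q (N + n)$1$1
    else if i = 5 then w (N + n) * g (N + n)$3$1 * g (N + n)$3$3 else if i = 6 then k' (N + n)
    else w (N + n) * (g (N + n)$3$1)^2)" for i n :: nat
  \<comment> \<open>The limit polynomial has no term of degree 6, so index 6 is free for
    \<open>k'\<close>, which is to be rescaled with weight 1.\<close>
  define e where "e i = (if i = 6 then 1 else i)" for i :: nat
  have smN: "strict_mono (\<lambda>n. N + n)" by (simp add: strict_mono_def)
  note qN = vconv_subseq[OF q_lim smN] and gN = vconv_subseq[OF g_lim smN] and kN = vconv_subseq[OF k'0 smN]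
  have x3: "vconv (\<lambda>n. q (N + n)$1$2 + w (N + n) * (g (N + n)$3$3)^2) 0"
  proof (rule vconv_0_bound)
    show "vconv (\<lambda>n. q (N + n)$1$2) 0" using qN[of 1 2] by (simp add: normal_form_def)
    show "\<forall>\<^sub>F n in sequentially. vnorm (q (N + n)$1$2 + w (N + n) * (g (N + n)$3$3)^2) \<le> vnorm (q (N + n)$1$2)"
      using w(2)[OF _ W0] by (intro always_eventually) simp
  qed
  have wN: "vconv (\<lambda>n. w (N + n)) 0"
  proof (rule vconv_eq)
    show "vconv (\<lambda>n. (q (N + n)$1$2 + w (N + n) * (g (N + n)$3$3)^2 - q (N + n)$1$2) * inverse (g (N + n)$3$3)^2)
      ((0 - normal_form 0 $1$2) * inverse ((mat 1 :: 'k^3^3)$3$3)^2)"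
      by (intro vconv_mult vconv_diff vconv_power vconv_inverse x3 qN gN) (simp add: mat_one_3)
    show "(q (N + n)$1$2 + w (N + n) * (g (N + n)$3$3)^2 - q (N + n)$1$2) * inverse (g (N + n)$3$3)^2 = w (N + n)" for n
      using N[of "N + n"] by (simp add: g33 field_simps)
    show "(0 - normal_form 0 $1$2) * inverse ((mat 1 :: 'k^3^3)$3$3)^2 = 0" by (simp add: normal_form_def)
  qed
  define I where "I = {1, 2, 3, 4, 5, 6, 7 :: nat}"
  have I: "finite I" "\<And>i. i \<in> I \<Longrightarrow> 1 \<le> e i" by (auto simp: I_def e_def)
  have xI: "vconv (x i) 0" if "i \<in> I" for i
  proof -
    have "vconv (\<lambda>n. q (N + n)$2$2 + q (N + n)$1$3) (normal_form 0$2$2 + normal_form 0$1$3)"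
      by (intro vconv_add qN)
    moreover have "vconv (\<lambda>n. w (N + n) * g (N + n)$3$1 * g (N + n)$3$3) (0 * (mat 1 :: 'k^3^3)$3$1 * (mat 1 :: 'k^3^3)$3$3)"
      "vconv (\<lambda>n. w (N + n) * (g (N + n)$3$1)^2) (0 * ((mat 1 :: 'k^3^3)$3$1)^2)"
      by (intro vconv_mult vconv_power wN gN)+
    ultimately show ?thesis
      using that qN[of 2 3] qN[of 1 1] x3 kN by (auto simp: I_def x_def[abs_def] normal_form_def)
  qed
  have xnz: "\<exists>i\<in>I. x i n \<noteq> 0" for n
  proof (rule ccontr)
    assume "\<not> ?thesis"
    then have "x 1 n = 0" "x 2 n = 0" "x 3 n = 0" "x 4 n = 0" "x 5 n = 0" "x 6 n = 0" by (auto simp: I_def)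
    then have z: "q (N + n)$2$3 = 0" "q (N + n)$2$2 + q (N + n)$1$3 = 0"
      "q (N + n)$1$2 + w (N + n) * (g (N + n)$3$3)^2 = 0" "q (N + n)$1$1 = 0"
      "w (N + n) * g (N + n)$3$1 * g (N + n)$3$3 = 0" "k' (N + n) = 0" by (simp_all add: x_def)
    have nz: "g (N + n)$3$3 \<noteq> 0" "K' (N + n) \<noteq> 0" using N[of "N + n"] by (auto simp: g33)
    have nl: "g (N + n)$3$1 * K' (N + n) = (g (N + n)$3$3)^2 * (q (N + n)$1$2)^2"
      using null[of "N + n"] z(4) by (simp add: algebra_simps)
    \<comment> \<open>If w = 0, the term of index 3 kills the entry of q, and the null relation then
      kills that of g. Otherwise the term of index 5 kills the entry of g, and the relation that of
      q.\<close>
    have "q (N + n)$1$2 = 0 \<and> g (N + n)$3$1 = 0"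
    proof (cases "w (N + n) = 0")
      case True
      then have "q (N + n)$1$2 = 0" using z(3) by simp
      then show ?thesis using nl nz by simp
    next
      case False
      then have "g (N + n)$3$1 = 0" using z(5) nz by simp
      then show ?thesis using nl nz by simp
    qed
    moreover have "g (N + n) = h (N + n)"
      using z(6) \<open>lower_unip 0 = (mat 1 :: 'k^3^3)\<close> by (simp add: g_def)
    ultimately have "unipotent_type (h (N + n))"
      using z(1,2,4) g32[of "N + n"] by (simp add: unipotent_type_def q_def add.commute)
    then show False using nu by blast
  qed
  have "\<exists>T r X. strict_mono r \<and> (\<forall>n. T n \<noteq> 0) \<and> vconv (\<lambda>n. inverse (T n)) 0 \<and>
      (\<forall>i\<in>I. vconv (\<lambda>n. x i (r n) * T n ^ e i) (X i)) \<and> (\<exists>i\<in>I. X i \<noteq> 0)"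
    by (rule vconv_rescale[OF I(1) xI I(2) xnz])
  then obtain T r X where r: "strict_mono r" and T: "\<And>n. T n \<noteq> 0" "vconv (\<lambda>n. inverse (T n)) 0"
    and X: "\<And>i. i \<in> I \<Longrightarrow> vconv (\<lambda>n. x i (r n) * T n ^ e i) (X i)" and Xnz: "\<exists>i\<in>I. X i \<noteq> 0"
    by blast
  define J where "J n = N + r n" for n
  have J: "N \<le> J n" for n by (simp add: J_def)
  have smJ: "strict_mono J" using r by (simp add: J_def strict_mono_def)
  note qJ = vconv_subseq[OF q_lim smJ] and gJ = vconv_subseq[OF g_lim smJ] and kJ = vconv_subseq[OF k'0 smJ]
    and KJ = vconv_subseq[OF K2 smJ]
  define a b c d ee f u p W' where "a n = q (J n)$1$1" and "b n = q (J n)$1$2" and "c n = q (J n)$2$2"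
    and "d n = q (J n)$1$3" and "ee n = q (J n)$2$3" and "f n = q (J n)$3$3" and "u n = g (J n)$3$1"
    and "p n = g (J n)$3$3" and "W' n = w (J n)" for n
  note abs = a_def b_def c_def d_def ee_def f_def u_def p_def W'_def
  have lims: "vconv c 1" "vconv d (- 1)" "vconv f 0" "vconv p 1"
    using qJ[of 2 2] qJ[of 1 3] qJ[of 3 3] gJ[of 3 3] by (simp_all add: abs[abs_def] normal_form_def mat_one_3)
  have pnz: "p n \<noteq> 0" and Knz: "K' (J n) \<noteq> 0" for n using N[OF J] by (auto simp: p_def g33)
  have X1: "vconv (\<lambda>n. ee n * T n) (X 1)" and X2: "vconv (\<lambda>n. (c n + d n) * T n ^ 2) (X 2)"
    and X3: "vconv (\<lambda>n. (b n + W' n * (p n)^2) * T n ^ 3) (X 3)" and X4: "vconv (\<lambda>n. a n * T n ^ 4) (X 4)"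
    and X5: "vconv (\<lambda>n. W' n * u n * p n * T n ^ 5) (X 5)" and X6: "vconv (\<lambda>n. k' (J n) * T n) (X 6)"
    and X7: "vconv (\<lambda>n. W' n * (u n)^2 * T n ^ 7) (X 7)"
    using X[of 1] X[of 2] X[of 3] X[of 4] X[of 5] X[of 6] X[of 7]
    by (simp_all add: abs x_def e_def I_def J_def)
  have w3: "3 * W' n = 0" for n using W3 w(1)[OF J, of n] by (cases "(3 :: 'k) = 0") (auto simp: W'_def)
  have nullJ: "u n * K' (J n) = (p n)^2 * ((b n)^2 - a n * c n)" for n
    using null[OF J, of n] by (simp add: abs algebra_simps)
  note R = T(2)
  define e1 where "e1 n = (b n + W' n * (p n)^2) * T n ^ 3 * inverse (T n) ^ 2" for n
  define e2 where "e2 n = a n * T n ^ 4 * inverse (T n) ^ 2 * c n" for n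
  have "vconv e1 (X 3 * 0 ^ 2)" "vconv e2 (X 4 * 0 ^ 2 * 1)"
    unfolding e1_def e2_def by (intro vconv_mult vconv_power X3 X4 R lims)+
  then have e0: "vconv e1 0" "vconv e2 0" by simp_all
  \<comment> \<open>Rescaling controls b only together with w p^2. By \<open>nullJ\<close> the
    product w p^2 (b^2 - a c) equals w u \<open>K'\<close>, which is governed by the term of index
    5; \<open>vconv_cubic\<close> then isolates b.\<close>
  have \<beta>: "vconv (\<lambda>n. b n * T n) 0"
  proof (rule vconv_cubic[OF e0])
    show "vconv (\<lambda>n. (e1 n - b n * T n) * ((b n * T n)^2 - e2 n)) 0"
    proof (rule vconv_eq)
      show "vconv (\<lambda>n. W' n * u n * p n * T n ^ 5 * inverse (T n) ^ 2 * inverse (p n) * K' (J n))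
        (X 5 * 0 ^ 2 * inverse 1 * 2)"
        by (intro vconv_mult vconv_power vconv_inverse X5 R lims KJ) simp
      show "W' n * u n * p n * T n ^ 5 * inverse (T n) ^ 2 * inverse (p n) * K' (J n)
         = (e1 n - b n * T n) * ((b n * T n)^2 - e2 n)" for n
      proof -
        have "e1 n = (b n + W' n * (p n)^2) * T n" using T(1)[of n]
          by (simp add: e1_def field_simps eval_nat_numeral)
        then have 1: "e1 n - b n * T n = W' n * (p n)^2 * T n" by (simp add: algebra_simps)
        have "e2 n = a n * c n * T n ^ 2" using T(1)[of n] by (simp add: e2_def field_simps eval_nat_numeral)
        then have 2: "(b n * T n)^2 - e2 n = ((b n)^2 - a n * c n) * T n ^ 2" by (simp add: algebra_simps power_mult_distrib)
        have "W' n * u n * p n * T n ^ 5 * inverse (T n) ^ 2 * inverse (p n) * K' (J n)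
          = W' n * T n ^ 3 * (u n * K' (J n))"
          using T(1)[of n] pnz[of n] by (simp add: field_simps eval_nat_numeral)
        then show ?thesis unfolding 1 2 nullJ by (simp add: algebra_simps eval_nat_numeral)
      qed
      show "X 5 * 0 ^ 2 * inverse 1 * 2 = 0" by simp
    qed
  qed
  \<comment> \<open>By \<open>nullJ\<close> again: up to factors with nonzero limits, u is b^2 - a
    c.\<close>
  have \<omega>: "vconv (\<lambda>n. u n * T n ^ 2) 0"
  proof (rule vconv_eq)
    show "vconv (\<lambda>n. (p n)^2 * ((b n * T n)^2 - e2 n) * inverse (K' (J n))) (1 ^ 2 * (0 ^ 2 - 0) * inverse 2)"
      by (intro vconv_mult vconv_power vconv_diff vconv_inverse lims \<beta> e0 KJ two)
    show "(p n)^2 * ((b n * T n)^2 - e2 n) * inverse (K' (J n)) = u n * T n ^ 2" for n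
    proof -
      have "e2 n = a n * c n * T n ^ 2" using T(1)[of n] by (simp add: e2_def field_simps eval_nat_numeral)
      then have "(p n)^2 * ((b n * T n)^2 - e2 n) = (p n)^2 * ((b n)^2 - a n * c n) * T n ^ 2"
        by (simp add: algebra_simps power_mult_distrib)
      also have "\<dots> = u n * K' (J n) * T n ^ 2" by (simp add: nullJ)
      finally show ?thesis using Knz[of n] by simp
    qed
  qed simp
  define S where "S = limit_poly (X 1) (X 2) (X 3) (X 4) (X 5) (X 7)"
  \<comment> \<open>The reparametrisation leaves in the limit a torus element with parameter m0^-2,
    where m0 = 1 - X 6 \<tau> / 2. It multiplies the coefficient of z^2 by m0^-4.\<close>
  define Bp where "Bp = [:1, - (X 6) / 2:] ^ 4"
  have quot: "poly (S + [:c0:]) \<tau> / poly Bp \<tau> \<in> CC"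
    if c0: "\<And>w t. w \<in> W \<Longrightarrow> c0 + w * t ^ 3 \<in> CC" and B: "poly Bp \<tau> \<noteq> 0" for c0 \<tau>
  proof -
    \<comment> \<open>The parameter moves with the flow time: it stays in \<open>CC\<close> by the
      choice of c0, and its pullback adds w p^2 to b in degree 3, where b alone need not remain
      bounded after rescaling.\<close>
    define s where "s n = c0 + W' n * (T n * \<tau>) ^ 3" for n
    define m where "m n = 1 - k' (J n) * (T n * \<tau>) / 2" for n
    define m0 where "m0 = 1 - X 6 * \<tau> / 2"
    have Bm: "poly Bp \<tau> = m0 ^ 4" by (simp add: Bp_def m0_def mult.commute)
    then have m0: "m0 \<noteq> 0" using B by auto
    have m: "vconv m m0"
    proof (rule vconv_eq)
      show "vconv (\<lambda>n. 1 - k' (J n) * T n * \<tau> * inverse 2) (1 - X 6 * \<tau> * inverse 2)"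
        by (intro vconv_diff vconv_mult vconv_const X6)
      show "1 - k' (J n) * T n * \<tau> * inverse 2 = m n" for n by (simp add: m_def mult.assoc)
      show "1 - X 6 * \<tau> * inverse 2 = m0" by (simp add: m0_def)
    qed
    have sCC: "s n \<in> CC" for n unfolding s_def by (rule c0) (simp add: W'_def w(1)[OF J])
    have gs: "act (normal_form (s n)) (g (J n)) = sym3 (a n + s n * (u n)^2) (b n) (c n)
      (d n + s n * u n * p n) (ee n) (f n + s n * (p n)^2)" for n
      unfolding abs by (rule act_normal_sym3[OF g32[OF J] q_def])
    have "mconv (\<lambda>n. act (act (normal_form (s n)) (g (J n))) (upper_unip (T n * \<tau>)))
       (normal_form (poly S \<tau> + c0))"
      unfolding gs unfolding s_def S_def
      by (rule scaled_limit[OF two T X1 X2 X3 X4 X5 X7 \<omega> \<beta> lims w3])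
    moreover have "mconv (\<lambda>n. torus (inverse (m n * m n)) ** lower_unip (k' (J n) * m n))
       (torus (inverse (m0 * m0)) ** lower_unip (0 * m0))"
    proof (rule mconv_mult)
      have "vconv (\<lambda>n. inverse (m n * m n)) (inverse (m0 * m0))"
        "vconv (\<lambda>n. inverse (inverse (m n * m n))) (inverse (inverse (m0 * m0)))"
        using m0 by (intro vconv_inverse vconv_mult m; simp)+
      then show "mconv (\<lambda>n. torus (inverse (m n * m n))) (torus (inverse (m0 * m0)))"
        by (simp add: mconv_def torus_def forall_3)
      have 1: "vconv (\<lambda>n. k' (J n) * m n) (0 * m0)" by (intro vconv_mult kJ m)
      have "vconv (\<lambda>n. (k' (J n) * m n) * (k' (J n) * m n) / 2) ((0 * m0) * (0 * m0) / 2)"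
        by (intro vconv_divide vconv_mult kJ m vconv_const two)
      with 1 show "mconv (\<lambda>n. lower_unip (k' (J n) * m n)) (lower_unip (0 * m0))"
        by (simp only: mconv_def lower_unip_def forall_3 vector_3 vconv_const simp_thms)
    qed
    ultimately have "mconv (\<lambda>n. act (act (act (normal_form (s n)) (g (J n))) (upper_unip (T n * \<tau>)))
        (torus (inverse (m n * m n)) ** lower_unip (k' (J n) * m n)))
       (act (normal_form (poly S \<tau> + c0)) (torus (inverse (m0 * m0)) ** lower_unip (0 * m0)))"
      by (rule mconv_act)
    also have "act (normal_form (poly S \<tau> + c0)) (torus (inverse (m0 * m0)) ** lower_unip (0 * m0))
        = normal_form (poly (S + [:c0:]) \<tau> / poly Bp \<tau>)"
      using m0 \<open>lower_unip 0 = (mat 1 :: 'k^3^3)\<close>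
      by (simp add: act_torus Bm eval_nat_numeral divide_inverse mult.assoc)
    finally have lim: "mconv (\<lambda>n. act (act (act (normal_form (s n)) (g (J n))) (upper_unip (T n * \<tau>)))
        (torus (inverse (m n * m n)) ** lower_unip (k' (J n) * m n)))
        (normal_form (poly (S + [:c0:]) \<tau> / poly Bp \<tau>))" .
    \<comment> \<open>By \<open>lower_upper_commute\<close>, the time of the shear after h that
      matches time \<open>T n * \<tau>\<close> after g, up to the torus and a lower unipotent
      tending to 1.\<close>
    define t where "t n = T n * \<tau> / m n" for n
    have "\<forall>\<^sub>F n in sequentially. act (act (act (normal_form (s n)) (g (J n))) (upper_unip (T n * \<tau>)))
        (torus (inverse (m n * m n)) ** lower_unip (k' (J n) * m n))
        = act (act (normal_form (s n)) (h (J n))) (upper_unip (t n))"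
      using vconv_nz[OF m m0]
    proof eventually_elim
      case (elim n)
      have hg: "h (J n) = g (J n) ** lower_unip (k' (J n))"
      proof -
        have "lower_unip (- k' (J n)) ** lower_unip (k' (J n)) = mat 1"
          using two by (intro mat3_eqI; simp add: mult3 lower_unip_def mat_def field_simps)
        then show ?thesis by (simp add: g_def flip: matrix_mul_assoc)
      qed
      have "upper_unip (T n * \<tau>) ** (torus (inverse (m n * m n)) ** lower_unip (k' (J n) * m n))
         = lower_unip (k' (J n)) ** upper_unip (t n)"
        using lower_upper_commute[OF two m_def elim] by (simp add: t_def matrix_mul_assoc)
      then show ?case unfolding act_act hg by (simp flip: matrix_mul_assoc)
    qed
    from mconv_cong[OF this lim]
    have "mconv (\<lambda>n. act (act (normal_form (s n)) (h (J n))) (upper_unip (t n)))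
        (normal_form (poly (S + [:c0:]) \<tau> / poly Bp \<tau>))" .
    moreover have "bounded_below (C (J n)) (act (normal_form (s n)) (h (J n)))" for n
      unfolding bounded_below_act[symmetric] using sCC[of n] C(2)[of "J n"] by (simp add: CC_def)
    ultimately show ?thesis using C(1) by (intro CC_transfer[of "\<lambda>n. C (J n)"])
  qed
  have const: "pderiv S * Bp = (S + [:c0:]) * pderiv Bp" if "\<And>w t. w \<in> W \<Longrightarrow> c0 + w * t ^ 3 \<in> CC" for c0
    using quotient_in_CC_constant[of Bp "S + [:c0:]"] quot[OF that] by (simp add: pderiv_add pderiv_pCons)
  have adm: "c0 + w * t ^ 3 \<in> CC" if "c0 \<in> W" "w \<in> W" for c0 w t
    using W(2) Wadd[OF that(1) Wcube[OF that(2), of t]] by (auto simp: mult.commute)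
  \<comment> \<open>A second admissible constant: any nonzero element of W, or c1 if W is trivial.
    Comparing it with the constant 0 isolates the derivative of Bp, and this is where a nonzero
    element of \<open>CC\<close> is indispensable.\<close>
  obtain c2 where c2: "c2 \<noteq> 0" "\<And>w t. w \<in> W \<Longrightarrow> c2 + w * t ^ 3 \<in> CC"
  proof (cases "W = {0}")
    case True
    then show ?thesis using c1 that[of c1] by simp
  next
    case False
    then obtain c2 where "c2 \<in> W" "c2 \<noteq> 0" using W0 by blast
    then show ?thesis using that[of c2] adm by blast
  qed
  have "pderiv S * Bp = S * pderiv Bp" using const[of 0] adm[OF W0] by simp
  moreover have "pderiv S * Bp = (S + [:c2:]) * pderiv Bp" by (rule const[OF c2(2)])
  ultimately have "[:c2:] * pderiv Bp = 0" by (simp add: algebra_simps)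
  then have dB: "pderiv Bp = 0" using c2(1) by simp
  then have "poly (pderiv Bp) 0 = 0" by simp
  then have X6: "X 6 = 0"
    using two numerals_nz by (simp add: Bp_def pderiv_power pderiv_pCons)
  then have Bp1: "Bp = 1" by (simp add: Bp_def flip: one_pCons)
  then have "pderiv S = 0" using const[of 0] adm[OF W0] by simp
  then have co: "of_nat (Suc i) * coeff S (Suc i) = 0" for i by (metis coeff_0 coeff_pderiv)
  have X0: "X 1 = 0" "X 2 = 0" "X 4 = 0" and X35: "3 * X 3 = 0" "5 * X 5 = 0"
    using co[of 0] co[of 1] co[of 3] co[of 2] co[of 4] two numerals_nz
    by (auto simp: S_def limit_poly_def eval_nat_numeral)
  have "(7 :: 'k) * coeff S (Suc 6) = 0" using co[of 6] by simp
  moreover have "coeff S (Suc 6) = X 7 / 4" by (simp add: S_def limit_poly_def eval_nat_numeral)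
  ultimately have X7': "7 * X 7 = 0" using numerals_nz by (metis mult_eq_0_iff divide_eq_0_iff)
  \<comment> \<open>If 3 = 0, then 5 and 7 are nonzero. Otherwise W is trivial, and the terms of
    index 5 and 7 are 0 from the start.\<close>
  have X57: "X 5 = 0 \<and> X 7 = 0"
  proof (cases "(3 :: 'k) = 0")
    case True
    have "(5 :: 'k) = 3 + 2" "(7 :: 'k) = 3 + 2 * 2" by simp_all
    then have "(5 :: 'k) \<noteq> 0" "(7 :: 'k) \<noteq> 0" using True two by (metis add_0 mult_eq_0_iff)+
    then show ?thesis using X35 X7' by simp
  next
    case False
    then have "W' n = 0" for n using w3[of n] by simp
    then show ?thesis using X5 X7 vconv_unique[of "\<lambda>n. 0"] by fastforce
  qed
  then have X3nz: "X 3 \<noteq> 0" using Xnz X0 X6 by (auto simp: I_def)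
  then have three: "(3 :: 'k) = 0" using X35(1) by simp
  \<comment> \<open>Only the cubic term is left, so all c0 + X 3 t^3 lie in \<open>CC\<close> and
    the maximality of W applies. But then w was not optimal: subtracting X 3 / T^3 from it would
    cancel the term, which contradicts the minimality unless X 3 = 0.\<close>
  have "X 3 \<in> W"
  proof (rule Wmax[OF three])
    fix c0 t assume c0: "c0 \<in> W"
    have "poly (S + [:c0:]) t / poly Bp t \<in> CC" using adm[OF c0] by (intro quot) (simp_all add: Bp1)
    then show "c0 + X 3 * t ^ 3 \<in> CC"
      using X0 X57 by (simp add: Bp1 S_def limit_poly_def eval_nat_numeral mult_ac add.commute)
  qed
  then have mX: "- X 3 \<in> W" using Wcube[of "X 3" "- 1"] by (simp add: power3_eq_cube)
  have "vconv (\<lambda>n. (b n + W' n * (p n)^2) * T n ^ 3 + (- X 3) * (p n)^2) (X 3 + (- X 3) * 1 ^ 2)"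
    by (intro vconv_add vconv_mult vconv_power vconv_const X3 lims)
  then have "vconv (\<lambda>n. (b n + W' n * (p n)^2) * T n ^ 3 + (- X 3) * (p n)^2) 0" by simp
  moreover have "vnorm ((b n + W' n * (p n)^2) * T n ^ 3)
      \<le> vnorm ((b n + W' n * (p n)^2) * T n ^ 3 + (- X 3) * (p n)^2)" for n
  proof -
    have "W' n + inverse (T n) ^ 3 * (- X 3) \<in> W"
      using w(1)[OF J] by (intro Wadd Wcube mX) (simp add: W'_def)
    then have "vnorm (b n + W' n * (p n)^2) \<le> vnorm (b n + (W' n + inverse (T n) ^ 3 * (- X 3)) * (p n)^2)"
      unfolding abs by (rule w(2)[OF J])
    then have "vnorm (b n + W' n * (p n)^2) * vnorm (T n ^ 3)
      \<le> vnorm (b n + (W' n + inverse (T n) ^ 3 * (- X 3)) * (p n)^2) * vnorm (T n ^ 3)"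
      by (rule mult_right_mono) simp
    moreover have "(b n + (W' n + inverse (T n) ^ 3 * (- X 3)) * (p n)^2) * T n ^ 3
      = (b n + W' n * (p n)^2) * T n ^ 3 + (- X 3) * (p n)^2"
      using T(1)[of n] by (simp add: field_simps)
    ultimately show ?thesis by (metis vnorm_mult)
  qed
  ultimately have "vconv (\<lambda>n. (b n + W' n * (p n)^2) * T n ^ 3) 0"
    by (rule vconv_0_bound[OF _ always_eventually[OF allI]])
  then have "X 3 = 0" using X3 by (rule vconv_unique[rotated])
  then show False using X3nz by simp
qed

end

section \<open>Orbit closures\<close>

lemma symmetric_entries: "transpose M = M \<Longrightarrow> M $ i $ j = M $ j $ i"
proof -
  assume "transpose M = M"
  moreover have "transpose M $ i $ j = M $ j $ i" by (simp add: transpose_def)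
  ultimately show ?thesis by simp
qed

lemma qform_inj:
  fixes M N :: "'k::field^3^3"
  assumes two: "(2 :: 'k) \<noteq> 0" and M: "transpose M = M" and N: "transpose N = N"
    and eq: "\<And>y. qform M y = qform N y"
  shows "M = N"
proof -
  note M' = symmetric_entries[OF M] and N' = symmetric_entries[OF N]
  note sym = M'[of 2 1] M'[of 3 1] M'[of 3 2] N'[of 2 1] N'[of 3 1] N'[of 3 2]
  have d: "M$1$1 = N$1$1" "M$2$2 = N$2$2" "M$3$3 = N$3$3"
    using eq[of "vector [1, 0, 0]"] eq[of "vector [0, 1, 0]"] eq[of "vector [0, 0, 1]"]
    by (simp_all add: qform_def sum_3)
  have "2 * M$1$2 = 2 * N$1$2" "2 * M$1$3 = 2 * N$1$3" "2 * M$2$3 = 2 * N$2$3"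
    using eq[of "vector [1, 1, 0]"] eq[of "vector [1, 0, 1]"] eq[of "vector [0, 1, 1]"]
    by (simp_all add: qform_def sum_3 d sym algebra_simps)
  then have "M$1$2 = N$1$2" "M$1$3 = N$1$3" "M$2$3 = N$2$3" using two by (metis mult_cancel_left)+
  then show ?thesis by (intro mat3_eqI) (simp_all add: d sym)
qed

lemma transpose_act: "transpose M = M \<Longrightarrow> transpose (act M g) = act M (g :: 'k::field^3^3)"
  by (simp add: act_def matrix_transpose_mul matrix_mul_assoc)

lemma mem_stabilizer:
  assumes "(2 :: 'k::field) \<noteq> 0" "transpose B = B"
  shows "g \<in> stabilizer_qf B \<longleftrightarrow> det g = 1 \<and> act B g = (B :: 'k^3^3)"
proof -
  have "(\<forall>y. qform B (g *v y) = qform B y) \<longleftrightarrow> act B g = B"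
    unfolding qform_act[symmetric] using qform_inj[OF assms(1) transpose_act assms(2)] assms(2) by auto
  then show ?thesis by (simp add: stabilizer_qf_def SL3_def)
qed

lemma stabilizer_mult: "g \<in> stabilizer_qf B \<Longrightarrow> h \<in> stabilizer_qf B \<Longrightarrow> g ** h \<in> stabilizer_qf B"
  by (simp add: stabilizer_qf_def SL3_mult flip: matrix_vector_mul_assoc)

lemma stabilizer_inv3: "h \<in> stabilizer_qf B \<Longrightarrow> inv3 h \<in> stabilizer_qf B"
proof -
  assume "h \<in> stabilizer_qf B"
  then have h: "det h = 1" "qform B (h *v y) = qform B y" for y by (auto simp: stabilizer_qf_def SL3_def)
  have "qform B (inv3 h *v y) = qform B y" for y
    using h(2)[of "inv3 h *v y"] inv3(1)[of h] h(1) by (simp add: matrix_vector_mul_assoc)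
  then show ?thesis using h(1) by (simp add: stabilizer_qf_def SL3_def det_inv3)
qed

lemma act_mat: "act (mat a ** N) g = mat a ** act N (g :: 'k::field^3^3)"
  by (rule mat3_eqI; simp add: act_def mult3 mat_def transpose_def algebra_simps)

text \<open>A hyperbolic pair \<open>y\<close>, \<open>z\<close> is completed by the cross product \<open>w\<close> of \<open>B *v y\<close> and
  \<open>B *v z\<close>; by Lagrange's identity \<open>y\<close>, \<open>w\<close>, \<open>z\<close> have determinant \<open>1\<close> up to sign.\<close>
lemma isotropic_normal_form:
  fixes B :: "'k::field^3^3"
  assumes two: "(2 :: 'k) \<noteq> 0" and sym: "transpose B = B" and nd: "nondegenerate_qf B" and iso: "isotropic_qf B"
  shows "\<exists>P a. det P \<noteq> 0 \<and> a \<noteq> 0 \<and> act B P = mat a ** normal_form 0"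
proof -
  define b where "b u w = u$1 * (B *v w)$1 + u$2 * (B *v w)$2 + u$3 * (B *v w)$3" for u w :: "'k^3"
  note B' = symmetric_entries[OF sym]
  note S = B'[of 2 1] B'[of 3 1] B'[of 3 2]
  have bq: "qform B u = b u u" for u by (simp add: qform_def b_def sum_3 vmult3 algebra_simps)
  have bs: "b u w = b w u" for u w by (simp add: b_def vmult3 S algebra_simps)
  have badd: "b (u + u') w = b u w + b u' w" and bsc: "b (s *s u) w = s * b u w" for u u' w s
    by (simp_all add: b_def algebra_simps)
  have badd': "b w (u + u') = b w u + b w u'" and bsc': "b w (s *s u) = s * b w u" for u u' w s
    by (simp_all add: bs[of w] badd bsc)
  obtain y where y: "y \<noteq> 0" "b y y = 0" using iso unfolding isotropic_qf_def bq by blast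
  have "B *v y \<noteq> 0"
  proof
    assume "B *v y = 0"
    then have "inv3 B *v (B *v y) = 0" by simp
    then show False using y(1) inv3(2)[of B] nd by (simp add: matrix_vector_mul_assoc nondegenerate_qf_def)
  qed
  then obtain i where i: "(B *v y) $ i \<noteq> 0" by (auto simp: vec_eq_iff)
  have "b (axis i 1) y = (B *v y) $ i"
    using exhaust_3[of i] by (auto simp: b_def axis_def)
  then have "b y (axis i 1) \<noteq> 0" using i bs by simp
  define z1 where "z1 = (- inverse (b y (axis i 1))) *s axis i 1"
  have z1: "b y z1 = - 1" using \<open>b y (axis i 1) \<noteq> 0\<close> unfolding z1_def bsc' by simp
  \<comment> \<open>The added multiple of y makes z isotropic without changing its product with
    y.\<close>
  define z where "z = z1 + (b z1 z1 / 2) *s y"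
  have z: "b y z = - 1" by (simp add: z_def badd' bsc' z1 y(2))
  have "b z1 y = - 1" using z1 bs by metis
  then have zz: "b z z = 0" using two by (simp add: z_def badd badd' bsc bsc' z1 y(2))
  have zy: "b z y = - 1" using z bs by metis
  define p r where "p = B *v y" and "r = B *v z"
  define w where "w = (vector [p$2 * r$3 - p$3 * r$2, p$3 * r$1 - p$1 * r$3, p$1 * r$2 - p$2 * r$1] :: 'k^3)"
  have wy: "b w y = 0" "b w z = 0" by (simp_all add: b_def w_def algebra_simps flip: p_def r_def)
  have yw: "b y w = 0" "b z w = 0" using wy bs by metis+
  \<comment> \<open>The value of the form at w cannot be prescribed, but z can be scaled freely; s =
    a = b w w turns the Gram matrix into a multiple of \<open>normal_form 0\<close>.\<close>
  define M where "M s = (vector [vector [y$1, w$1, s * z$1], vector [y$2, w$2, s * z$2], vector [y$3, w$3, s * z$3]] :: 'k^3^3)" for s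
  have actM: "act B (M s) = vector [vector [b y y, b y w, s * b y z], vector [b w y, b w w, s * b w z],
      vector [s * b z y, s * b z w, s * s * b z z]]" for s
    by (rule mat3_eqI; simp add: act_def mult3 transpose_def M_def b_def vmult3 algebra_simps)
  define a where "a = b w w"
  have act: "act B (M s) = vector [vector [0, 0, - s], vector [0, a, 0], vector [- s, 0, 0]]" for s
    by (simp add: actM y z zz zy wy yw a_def)
  have "det (M s) = s * ((p$1 * y$1 + p$2 * y$2 + p$3 * y$3) * (r$1 * z$1 + r$2 * z$2 + r$3 * z$3)
      - (p$1 * z$1 + p$2 * z$2 + p$3 * z$3) * (r$1 * y$1 + r$2 * y$2 + r$3 * y$3)) * (- 1)" for s
    by (simp add: det_3 M_def w_def algebra_simps)
  moreover have "p$1 * y$1 + p$2 * y$2 + p$3 * y$3 = 0" "p$1 * z$1 + p$2 * z$2 + p$3 * z$3 = - 1"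
    "r$1 * y$1 + r$2 * y$2 + r$3 * y$3 = - 1"
    using y(2) z zy by (simp_all add: b_def p_def r_def mult.commute)
  ultimately have detM: "det (M s) = s" for s by simp
  have "det (act B (M 1)) \<noteq> 0" using nd by (simp add: act_def det_mul detM nondegenerate_qf_def)
  then have "a \<noteq> 0" by (auto simp: act det_3)
  moreover have "act B (M a) = mat a ** normal_form 0"
    unfolding act by (rule mat3_eqI; simp add: mult3 mat_def normal_form_def)
  ultimately show ?thesis using detM by metis
qed

text \<open>The form is only similar to \<open>normal_form 0\<close>. The factor a does no harm, as
  proportional forms have the same stabiliser.\<close>

locale compact_invariant_family = completion K v
  for K :: "'k::field set" and v :: "'k \<Rightarrow> int" +
  fixes B P :: "'k^3^3" and a :: 'k and X :: "('k^3^3) set set"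
  assumes two: "(2 :: 'k) \<noteq> 0" and sym: "transpose B = B" and P: "det P \<noteq> 0" and a: "a \<noteq> 0"
    and act_P: "act B P = mat a ** normal_form 0"
    and compact_X: "compactin \<X> X" and closed_X: "closedin \<X> X"
    and stab_X: "A \<in> G \<Longrightarrow> coset A \<in> X \<Longrightarrow> h \<in> stabilizer_qf B \<Longrightarrow> coset (h ** A) \<in> X"
begin

lemma act_normal_conj: "act (normal_form 0) (inv3 P ** g ** P) = normal_form 0 \<longleftrightarrow> act B g = B"
proof -
  have cancel: "mat (inverse a) ** (mat a ** M) = M" for M :: "'k^3^3"
    using a by (intro mat3_eqI; simp add: mult3 mat_def)
  have "act (act B P) (inv3 P ** g ** P) = act (act B g) P"
    by (simp add: act_act matrix_mul_assoc inv3[OF P])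
  then have "mat a ** act (normal_form 0) (inv3 P ** g ** P) = act (act B g) P"
    by (simp add: act_P act_mat)
  moreover have "act (act B g) P = act B P \<longleftrightarrow> act B g = B"
  proof
    assume "act (act B g) P = act B P"
    then have "act (act (act B g) P) (inv3 P) = act (act B P) (inv3 P)" by simp
    then show "act B g = B" by (simp add: act_act inv3_cancel[OF P] inv3[OF P] act_one flip: matrix_mul_assoc)
  qed simp
  ultimately show ?thesis unfolding act_P using cancel by metis
qed

lemma stab_iff: "h \<in> stabilizer_qf B \<longleftrightarrow> det h = 1 \<and> act B h = B"
  by (rule mem_stabilizer[OF two sym])

lemma SO_conj: "SO h \<Longrightarrow> P ** h ** inv3 P \<in> stabilizer_qf B"
proof -
  assume h: "SO h"
  have "inv3 P ** (P ** h ** inv3 P) ** P = h"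
    by (simp add: inv3_cancel[OF P] inv3[OF P] flip: matrix_mul_assoc)
  then have "act B (P ** h ** inv3 P) = B" using h act_normal_conj[of "P ** h ** inv3 P"] by (simp add: SO_def)
  then show ?thesis using h P by (simp add: stab_iff SO_def det_mul det_inv3)
qed

definition lifts :: "('k^3^3) set"
  where "lifts = {A \<in> G. coset A \<in> X}"

definition XX :: "('k^3^3) set"
  where "XX = {A. P ** A \<in> lifts}"

lemma lifts_\<Gamma>: "A \<in> lifts \<Longrightarrow> \<gamma> \<in> \<Gamma> \<Longrightarrow> A ** \<gamma> \<in> lifts"
  by (simp add: lifts_def SL3_mult[OF _ \<Gamma>_G] coset_mult)

lemma X_Q: "X \<subseteq> Q"
  using closedin_subset[OF closed_X] by (simp add: topspace_T)

lemma lifts_closed: "(\<And>k. s k \<in> lifts) \<Longrightarrow> mconv s A \<Longrightarrow> A \<in> lifts"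
proof -
  assume s: "\<And>k. s k \<in> lifts" "mconv s A"
  have "A \<in> G" using mconv_det_eq[OF s(2)] s(1) by (simp add: lifts_def SL3_def)
  then show ?thesis using closed_X s unfolding closedin_T_seq[OF X_Q] lifts_def by blast
qed

lemma lifts_stab: "A \<in> lifts \<Longrightarrow> h \<in> stabilizer_qf B \<Longrightarrow> h ** A \<in> lifts"
  using stab_X SL3_mult by (auto simp: lifts_def stabilizer_qf_def)

lemma P_cancel: "P ** (inv3 P ** A) = A" "inv3 P ** (P ** A) = (A :: 'k^3^3)"
  by (rule inv3_cancel[OF P])+

sublocale orbit_dynamics K v "inverse (det P)" XX
proof
  fix A assume A: "A \<in> XX"
  have "det P * det A = 1" using A SL3_det[of "P ** A"] by (auto simp: XX_def lifts_def det_mul)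
  then show "det A = inverse (det P)" using P by (simp add: field_simps)
  show "A ** \<gamma> \<in> XX" if "\<gamma> \<in> \<Gamma>" for \<gamma>
    using A lifts_\<Gamma>[OF _ that] by (simp add: XX_def matrix_mul_assoc)
  show "h ** A \<in> XX" if "SO h" for h
    using A lifts_stab[OF _ SO_conj[OF that], of "P ** A"]
    by (simp add: XX_def P_cancel flip: matrix_mul_assoc)
next
  fix s :: "nat \<Rightarrow> 'k^3^3"
  assume s: "\<And>k. s k \<in> XX"
  then obtain r \<gamma> L where "strict_mono r" "\<forall>k. \<gamma> k \<in> \<Gamma>" "L \<in> G" "coset L \<in> X"
      and lim: "mconv (\<lambda>k. P ** s (r k) ** \<gamma> k) L"
    using compactin_T_seq[OF compact_X, of "\<lambda>k. P ** s k"] by (auto simp: XX_def lifts_def)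
  moreover have "mconv (\<lambda>k. inv3 P ** (P ** s (r k) ** \<gamma> k)) (inv3 P ** L)"
    by (intro mconv_mult mconv_const lim)
  ultimately show "\<exists>r \<gamma> L. strict_mono r \<and> (\<forall>k. \<gamma> k \<in> \<Gamma>) \<and> L \<in> XX \<and> mconv (\<lambda>k. s (r k) ** \<gamma> k) L"
    by (intro exI[of _ r] exI[of _ \<gamma>] exI[of _ "inv3 P ** L"])
       (simp add: XX_def lifts_def P_cancel flip: matrix_mul_assoc)
qed (use two P in auto)

text \<open>This provides the chain hypothesis of \<open>ex_minimal\<close>. The images of the sets
  in the quotient are closed in the compact X, and by \<Gamma>-invariance membership can be read off
  from the image.\<close>

lemma closed_inv_chain:
  assumes ne: "\<C> \<noteq> {}" and C: "\<And>C. C \<in> \<C> \<Longrightarrow> closed_inv C \<and> C \<noteq> {}"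
    and chain: "\<And>C C'. C \<in> \<C> \<Longrightarrow> C' \<in> \<C> \<Longrightarrow> C \<subseteq> C' \<or> C' \<subseteq> C"
  shows "\<Inter>\<C> \<noteq> {}"
proof -
  define f where "f C = (\<lambda>A. coset (P ** A)) ` C" for C
  have XXD: "P ** A \<in> G" "coset (P ** A) \<in> X" if "A \<in> C" "C \<in> \<C>" for A C
  proof -
    have "A \<in> XX" using C[OF that(2)] that(1) by (auto simp: closed_inv_def)
    then show "P ** A \<in> G" "coset (P ** A) \<in> X" by (auto simp: XX_def lifts_def)
  qed
  have mem: "inv3 P ** A \<in> C" if fC: "coset A \<in> f C" "C \<in> \<C>" for A C
  proof -
    obtain A' where A': "A' \<in> C" "coset A = coset (P ** A')" using fC(1) by (auto simp: f_def)
    obtain \<gamma> where "\<gamma> \<in> \<Gamma>" "A = P ** A' ** \<gamma>" using coset_eqD[OF A'(2)] by blast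
    moreover have "A' ** \<gamma> \<in> C" if "\<gamma> \<in> \<Gamma>" for \<gamma>
      using C[OF fC(2)] A'(1) that by (simp add: closed_inv_def)
    ultimately show ?thesis by (simp add: P_cancel flip: matrix_mul_assoc)
  qed
  have "\<Inter>(f ` \<C>) \<noteq> {}"
  proof (rule compactin_T_chain[OF compact_X])
    show "f ` \<C> \<noteq> {}" using ne by simp
    fix F assume "F \<in> f ` \<C>"
    then obtain C0 where C0: "C0 \<in> \<C>" "F = f C0" by blast
    have sub: "f C0 \<subseteq> X" using XXD(2)[OF _ C0(1)] by (auto simp: f_def)
    have "closedin \<X> (f C0)"
      unfolding closedin_T_seq[OF order_trans[OF sub X_Q]]
    proof (intro allI impI, elim conjE)
      fix s A assume s: "\<forall>k::nat. s k \<in> G \<and> coset (s k) \<in> f C0" and lim: "mconv s A"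
      have "mconv (\<lambda>k. inv3 P ** s k) (inv3 P ** A)" by (intro mconv_mult mconv_const lim)
      moreover have "\<forall>k. inv3 P ** s k \<in> C0" using mem[OF _ C0(1)] s by blast
      moreover have "\<forall>s A. (\<forall>k. s k \<in> C0) \<and> mconv s A \<longrightarrow> A \<in> C0"
        using C[OF C0(1)] by (simp add: closed_inv_def)
      ultimately have "inv3 P ** A \<in> C0" by (metis (no_types))
      then show "coset A \<in> f C0" by (auto simp: f_def P_cancel intro!: image_eqI[of _ _ "inv3 P ** A"])
    qed
    then show "closedin \<X> F \<and> F \<noteq> {} \<and> F \<subseteq> X" using sub C[OF C0(1)] C0(2) by (simp add: f_def)
    show "F \<subseteq> F' \<or> F' \<subseteq> F" if F': "F' \<in> f ` \<C>" for F'
    proof -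
      obtain C1 where C1: "C1 \<in> \<C>" "F' = f C1" using F' by blast
      then show ?thesis using chain[OF C0(1) C1(1)] unfolding C0(2) C1(2) f_def by (meson image_mono)
    qed
  qed
  then obtain c where c: "\<And>C. C \<in> \<C> \<Longrightarrow> c \<in> f C" by blast
  obtain C0 where C0: "C0 \<in> \<C>" using ne by blast
  then obtain A where A: "c = coset A" using c[OF C0] by (auto simp: f_def)
  then have "inv3 P ** A \<in> C" if "C \<in> \<C>" for C using mem[OF _ that] c[OF that] by simp
  then show ?thesis by blast
qed

text \<open>Accumulation is tested on matrices and not on cosets: with H the stabiliser, the
  approximating lifts avoid H A. A lift in H A \<gamma> for some \<gamma> in \<Gamma> may therefore
  count, even though its coset lies in the orbit.\<close>

definition acc :: "('k^3^3) set"
  where "acc = {A \<in> lifts. \<exists>s. (\<forall>k. s k \<in> lifts \<and> s k ** inv3 A \<notin> stabilizer_qf B) \<and> mconv s A}"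

lemma det_lifts: "A \<in> lifts \<Longrightarrow> det A = 1"
  using SL3_det by (auto simp: lifts_def)

lemma acc_\<Gamma>: "A \<in> acc \<Longrightarrow> \<gamma> \<in> \<Gamma> \<Longrightarrow> A ** \<gamma> \<in> acc"
proof -
  assume A: "A \<in> acc" and g: "\<gamma> \<in> \<Gamma>"
  then obtain s where s: "\<forall>k. s k \<in> lifts \<and> s k ** inv3 A \<notin> stabilizer_qf B" "mconv s A" and l: "A \<in> lifts"
    by (auto simp: acc_def)
  have d: "det A \<noteq> 0" "det \<gamma> \<noteq> 0" using det_lifts[OF l] SL3_det[OF g] by simp_all
  have "(s k ** \<gamma>) ** inv3 (A ** \<gamma>) = s k ** inv3 A" for k
    by (simp add: inv3_mult[OF d] matrix_mul_assoc inv3_cancel(3)[OF d(2)])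
  then show ?thesis unfolding acc_def
    using s l lifts_\<Gamma>[OF _ g] mconv_mult[OF s(2) mconv_const[of \<gamma>]]
    by (intro CollectI conjI exI[of _ "\<lambda>k. s k ** \<gamma>"]) auto
qed

lemma acc_stab: "A \<in> acc \<Longrightarrow> h \<in> stabilizer_qf B \<Longrightarrow> h ** A \<in> acc"
proof -
  assume A: "A \<in> acc" and h: "h \<in> stabilizer_qf B"
  then obtain s where s: "\<And>k. s k \<in> lifts" "\<And>k. s k ** inv3 A \<notin> stabilizer_qf B" "mconv s A" and l: "A \<in> lifts"
    by (auto simp: acc_def)
  have d: "det A \<noteq> 0" "det h \<noteq> 0" using det_lifts[OF l] h by (simp_all add: stab_iff)
  have "(h ** s k) ** inv3 (h ** A) \<notin> stabilizer_qf B" for k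
  proof
    assume "(h ** s k) ** inv3 (h ** A) \<in> stabilizer_qf B"
    then have "inv3 h ** ((h ** s k) ** inv3 (h ** A)) ** h \<in> stabilizer_qf B"
      by (rule stabilizer_mult[OF stabilizer_mult[OF stabilizer_inv3[OF h]] h])
    moreover have "inv3 h ** ((h ** s k) ** inv3 (h ** A)) ** h = s k ** inv3 A"
      by (simp add: inv3_mult[OF d(2,1)] inv3_cancel[OF d(2)] inv3[OF d(2)] flip: matrix_mul_assoc)
    ultimately show False using s(2) by simp
  qed
  then show ?thesis unfolding acc_def
    using s l lifts_stab[OF _ h] mconv_mult[OF mconv_const[of h] s(3)]
    by (intro CollectI conjI exI[of _ "\<lambda>k. h ** s k"]) auto
qed

text \<open>If \<open>u k\<close> lies in H A, H being the stabiliser, then the lifts that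
  accumulate at \<open>u k\<close> outside of its H-orbit also avoid H A.\<close>

lemma acc_closed:
  assumes u: "\<And>k. u k \<in> acc" "mconv u A"
  shows "A \<in> acc"
proof -
  have l: "u k \<in> lifts" for k using u(1) by (simp add: acc_def)
  have A: "A \<in> lifts" by (rule lifts_closed[OF l u(2)])
  have "\<exists>B'. B' \<in> lifts \<and> B' ** inv3 A \<notin> stabilizer_qf B \<and> near (int n) A B'" for n
  proof -
    obtain k where k: "near (int n) A (u k)" using mconv_near[OF u(2)] by (auto simp: eventually_sequentially)
    show ?thesis
    proof (cases "u k ** inv3 A \<in> stabilizer_qf B")
      case False
      then show ?thesis using k l by blast
    next
      case True
      obtain s where s: "\<And>j. s j \<in> lifts" "\<And>j. s j ** inv3 (u k) \<notin> stabilizer_qf B" "mconv s (u k)"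
        using u(1)[of k] by (auto simp: acc_def)
      obtain j where j: "near (int n) (u k) (s j)" using mconv_near[OF s(3)] by (auto simp: eventually_sequentially)
      have d: "det A \<noteq> 0" "det (u k) \<noteq> 0" using det_lifts[OF l] det_lifts[OF A] by simp_all
      have "s j ** inv3 A \<notin> stabilizer_qf B"
      proof
        assume "s j ** inv3 A \<in> stabilizer_qf B"
        then have "(s j ** inv3 A) ** inv3 (u k ** inv3 A) \<in> stabilizer_qf B"
          by (rule stabilizer_mult[OF _ stabilizer_inv3[OF True]])
        moreover have "(s j ** inv3 A) ** inv3 (u k ** inv3 A) = s j ** inv3 (u k)"
          using d by (simp add: inv3_mult det_inv3 inv3_inv3 matrix_mul_assoc inv3_cancel(4))
        ultimately show False using s(2) by simp
      qed
      then show ?thesis using s(1) near_trans[OF k j] by blast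
    qed
  qed
  then obtain s where "\<And>n. s n \<in> lifts" "\<And>n. s n ** inv3 A \<notin> stabilizer_qf B" "\<And>n. near (int n) A (s n)" by metis
  then show ?thesis using near_mconv[of A s] A unfolding acc_def by blast
qed

text \<open>The minimal set is taken inside E, so that its own points are accumulated. The bound
  \<epsilon> has to hold on all of \<open>XX\<close>, since the accumulating points may leave
  Y.\<close>

lemma acc_empty: "acc = {}"
proof (rule ccontr)
  assume ne: "acc \<noteq> {}"
  define E where "E = {A. P ** A \<in> acc}"
  have E: "closed_inv E"
    unfolding closed_inv_def
  proof (intro conjI ballI allI impI)
    show "E \<subseteq> XX" by (auto simp: E_def XX_def acc_def)
    show "A ** \<gamma> \<in> E" if "A \<in> E" "\<gamma> \<in> \<Gamma>" for A \<gamma>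
      using that acc_\<Gamma> by (simp add: E_def matrix_mul_assoc)
    show "A \<in> E" if s: "(\<forall>k. s k \<in> E) \<and> mconv s A" for s A
    proof -
      have 1: "mconv (\<lambda>k. P ** s k) (P ** A)" using s by (intro mconv_mult mconv_const) simp
      have 2: "P ** s k \<in> acc" for k using s by (simp add: E_def)
      show ?thesis using acc_closed[OF 2 1] by (simp add: E_def)
    qed
  qed
  have E_ne: "E \<noteq> {}"
  proof -
    obtain A where "A \<in> acc" using ne by blast
    then have "inv3 P ** A \<in> E" by (simp add: E_def P_cancel)
    then show ?thesis by blast
  qed
  have E_unip: "upper_unip t ** A \<in> E" if "A \<in> E" for A t
    using that acc_stab[OF _ SO_conj[OF SO_upper_unip[OF two]], of "P ** A" t]
    by (simp add: E_def P_cancel flip: matrix_mul_assoc)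
  have "\<exists>Y. closed_inv Y \<and> Y \<noteq> {} \<and> Y \<subseteq> E \<and> (\<forall>A\<in>Y. \<forall>t. upper_unip t ** A \<in> Y) \<and>
    (\<forall>Z\<subseteq>Y. closed_inv Z \<and> Z \<noteq> {} \<and> (\<forall>A\<in>Z. \<forall>t. upper_unip t ** A \<in> Z) \<longrightarrow> Z = Y)"
    by (rule ex_minimal[OF closed_inv_chain E E_ne E_unip])
  then obtain Y where Y: "closed_inv Y" "Y \<noteq> {}" and Y_E: "Y \<subseteq> E" and Y_unip: "\<forall>A\<in>Y. \<forall>t. upper_unip t ** A \<in> Y"
    and min: "\<forall>Z\<subseteq>Y. closed_inv Z \<and> Z \<noteq> {} \<and> (\<forall>A\<in>Z. \<forall>t. upper_unip t ** A \<in> Z) \<longrightarrow> Z = Y"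
    by (elim exE conjE)
  obtain \<epsilon> where \<epsilon>: "0 < \<epsilon>"
    "\<And>A m. A \<in> XX \<Longrightarrow> integral m \<Longrightarrow> m \<noteq> 0 \<Longrightarrow> \<epsilon> \<le> vnorm (qform (normal_form 0) (A *v m))"
    using form_values_bounded_below by (elim exE conjE) blast
  interpret minimal_dynamics K v "inverse (det P)" XX \<epsilon> Y
  proof
    show "Z = Y" if "Z \<subseteq> Y" "closed_inv Z" "Z \<noteq> {}" "\<And>A t. A \<in> Z \<Longrightarrow> upper_unip t ** A \<in> Z" for Z
      using min[rule_format, OF that(1)] that(2-4) by blast
    show "upper_unip t ** A \<in> Y" if "A \<in> Y" for A t using Y_unip that by simp
  qed (fact \<epsilon> Y)+
  obtain A where A: "A \<in> Y" using Y(2) by blast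
  then have "P ** A \<in> acc" using Y_E by (auto simp: E_def)
  then obtain s where s: "\<And>k. s k \<in> lifts" "\<And>k. s k ** inv3 (P ** A) \<notin> stabilizer_qf B" "mconv s (P ** A)"
    and l: "P ** A \<in> lifts" by (auto simp: acc_def)
  have dA: "det A \<noteq> 0" by (rule Y_det[OF A])
  have "\<exists>c\<in>CC. c \<noteq> 0"
  proof (rule ex_nonzero_CC[OF A])
    show "inv3 P ** s k \<in> XX" for k using s(1) by (simp add: XX_def P_cancel)
    show "mconv (\<lambda>k. inv3 P ** s k) A"
      using mconv_mult[OF mconv_const[of "inv3 P"] s(3)] by (simp add: P_cancel)
    fix k
    define g where "g = s k ** inv3 (P ** A)"
    have "det g = 1"
      using det_lifts[OF s(1)[of k]] det_lifts[OF l] by (simp add: g_def det_mul[of "s k"] det_inv3)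
    then have "act B g \<noteq> B" using s(2)[of k] by (auto simp: stab_iff g_def)
    moreover have "inv3 P ** g ** P = inv3 P ** s k ** inv3 A"
      by (simp add: g_def inv3_mult[OF P dA] matrix_mul_assoc inv3_cancel(4)[OF P])
    ultimately show "act (normal_form 0) (inv3 P ** s k ** inv3 A) \<noteq> normal_form 0"
      using act_normal_conj[of g] by simp
  qed
  then show False using contradiction by blast
qed

end

theorem theorem2p1:
  fixes K :: "'k::field set" and v :: "'k \<Rightarrow> int" and B :: "'k^3^3"
    and x :: "('k^3^3) set"
  assumes "global_function_field K"
    and "CHAR('k) \<noteq> 2"
    and "is_completion K v"
    and "transpose B = B"
    and "nondegenerate_qf B"
    and "isotropic_qf B"
    and "x \<in> coset_space (SL3 UNIV) (SL3 (nu_integers K v))"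
    and "compactin (homogeneous_space K v)
           ((homogeneous_space K v) closure_of (orbit (stabilizer_qf B) x))"
  shows "orbit (stabilizer_qf B) x =
           (homogeneous_space K v) closure_of (orbit (stabilizer_qf B) x)"
proof -
  interpret completion K v by unfold_locales fact+
  have two: "(2 :: 'k) \<noteq> 0"
  proof
    assume "(2 :: 'k) = 0"
    then have "of_nat 2 = (0 :: 'k)" by simp
    then have "CHAR('k) dvd 2" by (simp only: of_nat_eq_0_iff_char_dvd)
    then have "CHAR('k) \<le> 2" by (rule dvd_imp_le) simp
    then show False using assms(2) char CHAR_not_1' by (metis One_nat_def Suc_1 le_SucE le_zero_eq not_gr0)
  qed
  obtain P a where P: "det P \<noteq> 0" "a \<noteq> 0" "act B P = mat a ** normal_form 0"
    using isotropic_normal_form[OF two assms(4-6)] by blast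
  obtain A0 where A0: "A0 \<in> G" "x = coset A0" using QE[OF assms(7)] by blast
  define O' where "O' = orbit (stabilizer_qf B) x"
  define X where "X = \<X> closure_of O'"
  have O': "O' = {coset (h ** A0) | h. h \<in> stabilizer_qf B}"
    by (simp add: O'_def orbit_def A0(2) left_coset_coset)
  have stab_G: "h \<in> G" if "h \<in> stabilizer_qf B" for h using that by (simp add: stabilizer_qf_def)
  have O_Q: "O' \<subseteq> Q" using coset_Q SL3_mult[OF stab_G A0(1)] by (auto simp: O')
  have O_X: "O' \<subseteq> X" unfolding X_def by (rule closure_of_subset) (simp add: topspace_T O_Q)
  have closed_X: "closedin \<X> X" by (simp add: X_def)
  have X_Q: "X \<subseteq> Q" using closedin_subset[OF closed_X] by (simp add: topspace_T)
  have seq: "\<exists>s. (\<forall>k. s k \<in> G \<and> coset (s k) \<in> O') \<and> mconv s A" if "A \<in> G" "coset A \<in> X" for A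
    using closure_of_seq[OF O_Q that(1)] that(2) by (simp add: X_def)
  interpret compact_invariant_family K v B P a X
  proof (unfold_locales; (fact two assms(4) P closed_X)?)
    show "compactin \<X> X" using assms(8) by (simp add: X_def O'_def)
    fix A h assume A: "A \<in> G" "coset A \<in> X" and h: "h \<in> stabilizer_qf B"
    obtain s where s: "\<And>k. s k \<in> G" "\<And>k. coset (s k) \<in> O'" "mconv s A" using seq[OF A] by blast
    have "coset (h ** s k) \<in> O'" for k
    proof -
      obtain g where g: "g \<in> stabilizer_qf B" "coset (s k) = coset (g ** A0)" using s(2)[of k] by (auto simp: O')
      have "coset (h ** s k) = coset (h ** g ** A0)"
        using arg_cong[OF g(2), of "left_coset h"] by (simp add: left_coset_coset matrix_mul_assoc)
      then show ?thesis using stabilizer_mult[OF h g(1)] by (auto simp: O')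
    qed
    then have "\<forall>k. h ** s k \<in> G \<and> coset (h ** s k) \<in> X" using O_X SL3_mult[OF stab_G[OF h] s(1)] by blast
    moreover have "mconv (\<lambda>k. h ** s k) (h ** A)" by (intro mconv_mult mconv_const s(3))
    moreover have "h ** A \<in> G" by (rule SL3_mult[OF stab_G[OF h] A(1)])
    ultimately show "coset (h ** A) \<in> X" using closed_X unfolding closedin_T_seq[OF X_Q] by (metis (no_types))
  qed
  have "X \<subseteq> O'"
  proof
    fix c assume c: "c \<in> X"
    then obtain A where A: "A \<in> G" "c = coset A" using X_Q QE by blast
    then obtain s where s: "\<And>k. s k \<in> G" "\<And>k. coset (s k) \<in> O'" "mconv s A" using seq c by blast
    have sl: "s k \<in> lifts" for k using s(1,2) O_X by (auto simp: lifts_def)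
    \<comment> \<open>As nothing accumulates at A from outside of H A, H being the stabiliser, some
      approximating lift \<open>s k\<close> is itself in H A. So the coset of A lies in the same
      orbit as that of \<open>s k\<close>, which is \<open>O'\<close>.\<close>
    have "A \<notin> acc" using acc_empty by simp
    moreover have "A \<in> lifts" using A c by (simp add: lifts_def)
    ultimately obtain k where k: "s k ** inv3 A \<in> stabilizer_qf B" using s(3) sl unfolding acc_def by blast
    obtain g where g: "g \<in> stabilizer_qf B" "coset (s k) = coset (g ** A0)" using s(2)[of k] by (auto simp: O')
    have hg: "inv3 (s k ** inv3 A) ** g \<in> stabilizer_qf B" by (rule stabilizer_mult[OF stabilizer_inv3[OF k] g(1)])
    have d: "det A \<noteq> 0" "det (s k) \<noteq> 0" using SL3_det[OF A(1)] SL3_det[OF s(1)[of k]] by simp_all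
    have "coset A = left_coset (inv3 (s k ** inv3 A)) (coset (s k))"
      using d by (simp add: left_coset_coset inv3_mult det_inv3 inv3_inv3 inv3 flip: matrix_mul_assoc)
    also have "\<dots> = coset (inv3 (s k ** inv3 A) ** g ** A0)" by (simp add: g(2) left_coset_coset matrix_mul_assoc)
    finally show "c \<in> O'" using hg A(2) by (auto simp: O')
  qed
  then show ?thesis using O_X by (simp add: X_def O'_def)
qed

end
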